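(* Let $E$ and $F$ be meteor graphs of length three in normal form such that $F$ is obtained from $E$ by a finite sequence of in-splittings, out-splittings, in-amalgamations at interior vertices, and out-amalgamations at interior vertices. Then $E\approx F$.
   Context: A (directed) graph $E=(E^0,E^1,s,r)$ has vertices $E^0$, edges $E^1$ (parallel edges and loops allowed), source and range maps $s,r$. A graph is essential if it is finite, connected, and has no sinks and no sources. A cycle is a path $e_1\cdots e_n$ ($n\ge1$) with $r(e_n)=s(e_1)$ and $s(e_1),\dots,s(e_n)$ distinct (up to cyclic rotation; $|C|$ is the length). Cycles are disjoint if every vertex is the base of at most one cycle; then write $C_1\ge C_2$ if there is a path from a vertex of $C_1$ to a vertex of $C_2$. In-splitting: for each $v\in E^0$ with $r^{-1}(v)\neq\emptyset$ choose a partition $\{\mathcal E^v_1,\dots,\mathcal E^v_{m(v)}\}$ of $r^{-1}(v)$ into nonempty sets; if $r^{-1}(v)=\emptyset$ put $m(v)=1$, $v_1=v$. The resulting in-splitting $F$ of $E$ has vertices $v_i$ ($v\in E^0$, $1\le i\le m(v)$) and edges $e_j$ ($e\in E^1$, $1\le j\le m(s(e))$), with $s(e_j)=s(e)_j$ and $r(e_j)=r(e)_i$ where $e\in\mathcal E^{r(e)}_i$; it is an in-splitting at $v$ if $m(w)=1$ for all $w\ne v$. An out-splitting of $E$ is a graph whose transpose is an in-splitting of the transpose of $E$. If $F$ is an in-splitting (out-splitting) of $E$, then $E$ is an in-amalgamation (out-amalgamation) of $F$; it is an amalgamation at an interior vertex if the splitting from $E$ to $F$ is at an interior vertex of $E$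 (a vertex on a trail but not on a cycle). Meteor graph of length three: a connected essential graph $E$ whose cycles are exactly three disjoint cycles $P_E,Q_E,R_E$, forming a unique chain $P_E>Q_E>R_E$. Put $x^E=|P_E|$, $y^E=|Q_E|$, $z^E=|R_E|$. A trail from a cycle $A$ to a cycle $B\neq A$ is a path $\alpha=e_1\cdots e_n$, $n\ge1$, $|\alpha|=n$, with $s(e_1)\in A^0$, $r(e_n)\in B^0$ and no $s(e_i)$, $1<i\le n$, on any cycle. Its interior vertices are its vertices not on cycles. Normal form: there are vertices $p_1\in P_E^0$, $q_1\in Q_E^0$, $r_1\in R_E^0$ such that all trails from $P_E$ to $Q_E$ go from $p_1$ to $q_1$, all trails from $Q_E$ to $R_E$ go from $q_1$ to $r_1$, all trails from $P_E$ to $R_E$ go from $p_1$ to $r_1$; distinct trails have no common interior vertices; and for each pair of distinct cycles $(A,B)$ and trails $\alpha,\beta$ from $A$ to $B$: if $|\alpha|\equiv|\beta|\pmod{\gcd(|A|,|B|)}$ then $|\alpha|=|\beta|$, and if $|\alpha|\equiv t\pmod{\gcd(|A|,|B|)}$ with $0\le t<\gcd(|A|,|B|)$ then $|\alpha|\equiv t\pmod{|A||B|}$. The cycles of graphs related by these moves are identified, and the distinguished vertices $p_1,q_1,r_1$ of $E$ and $F$ correspond under this identification (when a vertex on a cycle is split, the unique resulting vertex on the cycle keeps its label). Counts: $N_1^E(c)$ is the number of trails from $P_E$ to $Q_E$ of length $\equiv c$ mod $\gcd(x^E,y^E)$ ($1\le c\le\gcd(x^E,y^E)$); $N_2^E(c)$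 the number of trails from $Q_E$ to $R_E$ of length $\equiv c$ mod $\gcd(y^E,z^E)$ ($1\le c\le\gcd(y^E,z^E)$); $N_E(c)$ the number of trails from $P_E$ to $R_E$ of length $\equiv c$ mod $\gcd(x^E,z^E)$ ($1\le c\le \gcd(x^E,z^E)$). For $1\le a,b\le\delta:=\gcd(x^E,y^E,z^E)$, $S_1^E(a)=\sum N_1^E(k)$ over $1\le k\le\gcd(x^E,y^E)$ with $k\equiv a\pmod\delta$, and $S_2^E(b)=\sum N_2^E(k)$ over $1\le k\le \gcd(y^E,z^E)$ with $k\equiv b\pmod \delta$. Definition of $E\approx F$ (for meteor graphs of length three in normal form): (i) $x^E=x^F=:x$, $y^E=y^F=:y$, $z^E=z^F=:z$; (ii) $N_1^E(c)=N_1^F(c)$ for all $1\le c\le\gcd(x,y)$; (iii) $N_2^E(c)=N_2^F(c)$ for all $1\le c\le\gcd(y,z)$; (iv) with $\delta=\gcd(x,y,z)$, $S_1:=S_1^E=S_1^F$, $S_2:=S_2^E=S_2^F$, there are integers $g_1,\dots,g_\delta$, $l_1,\dots,l_\delta$ such that $\operatorname{lcm}(x,y)\mid l_a$ and $\operatorname{lcm}(y,z)\mid g_a$ for all $a$; $l_a=0$ whenever $S_1(a)=0$; $g_b=0$ whenever $S_2(b)=0$; and for all $1\le h\le\gcd(x,z)$ $$N_F(h)-N_E(h)=\frac{\delta}{y\gcd(x,z)}\Bigl(\sum_{\substack{1\le a,b\le \delta\\ a+b\equiv h\,(\mathrm{mod}\ \delta)}}S_1(a)g_b+\sum_{\substack{1\le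 a,b\le \delta\\ a+b\equiv h\,(\mathrm{mod}\ \delta)}}l_aS_2(b)\Bigr).$$ *)

theory Defs
  imports "Graph_Theory.Graph_Theory" "HOL-Library.Disjoint_Sets" "HOL-Number_Theory.Cong"
begin

section \<open>Cycles and essential graphs\<close>

text \<open>
  Graphs are values of type \<^typ>\<open>('a, 'b) pre_digraph\<close>: source is \<^const>\<open>tail\<close>, range is
  \<^const>\<open>head\<close>; parallel arcs and loops are allowed. A cycle is represented by its list of arcs
  (\<^const>\<open>pre_digraph.cycle\<close>), and two lists represent the same cycle iff they are rotations of
  each other. The length of a cycle is the length of any such list.
\<close>

definition same_cycle :: "'b list \<Rightarrow> 'b list \<Rightarrow> bool" where
  "same_cycle C D \<longleftrightarrow> (\<exists>n. D = rotate n C)"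

definition verts_of_cycle :: "('a, 'b) pre_digraph \<Rightarrow> 'b list \<Rightarrow> 'a set" where
  "verts_of_cycle G C = tail G ` set C"

definition cycle_verts :: "('a, 'b) pre_digraph \<Rightarrow> 'a set" where
  "cycle_verts G = (\<Union>C \<in> {C. pre_digraph.cycle G C}. verts_of_cycle G C)"

definition disjoint_cycles :: "('a, 'b) pre_digraph \<Rightarrow> bool" where
  "disjoint_cycles G \<longleftrightarrow>
    (\<forall>v \<in> verts G. \<forall>C D.
       pre_digraph.cycle G C \<and> pre_digraph.awalk G v C v \<and>
       pre_digraph.cycle G D \<and> pre_digraph.awalk G v D v \<longrightarrow> C = D)"

definition cycle_ge :: "('a, 'b) pre_digraph \<Rightarrow> 'b list \<Rightarrow> 'b list \<Rightarrow> bool" where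
  "cycle_ge G C D \<longleftrightarrow>
    (\<exists>u \<in> verts_of_cycle G C. \<exists>v \<in> verts_of_cycle G D. u \<rightarrow>\<^sup>*\<^bsub>G\<^esub> v)"

definition cycle_gt :: "('a, 'b) pre_digraph \<Rightarrow> 'b list \<Rightarrow> 'b list \<Rightarrow> bool" where
  "cycle_gt G C D \<longleftrightarrow> cycle_ge G C D \<and> \<not> same_cycle C D"

definition essential :: "('a, 'b) pre_digraph \<Rightarrow> bool" where
  "essential G \<longleftrightarrow> fin_digraph G \<and> connected G \<and>
    (\<forall>v \<in> verts G. out_arcs G v \<noteq> {} \<and> in_arcs G v \<noteq> {})"

section \<open>In- and out-splittings\<close>

text \<open>
  A splitting is given by the number \<open>m v\<close> of copies of each vertex \<open>v\<close> and, for \<open>i \<in> {1..m v}\<close>,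
  the \<open>i\<close>-th set \<open>X v i\<close> of the partition of the arcs with range \<open>v\<close>. The copies of a vertex \<open>v\<close>
  and of an arc \<open>e\<close> are the pairs \<open>(v, i)\<close> and \<open>(e, j)\<close>.
\<close>

definition splitting_data ::
    "('a, 'b) pre_digraph \<Rightarrow> ('a \<Rightarrow> nat) \<Rightarrow> ('a \<Rightarrow> nat \<Rightarrow> 'b set) \<Rightarrow> bool" where
  "splitting_data E m X \<longleftrightarrow>
    (\<forall>v \<in> verts E.
       if in_arcs E v = {} then m v = 1
       else (\<Union>i \<in> {1..m v}. X v i) = in_arcs E v \<and>
            disjoint_family_on (X v) {1..m v} \<and>
            (\<forall>i \<in> {1..m v}. X v i \<noteq> {}))"

definition in_split ::
    "('a, 'b) pre_digraph \<Rightarrow> ('a \<Rightarrow> nat) \<Rightarrow> ('a \<Rightarrow> nat \<Rightarrow> 'b set) \<Rightarrow>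
     ('a \<times> nat, 'b \<times> nat) pre_digraph" where
  "in_split E m X =
    \<lparr> verts = {(v, i). v \<in> verts E \<and> i \<in> {1..m v}},
      arcs = {(e, j). e \<in> arcs E \<and> j \<in> {1..m (tail E e)}},
      tail = (\<lambda>(e, j). (tail E e, j)),
      head = (\<lambda>(e, j). (head E e, THE i. i \<in> {1..m (head E e)} \<and> e \<in> X (head E e) i)) \<rparr>"

text \<open>
  \<open>F\<close> is (a copy, under an isomorphism, of) an in-splitting of \<open>E\<close> with \<open>m v\<close> copies of \<open>v\<close>;
  \<open>\<phi> (v, i)\<close> is the vertex of \<open>F\<close> that is the \<open>i\<close>-th copy of \<open>v\<close>. Admitting isomorphic copies
  lets all graphs of a sequence of moves have the same type.
\<close>

definition in_splitting ::
    "('a, 'b) pre_digraph \<Rightarrow> ('c, 'd) pre_digraph \<Rightarrow> ('a \<Rightarrow> nat) \<Rightarrow> ('a \<times> nat \<Rightarrow> 'c) \<Rightarrow> bool" where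
  "in_splitting E F m \<phi> \<longleftrightarrow> wf_digraph E \<and>
    (\<exists>X h. splitting_data E m X \<and>
       pre_digraph.digraph_isomorphism (in_split E m X) h \<and>
       F = app_iso h (in_split E m X) \<and> \<phi> = iso_verts h)"

definition transpose_digraph :: "('a, 'b) pre_digraph \<Rightarrow> ('a, 'b) pre_digraph" where
  "transpose_digraph G = \<lparr> verts = verts G, arcs = arcs G, tail = head G, head = tail G \<rparr>"

definition out_splitting ::
    "('a, 'b) pre_digraph \<Rightarrow> ('c, 'd) pre_digraph \<Rightarrow> ('a \<Rightarrow> nat) \<Rightarrow> ('a \<times> nat \<Rightarrow> 'c) \<Rightarrow> bool" where
  "out_splitting E F m \<phi> \<longleftrightarrow> in_splitting (transpose_digraph E) (transpose_digraph F) m \<phi>"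

definition splitting_at :: "('a, 'b) pre_digraph \<Rightarrow> ('a \<Rightarrow> nat) \<Rightarrow> 'a \<Rightarrow> bool" where
  "splitting_at E m v \<longleftrightarrow> (\<forall>w \<in> verts E. w \<noteq> v \<longrightarrow> m w = 1)"

section \<open>Trails\<close>

text \<open>
  Trails between cycles; unrelated to \<^const>\<open>pre_digraph.trail\<close>.
  \<^const>\<open>pre_digraph.inner_verts\<close> lists the sources of all arcs but the first.
\<close>

definition cycle_trail :: "('a, 'b) pre_digraph \<Rightarrow> 'b list \<Rightarrow> 'b list \<Rightarrow> 'b list \<Rightarrow> bool" where
  "cycle_trail G A B \<alpha> \<longleftrightarrow>
    pre_digraph.cycle G A \<and> pre_digraph.cycle G B \<and> \<not> same_cycle A B \<and> \<alpha> \<noteq> [] \<and>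
    (\<exists>u \<in> verts_of_cycle G A. \<exists>v \<in> verts_of_cycle G B. pre_digraph.awalk G u \<alpha> v) \<and>
    set (pre_digraph.inner_verts G \<alpha>) \<inter> cycle_verts G = {}"

definition trail_interior :: "('a, 'b) pre_digraph \<Rightarrow> 'b list \<Rightarrow> 'a set" where
  "trail_interior G \<alpha> = (tail G ` set \<alpha> \<union> head G ` set \<alpha>) - cycle_verts G"

definition interior_vertex :: "('a, 'b) pre_digraph \<Rightarrow> 'a \<Rightarrow> bool" where
  "interior_vertex G v \<longleftrightarrow> (\<exists>A B \<alpha>. cycle_trail G A B \<alpha> \<and> v \<in> trail_interior G \<alpha>)"

section \<open>Moves\<close>

text \<open>
  \<open>move G H \<sigma>\<close>: the graph \<open>H\<close> arises from \<open>G\<close> by one move, and \<open>\<sigma>\<close> is the identification of the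
  vertices on cycles of \<open>G\<close> with those of \<open>H\<close> that the move induces. For a splitting it pairs
  \<open>v\<close> with the copy of \<open>v\<close> that lies on a cycle; for an amalgamation it is the converse.
\<close>

definition copy_rel ::
    "('a, 'b) pre_digraph \<Rightarrow> ('c, 'd) pre_digraph \<Rightarrow> ('a \<Rightarrow> nat) \<Rightarrow> ('a \<times> nat \<Rightarrow> 'c) \<Rightarrow>
     ('a \<times> 'c) set" where
  "copy_rel E F m \<phi> =
    {(v, w). v \<in> verts E \<and> w \<in> cycle_verts F \<and> (\<exists>i \<in> {1..m v}. w = \<phi> (v, i))}"

inductive move ::
    "('a, 'b) pre_digraph \<Rightarrow> ('a, 'b) pre_digraph \<Rightarrow> ('a \<times> 'a) set \<Rightarrow> bool" where
  in_split: "in_splitting G H m \<phi> \<Longrightarrow> move G H (copy_rel G H m \<phi>)"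
| out_split: "out_splitting G H m \<phi> \<Longrightarrow> move G H (copy_rel G H m \<phi>)"
| in_amalg: "in_splitting H G m \<phi> \<Longrightarrow> interior_vertex H v \<Longrightarrow> splitting_at H m v \<Longrightarrow>
    move G H ((copy_rel H G m \<phi>)\<inverse>)"
| out_amalg: "out_splitting H G m \<phi> \<Longrightarrow> interior_vertex H v \<Longrightarrow> splitting_at H m v \<Longrightarrow>
    move G H ((copy_rel H G m \<phi>)\<inverse>)"

inductive moves ::
    "('a, 'b) pre_digraph \<Rightarrow> ('a, 'b) pre_digraph \<Rightarrow> ('a \<times> 'a) set \<Rightarrow> bool" where
  refl: "moves G G (Id_on (cycle_verts G))"
| step: "moves G H \<rho> \<Longrightarrow> move H K \<sigma> \<Longrightarrow> moves G K (\<rho> O \<sigma>)"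

section \<open>Meteor graphs of length three\<close>

definition meteor_graph3 ::
    "('a, 'b) pre_digraph \<Rightarrow> 'b list \<Rightarrow> 'b list \<Rightarrow> 'b list \<Rightarrow> bool" where
  "meteor_graph3 G P Q R \<longleftrightarrow>
    essential G \<and> disjoint_cycles G \<and>
    (\<forall>C. pre_digraph.cycle G C \<longleftrightarrow> same_cycle P C \<or> same_cycle Q C \<or> same_cycle R C) \<and>
    \<not> same_cycle P Q \<and> \<not> same_cycle Q R \<and> \<not> same_cycle P R \<and>
    cycle_gt G P Q \<and> cycle_gt G Q R"

definition normal_form ::
    "('a, 'b) pre_digraph \<Rightarrow> 'b list \<Rightarrow> 'b list \<Rightarrow> 'b list \<Rightarrow> 'a \<Rightarrow> 'a \<Rightarrow> 'a \<Rightarrow> bool" where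
  "normal_form G P Q R p q r \<longleftrightarrow>
    p \<in> verts_of_cycle G P \<and> q \<in> verts_of_cycle G Q \<and> r \<in> verts_of_cycle G R \<and>
    (\<forall>\<alpha>. cycle_trail G P Q \<alpha> \<longrightarrow> pre_digraph.awalk G p \<alpha> q) \<and>
    (\<forall>\<alpha>. cycle_trail G Q R \<alpha> \<longrightarrow> pre_digraph.awalk G q \<alpha> r) \<and>
    (\<forall>\<alpha>. cycle_trail G P R \<alpha> \<longrightarrow> pre_digraph.awalk G p \<alpha> r) \<and>
    (\<forall>A B A' B' \<alpha> \<beta>. cycle_trail G A B \<alpha> \<and> cycle_trail G A' B' \<beta> \<and> \<alpha> \<noteq> \<beta> \<longrightarrow>
       trail_interior G \<alpha> \<inter> trail_interior G \<beta> = {}) \<and>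
    (\<forall>A B \<alpha> \<beta>. cycle_trail G A B \<alpha> \<and> cycle_trail G A B \<beta> \<and>
       [length \<alpha> = length \<beta>] (mod gcd (length A) (length B)) \<longrightarrow> length \<alpha> = length \<beta>) \<and>
    (\<forall>A B \<alpha> t. cycle_trail G A B \<alpha> \<and> t < gcd (length A) (length B) \<and>
       [length \<alpha> = t] (mod gcd (length A) (length B)) \<longrightarrow>
       [length \<alpha> = t] (mod length A * length B))"

text \<open>
  For a meteor graph \<open>G\<close> with cycles \<open>P, Q, R\<close>, the counts \<open>N\<^sub>1, N\<^sub>2, N\<close> are \<open>trail_count G P Q\<close>,
  \<open>trail_count G Q R\<close>, \<open>trail_count G P R\<close>; with \<open>d = gcd(x, y, z)\<close>, the sums \<open>S\<^sub>1, S\<^sub>2\<close> are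
  \<open>trail_sum G P Q d\<close> and \<open>trail_sum G Q R d\<close>.
\<close>

definition trail_count :: "('a, 'b) pre_digraph \<Rightarrow> 'b list \<Rightarrow> 'b list \<Rightarrow> nat \<Rightarrow> nat" where
  "trail_count G A B c =
    card {\<alpha>. cycle_trail G A B \<alpha> \<and> [length \<alpha> = c] (mod gcd (length A) (length B))}"

definition trail_sum :: "('a, 'b) pre_digraph \<Rightarrow> 'b list \<Rightarrow> 'b list \<Rightarrow> nat \<Rightarrow> nat \<Rightarrow> nat" where
  "trail_sum G A B d a =
    (\<Sum>k \<in> {k \<in> {1..gcd (length A) (length B)}. [k = a] (mod d)}. trail_count G A B k)"

definition meteor_equiv ::
    "('a, 'b) pre_digraph \<Rightarrow> 'b list \<Rightarrow> 'b list \<Rightarrow> 'b list \<Rightarrow>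
     ('c, 'd) pre_digraph \<Rightarrow> 'd list \<Rightarrow> 'd list \<Rightarrow> 'd list \<Rightarrow> bool" where
  "meteor_equiv E P Q R F P' Q' R' \<longleftrightarrow>
    (let x = length P; y = length Q; z = length R;
         d = gcd x (gcd y z);
         S1 = trail_sum E P Q d; S2 = trail_sum E Q R d
     in length P' = x \<and> length Q' = y \<and> length R' = z \<and>
        (\<forall>c \<in> {1..gcd x y}. trail_count E P Q c = trail_count F P' Q' c) \<and>
        (\<forall>c \<in> {1..gcd y z}. trail_count E Q R c = trail_count F Q' R' c) \<and>
        (\<exists>g l :: nat \<Rightarrow> int.
           (\<forall>a \<in> {1..d}. int (lcm x y) dvd l a \<and> int (lcm y z) dvd g a) \<and>
           (\<forall>a \<in> {1..d}. S1 a = 0 \<longrightarrow> l a = 0) \<and>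
           (\<forall>b \<in> {1..d}. S2 b = 0 \<longrightarrow> g b = 0) \<and>
           (\<forall>h \<in> {1..gcd x z}.
              rat_of_nat (trail_count F P' R' h) - rat_of_nat (trail_count E P R h) =
              rat_of_nat d / rat_of_nat (y * gcd x z) *
              rat_of_int
                ((\<Sum>(a, b) \<in> {(a, b). a \<in> {1..d} \<and> b \<in> {1..d} \<and> [a + b = h] (mod d)}.
                    int (S1 a) * g b) +
                 (\<Sum>(a, b) \<in> {(a, b). a \<in> {1..d} \<and> b \<in> {1..d} \<and> [a + b = h] (mod d)}.
                    l a * int (S2 b))))))"

end

theory Submission
  imports Defs "HOL-Computational_Algebra.Polynomial_FPS"
begin

text \<open>
  Fix vertices \<open>p, q, r\<close> on the three cycles. A first passage is a nonempty walk between two of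
  them whose interior avoids all three. Let \<open>A\<close> be the \<open>3 \<times> 3\<close> matrix of the generating functions
  of first passages, counted by length. For a meteor graph in normal form it is upper triangular
  with diagonal \<open>t^x, t^y, t^z\<close>, and the entries \<open>f, g, h\<close> above the diagonal are the generating
  polynomials of the trails from \<open>P\<close> to \<open>Q\<close>, from \<open>Q\<close> to \<open>R\<close> and from \<open>P\<close> to \<open>R\<close>
  (\<open>normal_meteor.skeleton\<close>). The graphs between \<open>E\<close> and \<open>F\<close> need not be in normal form, but all of
  them have a matrix of this shape, and the moves act on it by simple row and column operations.

  A walk of an in-splitting is determined by its first vertex and its projection, and the last arc
  of the projection determines at which copy the walk ends. Let \<open>B\<close> count the first passages of the
  original graph that end at a copy different from the marked one. Cutting a first passage of the
  splitting at its first visit to a wrong copy gives \<open>A' = (A - B) + B A'\<close>, that is,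
  \<open>1 - A = (1 - B) (1 - A')\<close> (\<open>marked_passages_gf\<close>). A walk once around a marked cycle ends at the
  marked copy, so \<open>B\<close> is strictly upper triangular. The same identity serves an amalgamation, read
  in the opposite direction, and out-splittings are in-splittings of the transposed graph. Hence
  all moves stay inside one equivalence relation on triples \<open>(f, g, h)\<close>: there are integer
  polynomials \<open>u, v\<close> with \<open>f' \<equiv> f + u (1 - t^y)\<close> modulo \<open>1 - t^x\<close>, \<open>g' \<equiv> g + v (1 - t^y)\<close> modulo
  \<open>1 - t^z\<close>, and \<open>h' \<equiv> h - u g - f' v\<close> modulo \<open>1 - t^gcd(x, z)\<close> (\<open>trail_relation\<close>).

  Reducing the first two congruences modulo \<open>1 - t^gcd(x, y)\<close> and \<open>1 - t^gcd(y, z)\<close> yields the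
  invariance of \<open>N\<^sub>1\<close> and \<open>N\<^sub>2\<close>. The length conditions of the normal form say that \<open>f\<close> modulo
  \<open>1 - t^x\<close> is determined by \<open>N\<^sub>1\<close>; so \<open>u (1 - t^y) \<equiv> 0\<close>, and the coefficients of \<open>u\<close>, summed over
  residue classes modulo \<open>x\<close>, are periodic with period \<open>gcd(x, y)\<close>. Summed over residue classes
  modulo \<open>gcd(x, z)\<close> they are therefore periodic with period \<open>\<delta>\<close> and divisible by
  \<open>x / lcm(gcd(x, y), gcd(x, z))\<close>. Up to the factor \<open>- y gcd(x, z) / \<delta>\<close> they are the integers \<open>l\<^sub>a\<close>,
  and \<open>u g\<close> gives the sum over \<open>l\<^sub>a S\<^sub>2(b)\<close>. In the same way \<open>v\<close> provides the integers \<open>g\<^sub>b\<close>. Finally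
  \<open>l\<^sub>a\<close> vanishes when \<open>S\<^sub>1(a)\<close> does, because \<open>u\<close> is made up of first passages from \<open>p\<close> to \<open>q\<close>, and
  the residue classes modulo \<open>\<delta>\<close> of their lengths do not change under the moves
  (\<open>trail_relation_counts\<close>).
\<close>

section \<open>Generating functions of sets of walks\<close>

unbundle fps_syntax

definition walk_gf :: "'b list set \<Rightarrow> int fps" where
  "walk_gf L = Abs_fps (\<lambda>n. int (card {\<alpha> \<in> L. length \<alpha> = n}))"

lemma walk_gf_nth: "walk_gf L $ n = int (card {\<alpha> \<in> L. length \<alpha> = n})"
  by (simp add: walk_gf_def)

lemma finite_slice:
  assumes "finite A" and "L \<subseteq> lists A"
  shows "finite {\<alpha> \<in> L. length \<alpha> = n}"
proof -
  have "{\<alpha> \<in> L. length \<alpha> = n} \<subseteq> {\<alpha>. set \<alpha> \<subseteq> A \<and> length \<alpha> = n}"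
    using assms(2) by auto
  then show ?thesis
    using finite_lists_length_eq[OF assms(1)] finite_subset by blast
qed

lemma walk_gf_mono:
  assumes "finite A" and "M \<subseteq> lists A" and "L \<subseteq> M"
  shows "walk_gf L $ n \<le> walk_gf M $ n"
  unfolding walk_gf_nth of_nat_le_iff
  using assms(3) by (intro card_mono finite_slice[OF assms(1,2)]) auto

lemma walk_gf_Un:
  assumes "finite A" and "L \<subseteq> lists A" and "M \<subseteq> lists A" and "L \<inter> M = {}"
  shows "walk_gf (L \<union> M) = walk_gf L + walk_gf M"
proof (rule fps_ext)
  fix n
  have "{\<alpha> \<in> L \<union> M. length \<alpha> = n} = {\<alpha> \<in> L. length \<alpha> = n} \<union> {\<alpha> \<in> M. length \<alpha> = n}"
    by auto
  moreover have "{\<alpha> \<in> L. length \<alpha> = n} \<inter> {\<alpha> \<in> M. length \<alpha> = n} = {}"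
    using assms(4) by auto
  ultimately show "walk_gf (L \<union> M) $ n = (walk_gf L + walk_gf M) $ n"
    by (simp add: walk_gf_nth card_Un_disjoint finite_slice[OF assms(1,2)]
        finite_slice[OF assms(1,3)])
qed

lemma walk_gf_UNION:
  assumes "finite A" and "finite I" and "\<And>i. i \<in> I \<Longrightarrow> L i \<subseteq> lists A"
    and "disjoint_family_on L I"
  shows "walk_gf (\<Union>i\<in>I. L i) = (\<Sum>i\<in>I. walk_gf (L i))"
  using assms(2-4)
proof (induction I)
  case empty
  have "walk_gf ({} :: 'a list set) = 0"
    by (rule fps_ext) (simp add: walk_gf_nth)
  then show ?case by simp
next
  case (insert i I)
  have "L i \<inter> (\<Union>i\<in>I. L i) = {}"
    using insert.prems(2) insert.hyps(2) unfolding disjoint_family_on_def by fastforce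
  moreover have "disjoint_family_on L I"
    using insert.prems(2) unfolding disjoint_family_on_def by blast
  ultimately show ?case
    using insert assms(1) by (auto simp: walk_gf_Un[where A = A] UN_subset_iff)
qed

lemma walk_gf_image:
  assumes "inj_on f L" and "\<And>\<alpha>. \<alpha> \<in> L \<Longrightarrow> length (f \<alpha>) = length \<alpha>"
  shows "walk_gf (f ` L) = walk_gf L"
proof (rule fps_ext)
  fix n
  have "{\<alpha> \<in> f ` L. length \<alpha> = n} = f ` {\<alpha> \<in> L. length \<alpha> = n}"
    using assms(2) by auto
  moreover have "inj_on f {\<alpha> \<in> L. length \<alpha> = n}"
    using assms(1) by (auto simp: inj_on_def)
  ultimately show "walk_gf (f ` L) $ n = walk_gf L $ n"
    by (simp add: walk_gf_nth card_image)
qed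

lemma walk_gf_concat:
  assumes "finite A" and "L \<subseteq> lists A" and "M \<subseteq> lists A"
    and inj: "inj_on (\<lambda>(\<alpha>, \<beta>). \<alpha> @ \<beta>) (L \<times> M)"
  shows "walk_gf ((\<lambda>(\<alpha>, \<beta>). \<alpha> @ \<beta>) ` (L \<times> M)) = walk_gf L * walk_gf M"
proof (rule fps_ext)
  fix n
  let ?c = "\<lambda>(\<alpha>, \<beta>). \<alpha> @ \<beta>"
  let ?s = "\<lambda>L n. {\<alpha> \<in> L. length \<alpha> = n}"
  have eq: "?s (?c ` (L \<times> M)) n = ?c ` (\<Union>i\<in>{0..n}. ?s L i \<times> ?s M (n - i))"
  proof (intro equalityI subsetI)
    fix \<gamma> assume "\<gamma> \<in> ?s (?c ` (L \<times> M)) n"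
    then obtain \<alpha> \<beta> where *: "\<gamma> = \<alpha> @ \<beta>" "\<alpha> \<in> L" "\<beta> \<in> M" "length \<alpha> + length \<beta> = n"
      by auto
    then have "(\<alpha>, \<beta>) \<in> (\<Union>i\<in>{0..n}. ?s L i \<times> ?s M (n - i))" by auto
    then show "\<gamma> \<in> ?c ` (\<Union>i\<in>{0..n}. ?s L i \<times> ?s M (n - i))" using *(1) by force
  qed auto
  have "inj_on ?c (\<Union>i\<in>{0..n}. ?s L i \<times> ?s M (n - i))"
    by (rule inj_on_subset[OF inj]) auto
  then have "card (?s (?c ` (L \<times> M)) n) = card (\<Union>i\<in>{0..n}. ?s L i \<times> ?s M (n - i))"
    unfolding eq by (rule card_image)
  also have "\<dots> = (\<Sum>i = 0..n. card (?s L i \<times> ?s M (n - i)))"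
    by (rule card_UN_disjoint)
      (auto intro!: finite_cartesian_product finite_slice[OF assms(1,2)] finite_slice[OF assms(1,3)])
  finally show "walk_gf (?c ` (L \<times> M)) $ n = (walk_gf L * walk_gf M) $ n"
    by (simp add: walk_gf_nth fps_mult_nth card_cartesian_product)
qed

section \<open>First passages\<close>

definition first_passages :: "('a, 'b) pre_digraph \<Rightarrow> 'a set \<Rightarrow> 'a \<Rightarrow> 'a \<Rightarrow> 'b list set" where
  "first_passages G S u v =
    {\<alpha>. \<alpha> \<noteq> [] \<and> pre_digraph.awalk G u \<alpha> v \<and> head G ` set (butlast \<alpha>) \<inter> S = {}}"

definition passage_gf :: "('a, 'b) pre_digraph \<Rightarrow> 'a set \<Rightarrow> 'a \<Rightarrow> 'a \<Rightarrow> int fps" where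
  "passage_gf G S u v = walk_gf (first_passages G S u v)"

lemma (in wf_digraph) awalk_append_ex:
  "awalk u (\<alpha> @ \<beta>) v \<longleftrightarrow> (\<exists>w. awalk u \<alpha> w \<and> awalk w \<beta> v)"
  using awalk_appendI awalk_append_iff by blast

lemma (in wf_digraph) awalk_last: "awalk u \<alpha> v \<Longrightarrow> \<alpha> \<noteq> [] \<Longrightarrow> v = head G (last \<alpha>)"
proof (induction \<alpha> arbitrary: u)
  case (Cons e \<alpha>)
  then show ?case by (cases "\<alpha> = []") (auto simp: awalk_Cons_iff awalk_Nil_iff)
qed simp

lemma first_passages_lists: "first_passages G S u v \<subseteq> lists (arcs G)"
  by (auto simp: first_passages_def pre_digraph.awalk_def)

lemma passage_gf_nonneg: "0 \<le> passage_gf G S u v $ n"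
  by (simp add: passage_gf_def walk_gf_nth)

lemma passage_gf_0: "passage_gf G S u v $ 0 = 0"
  by (simp add: passage_gf_def walk_gf_nth first_passages_def)

lemma passage_gf_eq_0_iff:
  assumes "finite (arcs G)"
  shows "passage_gf G S u v = 0 \<longleftrightarrow> first_passages G S u v = {}"
proof
  assume *: "passage_gf G S u v = 0"
  show "first_passages G S u v = {}"
  proof (rule ccontr)
    assume "first_passages G S u v \<noteq> {}"
    then obtain \<alpha> where \<alpha>: "\<alpha> \<in> first_passages G S u v" by auto
    have "passage_gf G S u v $ length \<alpha> = 0" using * by simp
    then have "{\<beta> \<in> first_passages G S u v. length \<beta> = length \<alpha>} = {}"
      using finite_slice[OF assms first_passages_lists]
      unfolding passage_gf_def walk_gf_nth by (metis card_0_eq of_nat_eq_0_iff)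
    then show False using \<alpha> by auto
  qed
next
  assume "first_passages G S u v = {}"
  then show "passage_gf G S u v = 0"
    by (intro fps_ext) (simp add: passage_gf_def walk_gf_nth)
qed

text \<open>
  Cutting at the first arc that enters \<open>S\<close> is the basic decomposition of all later counts.
\<close>

lemma walk_first_visit:
  assumes "wf_digraph G" and "pre_digraph.awalk G u \<alpha> v" and "\<alpha> \<noteq> []" and "v \<in> S"
  obtains \<beta> \<gamma> s where "\<alpha> = \<beta> @ \<gamma>" and "s \<in> S" and "\<beta> \<in> first_passages G S u s"
    and "pre_digraph.awalk G s \<gamma> v"
proof -
  interpret wf_digraph G by fact
  have "\<exists>e\<in>set \<alpha>. head G e \<in> S"
    using assms awalk_last last_in_set by metis
  then obtain xs e ys where *: "\<alpha> = xs @ e # ys" "head G e \<in> S" "\<forall>x\<in>set xs. head G x \<notin> S"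
    using split_list_first_prop[of \<alpha> "\<lambda>e. head G e \<in> S"] by blast
  have "awalk u ((xs @ [e]) @ ys) v" using * assms(2) by simp
  then obtain w where w: "awalk u (xs @ [e]) w" "awalk w ys v"
    unfolding awalk_append_ex by blast
  have "w = head G e" using awalk_last[OF w(1)] by simp
  show ?thesis
  proof (rule that)
    show "\<alpha> = (xs @ [e]) @ ys" "head G e \<in> S" "awalk (head G e) ys v"
      using * w \<open>w = head G e\<close> by auto
    show "xs @ [e] \<in> first_passages G S u (head G e)"
      using w \<open>w = head G e\<close> * by (auto simp: first_passages_def)
  qed
qed

text \<open>
  If one of two first passages were a proper prefix of the other, its end would be an interior
  vertex of the longer one. So the cut of a walk after a first passage is unique.
\<close>

lemma first_passage_prefix_unique:
  assumes "wf_digraph G" and "s \<in> S" "s' \<in> S"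
    and "\<beta> \<in> first_passages G S u s" and "\<beta>' \<in> first_passages G S u s'"
    and "\<beta> @ \<gamma> = \<beta>' @ \<gamma>'"
  shows "\<beta> = \<beta>'"
proof -
  interpret wf_digraph G by fact
  have aux: False
    if "\<beta> \<in> first_passages G S u s" "s \<in> S" "\<beta> @ \<delta> \<in> first_passages G S u s'" "\<delta> \<noteq> []"
    for \<beta> \<delta> s s'
  proof -
    have "\<beta> \<noteq> []" "head G (last \<beta>) \<in> S"
      using that awalk_last by (auto simp: first_passages_def)
    moreover have "last \<beta> \<in> set (butlast (\<beta> @ \<delta>))"
      using that(4) \<open>\<beta> \<noteq> []\<close> by (simp add: butlast_append)
    ultimately show False using that(3) by (auto simp: first_passages_def)
  qed
  consider \<delta> where "\<beta>' = \<beta> @ \<delta>" | \<delta> where "\<beta> = \<beta>' @ \<delta>"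
    using assms(6) by (auto simp: append_eq_append_conv2)
  then show ?thesis using aux assms(2-5) by cases fastforce+
qed

section \<open>First passages in an in-splitting\<close>

text \<open>
  The head of all copies of the arc \<open>e\<close>; it does not depend on the copy.
\<close>

definition split_head ::
    "('a, 'b) pre_digraph \<Rightarrow> ('a \<Rightarrow> nat) \<Rightarrow> ('a \<Rightarrow> nat \<Rightarrow> 'b set) \<Rightarrow> 'b \<Rightarrow> 'a \<times> nat" where
  "split_head E m X e = (head E e, THE i. i \<in> {1..m (head E e)} \<and> e \<in> X (head E e) i)"

lemma in_split_simps [simp]:
  "verts (in_split E m X) = {(v, i). v \<in> verts E \<and> i \<in> {1..m v}}"
  "arcs (in_split E m X) = {(e, j). e \<in> arcs E \<and> j \<in> {1..m (tail E e)}}"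
  "tail (in_split E m X) f = (tail E (fst f), snd f)"
  "head (in_split E m X) f = split_head E m X (fst f)"
  by (auto simp: in_split_def split_head_def case_prod_beta)

lemma fst_split_head [simp]: "fst (split_head E m X e) = head E e"
  by (simp add: split_head_def)

lemma split_head_copy:
  assumes "wf_digraph E" and "splitting_data E m X" and "e \<in> arcs E"
  shows "snd (split_head E m X e) \<in> {1..m (head E e)}"
proof -
  let ?v = "head E e"
  have v: "?v \<in> verts E" "e \<in> in_arcs E ?v"
    using assms(1,3) by (auto simp: wf_digraph_def)
  then have U: "(\<Union>i\<in>{1..m ?v}. X ?v i) = in_arcs E ?v" "disjoint_family_on (X ?v) {1..m ?v}"
    using assms(2) unfolding splitting_data_def by (metis empty_iff)+
  then obtain i where i: "i \<in> {1..m ?v}" "e \<in> X ?v i" using v(2) by blast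
  have "(THE i. i \<in> {1..m ?v} \<and> e \<in> X ?v i) = i"
    using U(2) i unfolding disjoint_family_on_def by (intro the_equality) blast+
  then show ?thesis using i by (simp add: split_head_def)
qed

lemma copies_pos:
  assumes "splitting_data E m X" and "v \<in> verts E"
  shows "1 \<le> m v"
proof (rule ccontr)
  assume "\<not> 1 \<le> m v"
  then have "{1..m v} = {}" "m v \<noteq> 1" by auto
  then show False using assms unfolding splitting_data_def by (metis UN_empty)
qed

lemma wf_in_split:
  assumes "wf_digraph E" and "splitting_data E m X"
  shows "wf_digraph (in_split E m X)"
proof
  fix f assume "f \<in> arcs (in_split E m X)"
  then obtain e j where f: "f = (e, j)" "e \<in> arcs E" "j \<in> {1..m (tail E e)}" by auto
  then show "tail (in_split E m X) f \<in> verts (in_split E m X)"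
    using assms(1) by (auto simp: wf_digraph_def)
  have "split_head E m X e = (head E e, snd (split_head E m X e))"
    by (metis fst_split_head prod.collapse)
  then show "head (in_split E m X) f \<in> verts (in_split E m X)"
    using split_head_copy[OF assms f(2)] f assms(1) by (auto simp: wf_digraph_def)
qed

lemma in_split_walk_project:
  assumes "wf_digraph E" and "splitting_data E m X"
    and "pre_digraph.awalk (in_split E m X) u \<alpha> v"
  shows "pre_digraph.awalk E (fst u) (map fst \<alpha>) (fst v)"
proof -
  interpret E: wf_digraph E by fact
  interpret I: wf_digraph "in_split E m X" by (rule wf_in_split) fact+
  show ?thesis using assms(3)
  proof (induction \<alpha> arbitrary: u)
    case (Cons f \<alpha>)
    then show ?case using Cons.IH[of "split_head E m X (fst f)"]
      by (auto simp: I.awalk_simps E.awalk_simps)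
  qed (auto simp: I.awalk_simps E.awalk_simps)
qed

lemma in_split_walk_lift:
  assumes "wf_digraph E" and "splitting_data E m X"
    and "pre_digraph.awalk E u \<beta> v" and "i \<in> {1..m u}"
  shows "\<exists>\<alpha>. pre_digraph.awalk (in_split E m X) (u, i) \<alpha>
           (last ((u, i) # map (split_head E m X) \<beta>)) \<and> map fst \<alpha> = \<beta>"
proof -
  interpret E: wf_digraph E by fact
  interpret I: wf_digraph "in_split E m X" by (rule wf_in_split) fact+
  show ?thesis using assms(3,4)
  proof (induction \<beta> arbitrary: u i)
    case Nil
    then show ?case by (auto simp: I.awalk_simps E.awalk_simps)
  next
    case (Cons e \<beta>)
    then have e: "e \<in> arcs E" "tail E e = u" "E.awalk (head E e) \<beta> v"
      by (auto simp: E.awalk_simps)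
    let ?h = "split_head E m X e"
    have h: "?h = (head E e, snd ?h)" by (metis fst_split_head prod.collapse)
    obtain \<alpha> where "I.awalk ?h \<alpha> (last (?h # map (split_head E m X) \<beta>))" "map fst \<alpha> = \<beta>"
      using Cons.IH[OF e(3) split_head_copy[OF assms(1,2) e(1)]] h by auto
    then show ?case using e Cons.prems(2)
      by (intro exI[of _ "(e, i) # \<alpha>"]) (auto simp: I.awalk_simps)
  qed
qed

lemma in_split_walk_inj:
  assumes "wf_digraph E" and "splitting_data E m X"
    and "pre_digraph.awalk (in_split E m X) u \<alpha> v" and "pre_digraph.awalk (in_split E m X) u \<beta> w"
    and "map fst \<alpha> = map fst \<beta>"
  shows "\<alpha> = \<beta>"
proof -
  interpret I: wf_digraph "in_split E m X" by (rule wf_in_split) fact+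
  show ?thesis using assms(3-5)
  proof (induction \<alpha> arbitrary: u \<beta>)
    case (Cons f \<alpha>)
    then obtain f' \<beta>' where \<beta>: "\<beta> = f' # \<beta>'" "fst f = fst f'" "map fst \<alpha> = map fst \<beta>'"
      by auto
    moreover have "snd f = snd f'"
      using Cons.prems \<beta> by (auto simp: I.awalk_simps)
    moreover have "\<alpha> = \<beta>'"
      using Cons.IH[of "split_head E m X (fst f)" \<beta>'] Cons.prems(1,2) \<beta>
      by (simp add: I.awalk_Cons_iff)
    ultimately show ?case by (simp add: prod_eq_iff)
  qed simp
qed

text \<open>
  Whether a walk of the splitting is a first passage can be read off its projection.
\<close>

lemma in_split_first_passages:
  assumes "wf_digraph E" and "splitting_data E m X" and "i \<in> {1..m s}"
  shows "map fst ` first_passages (in_split E m X) T (s, i) w =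
    {\<beta>. \<beta> \<noteq> [] \<and> pre_digraph.awalk E s \<beta> (fst w) \<and> split_head E m X (last \<beta>) = w \<and>
        split_head E m X ` set (butlast \<beta>) \<inter> T = {}}" (is "?L = ?R")
proof -
  interpret E: wf_digraph E by fact
  interpret I: wf_digraph "in_split E m X" by (rule wf_in_split) fact+
  show ?thesis
  proof (intro equalityI subsetI)
    fix \<beta> assume "\<beta> \<in> ?L"
    then obtain \<alpha> where \<alpha>: "\<beta> = map fst \<alpha>" "\<alpha> \<noteq> []" "I.awalk (s, i) \<alpha> w"
      "head (in_split E m X) ` set (butlast \<alpha>) \<inter> T = {}"
      by (auto simp: first_passages_def)
    have "w = split_head E m X (fst (last \<alpha>))"
      using I.awalk_last[OF \<alpha>(3,2)] by simp
    then show "\<beta> \<in> ?R"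
      using \<alpha> in_split_walk_project[OF assms(1,2) \<alpha>(3)]
      by (auto simp: last_map map_butlast[symmetric] image_image)
  next
    fix \<beta> assume \<beta>: "\<beta> \<in> ?R"
    then obtain \<alpha> where "I.awalk (s, i) \<alpha> (last ((s, i) # map (split_head E m X) \<beta>))"
      and \<alpha>\<beta>: "map fst \<alpha> = \<beta>"
      using in_split_walk_lift[OF assms(1,2) _ assms(3)] by blast
    moreover have "last ((s, i) # map (split_head E m X) \<beta>) = w"
      using \<beta> by (auto simp: last_map)
    moreover have "head (in_split E m X) ` set (butlast \<alpha>) = split_head E m X ` set (butlast \<beta>)"
      unfolding \<alpha>\<beta>[symmetric] by (simp add: map_butlast[symmetric] image_image)
    moreover have "\<alpha> \<noteq> []" using \<beta> \<alpha>\<beta> by auto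
    ultimately have "\<alpha> \<in> first_passages (in_split E m X) T (s, i) w"
      using \<beta> by (simp add: first_passages_def)
    then show "\<beta> \<in> ?L" using \<alpha>\<beta> by blast
  qed
qed

text \<open>
  For the next two definitions think of \<open>H e\<close> as the head of the copies of the arc \<open>e\<close> in a
  splitting and of \<open>c s\<close> as the marked copy of \<open>s\<close>. A wrong passage ends at a copy of \<open>t\<close> other than
  \<open>c t\<close>; the marked passages are the projections of the first passages between marked copies.
\<close>

definition wrong_passages ::
    "('a, 'b) pre_digraph \<Rightarrow> ('b \<Rightarrow> 'c) \<Rightarrow> ('a \<Rightarrow> 'c) \<Rightarrow> 'a set \<Rightarrow> 'a \<Rightarrow> 'a \<Rightarrow> 'b list set" where
  "wrong_passages E H c S s t = {\<beta> \<in> first_passages E S s t. H (last \<beta>) \<noteq> c t}"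

definition marked_passages ::
    "('a, 'b) pre_digraph \<Rightarrow> ('b \<Rightarrow> 'c) \<Rightarrow> ('a \<Rightarrow> 'c) \<Rightarrow> 'a set \<Rightarrow> 'a \<Rightarrow> 'a \<Rightarrow> 'b list set" where
  "marked_passages E H c S s t =
    {\<beta>. \<beta> \<noteq> [] \<and> pre_digraph.awalk E s \<beta> t \<and> H (last \<beta>) = c t \<and> H ` set (butlast \<beta>) \<inter> c ` S = {}}"

lemma wrong_passages_lists: "wrong_passages E H c S s t \<subseteq> lists (arcs E)"
  using first_passages_lists[of E S s t] by (auto simp: wrong_passages_def)

lemma marked_passages_lists: "marked_passages E H c S s t \<subseteq> lists (arcs E)"
  by (auto simp: marked_passages_def pre_digraph.awalk_def)

text \<open>
  A marked passage may visit \<open>S\<close> in its interior, but only at wrong copies. Cutting at the first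
  such visit leaves a wrong passage and a marked passage that starts at the vertex visited, since
  the copy at which a walk starts has no influence on the copies at which its arcs end.
\<close>

lemma marked_passages_decomp:
  fixes \<pi> :: "'c \<Rightarrow> 'a"
  assumes "wf_digraph E" and "t \<in> S"
    and \<pi>H: "\<And>e. \<pi> (H e) = head E e" and \<pi>c: "\<And>s. s \<in> S \<Longrightarrow> \<pi> (c s) = s"
  shows "marked_passages E H c S s t =
    (first_passages E S s t - wrong_passages E H c S s t) \<union>
    (\<Union>u\<in>S. (\<lambda>(\<beta>, \<gamma>). \<beta> @ \<gamma>) ` (wrong_passages E H c S s u \<times> marked_passages E H c S u t))"
    (is "?M = ?C \<union> ?D")
proof -
  interpret wf_digraph E by fact
  have notin: "H e \<notin> c ` S" if "head E e \<notin> S" for e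
    using that \<pi>H \<pi>c by (metis imageE)
  show ?thesis
  proof (intro equalityI subsetI)
    fix \<beta> assume \<beta>: "\<beta> \<in> ?M"
    show "\<beta> \<in> ?C \<union> ?D"
    proof (cases "\<exists>e\<in>set (butlast \<beta>). head E e \<in> S")
      case False
      then show ?thesis using \<beta>
        by (auto simp: marked_passages_def first_passages_def wrong_passages_def)
    next
      case True
      then obtain xs e ys where *: "butlast \<beta> = xs @ e # ys" "head E e \<in> S"
        "\<forall>x\<in>set xs. head E x \<notin> S"
        using split_list_first_prop[of "butlast \<beta>" "\<lambda>e. head E e \<in> S"] by blast
      have \<beta>eq: "\<beta> = (xs @ [e]) @ (ys @ [last \<beta>])"
        using \<beta> append_butlast_last_id[of \<beta>] * by (simp add: marked_passages_def)
      have "awalk s \<beta> t" using \<beta> by (simp add: marked_passages_def)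
      then obtain w where w: "awalk s (xs @ [e]) w" "awalk w (ys @ [last \<beta>]) t"
        using \<beta>eq awalk_append_ex by metis
      have we: "w = head E e" using awalk_last[OF w(1)] by simp
      have 1: "xs @ [e] \<in> wrong_passages E H c S s (head E e)"
        using w we * \<beta> by (auto simp: wrong_passages_def first_passages_def marked_passages_def)
      have 2: "ys @ [last \<beta>] \<in> marked_passages E H c S (head E e) t"
        using w we * \<beta> by (auto simp: marked_passages_def)
      have "\<beta> \<in> (\<lambda>(\<beta>, \<gamma>). \<beta> @ \<gamma>) `
          (wrong_passages E H c S s (head E e) \<times> marked_passages E H c S (head E e) t)"
        using 1 2 \<beta>eq by (intro image_eqI[of _ _ "(xs @ [e], ys @ [last \<beta>])"]) auto
      then show ?thesis using *(2) by blast
    qed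
  next
    fix \<beta> assume "\<beta> \<in> ?C \<union> ?D"
    then show "\<beta> \<in> ?M"
    proof
      assume "\<beta> \<in> ?C"
      then show ?thesis using notin
        by (auto simp: marked_passages_def first_passages_def wrong_passages_def)
    next
      assume "\<beta> \<in> ?D"
      then obtain u \<gamma> \<delta> where *: "u \<in> S" "\<beta> = \<gamma> @ \<delta>" "\<gamma> \<in> wrong_passages E H c S s u"
        "\<delta> \<in> marked_passages E H c S u t" by auto
      have \<gamma>: "\<gamma> \<noteq> []" "awalk s \<gamma> u" "head E (last \<gamma>) = u"
        using * awalk_last by (auto simp: wrong_passages_def first_passages_def)
      have "H (last \<gamma>) \<notin> c ` S"
      proof
        assume "H (last \<gamma>) \<in> c ` S"
        then obtain v where "v \<in> S" "H (last \<gamma>) = c v" by auto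
        then have "v = u" using \<pi>H[of "last \<gamma>"] \<pi>c \<gamma>(3) by metis
        then show False using * \<open>H (last \<gamma>) = c v\<close> by (auto simp: wrong_passages_def)
      qed
      moreover have "H ` set (butlast \<gamma>) \<inter> c ` S = {}"
        using * notin by (auto simp: wrong_passages_def first_passages_def)
      moreover have "set \<gamma> = insert (last \<gamma>) (set (butlast \<gamma>))"
        using \<gamma>(1) append_butlast_last_id[of \<gamma>] by (metis list.simps(15) rotate1.simps(2) set_rotate1)
      ultimately have "H ` set \<gamma> \<inter> c ` S = {}" by auto
      then show ?thesis using * \<gamma> awalk_appendI
        by (auto simp: marked_passages_def butlast_append)
    qed
  qed
qed

text \<open>
  With \<open>A\<close>, \<open>B\<close>, \<open>A'\<close> for the matrices of first, wrong and marked passages this is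
  \<open>A' + B = A + B A'\<close>, or \<open>1 - A = (1 - B) (1 - A')\<close>.
\<close>

lemma marked_passages_gf:
  fixes \<pi> :: "'c \<Rightarrow> 'a"
  assumes "fin_digraph E" and "t \<in> S" and "finite S"
    and \<pi>H: "\<And>e. \<pi> (H e) = head E e" and \<pi>c: "\<And>s. s \<in> S \<Longrightarrow> \<pi> (c s) = s"
  shows "walk_gf (marked_passages E H c S s t) + walk_gf (wrong_passages E H c S s t) =
    passage_gf E S s t +
    (\<Sum>u\<in>S. walk_gf (wrong_passages E H c S s u) * walk_gf (marked_passages E H c S u t))"
proof -
  interpret fin_digraph E by fact
  let ?F = "first_passages E S s" and ?W = "wrong_passages E H c S s"
  let ?M = "\<lambda>u. marked_passages E H c S u t"
  let ?D = "\<lambda>u. (\<lambda>(\<beta>, \<gamma>). \<beta> @ \<gamma>) ` (?W u \<times> ?M u)"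
  note A = finite_arcs
  have WF: "?W u \<subseteq> ?F u" for u by (auto simp: wrong_passages_def)
  have uniq: "\<beta> = \<beta>'" if "\<beta> \<in> ?W u" "\<beta>' \<in> ?W u'" "\<beta> @ \<gamma> = \<beta>' @ \<gamma>'" "u \<in> S" "u' \<in> S"
    for \<beta> \<beta>' \<gamma> \<gamma>' u u'
    using that first_passage_prefix_unique[of E u S u' \<beta> s \<beta>' \<gamma> \<gamma>'] WF wf_digraph_axioms by blast
  have D_lists: "?D u \<subseteq> lists (arcs E)" for u
    using wrong_passages_lists marked_passages_lists by fastforce
  have D_gf: "walk_gf (?D u) = walk_gf (?W u) * walk_gf (?M u)" if "u \<in> S" for u
  proof (intro walk_gf_concat[OF A wrong_passages_lists marked_passages_lists] inj_onI)
    fix a b assume *: "a \<in> ?W u \<times> ?M u" "b \<in> ?W u \<times> ?M u"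
      "(case a of (\<beta>, \<gamma>) \<Rightarrow> \<beta> @ \<gamma>) = (case b of (\<beta>, \<gamma>) \<Rightarrow> \<beta> @ \<gamma>)"
    obtain \<beta> \<gamma> \<beta>' \<gamma>' where ab: "a = (\<beta>, \<gamma>)" "b = (\<beta>', \<gamma>')" by fastforce
    then have "\<beta> = \<beta>'" using uniq[of \<beta> u \<beta>' u \<gamma> \<gamma>'] * that by simp
    then show "a = b" using ab * by simp
  qed
  have "disjoint_family_on ?D S"
    unfolding disjoint_family_on_def
  proof (intro ballI impI, rule ccontr)
    fix u u' assume *: "u \<in> S" "u' \<in> S" "u \<noteq> u'" "?D u \<inter> ?D u' \<noteq> {}"
    then obtain \<beta> \<beta>' \<gamma> \<gamma>' where "\<beta> \<in> ?W u" "\<beta>' \<in> ?W u'" "\<beta> @ \<gamma> = \<beta>' @ \<gamma>'" by auto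
    then have "\<beta> \<in> ?F u" "\<beta> \<in> ?F u'" using uniq * WF by blast+
    then show False using \<open>u \<noteq> u'\<close> awalk_last
      by (auto simp: first_passages_def)
  qed
  then have D: "walk_gf (\<Union>u\<in>S. ?D u) = (\<Sum>u\<in>S. walk_gf (?W u) * walk_gf (?M u))"
    using D_gf by (subst walk_gf_UNION[OF A \<open>finite S\<close> D_lists]) auto
  have FD: "(?F t - ?W t) \<inter> (\<Union>u\<in>S. ?D u) = {}"
  proof (rule ccontr)
    assume "\<not> ?thesis"
    then obtain u \<beta> \<gamma> where *: "u \<in> S" "\<beta> \<in> ?W u" "\<gamma> \<in> ?M u" "\<beta> @ \<gamma> \<in> ?F t" by auto
    then have "\<beta> = \<beta> @ \<gamma>"
      using first_passage_prefix_unique[of E u S t \<beta> s "\<beta> @ \<gamma>" \<gamma> "[]"] WF wf_digraph_axioms \<open>t \<in> S\<close>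
      by auto
    then show False using * by (auto simp: marked_passages_def)
  qed
  have F_lists: "?F t - ?W t \<subseteq> lists (arcs E)" using first_passages_lists[of E S s t] by auto
  have D_lists': "(\<Union>u\<in>S. ?D u) \<subseteq> lists (arcs E)" using D_lists by (rule UN_least)
  have decomp: "?M s = (?F t - ?W t) \<union> (\<Union>u\<in>S. ?D u)"
    by (rule marked_passages_decomp[where \<pi> = \<pi>]) (use wf_digraph_axioms assms in auto)
  have "walk_gf (?M s) = walk_gf (?F t - ?W t) + walk_gf (\<Union>u\<in>S. ?D u)"
    by (rule trans[OF arg_cong[OF decomp, of walk_gf] walk_gf_Un[OF A F_lists D_lists' FD]])
  moreover have "walk_gf (?F t - ?W t) + walk_gf (?W t) = passage_gf E S s t"
    unfolding passage_gf_def
    using WF[of t] by (subst walk_gf_Un[OF A F_lists wrong_passages_lists, symmetric])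
      (auto simp: Un_absorb2)
  ultimately show ?thesis using D by (simp add: algebra_simps)
qed

lemma app_iso_walk:
  assumes "wf_digraph G" and h: "pre_digraph.digraph_isomorphism G h" and "u \<in> verts G"
  shows "pre_digraph.awalk (app_iso h G) (iso_verts h u) \<beta> w \<longleftrightarrow>
    (\<exists>\<alpha> v. \<beta> = map (iso_arcs h) \<alpha> \<and> w = iso_verts h v \<and> pre_digraph.awalk G u \<alpha> v)"
proof -
  interpret G: wf_digraph G by fact
  interpret H: wf_digraph "app_iso h G" by (rule G.wf_digraphI_app_iso) fact
  show ?thesis using assms(3)
  proof (induction \<beta> arbitrary: u)
    case Nil
    then show ?case by (auto simp: H.awalk_simps G.awalk_simps)
  next
    case (Cons f \<beta>)
    show ?case
    proof
      assume "H.awalk (iso_verts h u) (f # \<beta>) w"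
      then obtain e where e: "e \<in> arcs G" "f = iso_arcs h e" "iso_tail h f = iso_verts h u"
        "H.awalk (iso_head h f) \<beta> w" by (auto simp: H.awalk_simps)
      then have "tail G e = u" "iso_head h f = iso_verts h (head G e)"
        using h Cons.prems by (auto simp: G.iso_verts_tail G.iso_verts_head)
      then obtain \<alpha> v where "\<beta> = map (iso_arcs h) \<alpha>" "w = iso_verts h v" "G.awalk (head G e) \<alpha> v"
        using Cons.IH[of "head G e"] e by auto
      then show "\<exists>\<alpha> v. f # \<beta> = map (iso_arcs h) \<alpha> \<and> w = iso_verts h v \<and> G.awalk u \<alpha> v"
        using e \<open>tail G e = u\<close>
        by (intro exI[of _ "e # \<alpha>"] exI[of _ v]) (auto simp: G.awalk_simps)
    next
      assume "\<exists>\<alpha> v. f # \<beta> = map (iso_arcs h) \<alpha> \<and> w = iso_verts h v \<and> G.awalk u \<alpha> v"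
      then obtain e \<alpha> v where *: "f = iso_arcs h e" "\<beta> = map (iso_arcs h) \<alpha>" "w = iso_verts h v"
        "e \<in> arcs G" "tail G e = u" "G.awalk (head G e) \<alpha> v" by (auto simp: G.awalk_simps)
      then have "H.awalk (iso_verts h (head G e)) \<beta> w"
        using Cons.IH[of "head G e"] by auto
      then show "H.awalk (iso_verts h u) (f # \<beta>) w"
        using * h by (auto simp: H.awalk_simps G.iso_verts_tail G.iso_verts_head)
    qed
  qed
qed

lemma app_iso_passage_gf:
  assumes "wf_digraph G" and h: "pre_digraph.digraph_isomorphism G h"
    and "u \<in> verts G" and "v \<in> verts G" and "T \<subseteq> verts G"
  shows "passage_gf (app_iso h G) (iso_verts h ` T) (iso_verts h u) (iso_verts h v) =
    passage_gf G T u v"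
proof -
  interpret G: wf_digraph G by fact
  have head: "head (app_iso h G) ` set (butlast (map (iso_arcs h) \<alpha>)) \<inter> iso_verts h ` T = {} \<longleftrightarrow>
      head G ` set (butlast \<alpha>) \<inter> T = {}" if "set \<alpha> \<subseteq> arcs G" for \<alpha>
  proof -
    have sub: "set (butlast \<alpha>) \<subseteq> arcs G" using that by (auto dest: in_set_butlastD)
    then have "head (app_iso h G) ` set (butlast (map (iso_arcs h) \<alpha>)) =
        iso_verts h ` head G ` set (butlast \<alpha>)"
      unfolding map_butlast[symmetric] set_map image_image head_app_iso
      using G.iso_verts_head[OF h] by (intro image_cong) auto
    moreover have "head G ` set (butlast \<alpha>) \<subseteq> verts G" using sub by auto
    ultimately show ?thesis
      using inj_on_image_Int[OF G.digraph_isomorphism_inj_on_verts[OF h] _ assms(5)]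
      by (metis image_is_empty)
  qed
  have "first_passages (app_iso h G) (iso_verts h ` T) (iso_verts h u) (iso_verts h v) =
      map (iso_arcs h) ` first_passages G T u v"
  proof (intro equalityI subsetI)
    fix \<beta> assume \<beta>: "\<beta> \<in> first_passages (app_iso h G) (iso_verts h ` T) (iso_verts h u) (iso_verts h v)"
    then have "pre_digraph.awalk (app_iso h G) (iso_verts h u) \<beta> (iso_verts h v)"
      by (simp add: first_passages_def)
    then obtain \<alpha> v' where \<alpha>: "\<beta> = map (iso_arcs h) \<alpha>" "iso_verts h v = iso_verts h v'" "G.awalk u \<alpha> v'"
      unfolding app_iso_walk[OF assms(1-3)] by (elim exE conjE)
    then have "v' = v"
      using assms(4) G.awalk_last_in_verts[OF \<alpha>(3)] G.iso_verts_eq_iff[OF h] by metis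
    moreover have "set \<alpha> \<subseteq> arcs G" using \<alpha>(3) by (simp add: G.awalk_def)
    ultimately have "\<alpha> \<in> first_passages G T u v"
      using \<alpha> \<beta> head[of \<alpha>] by (simp add: first_passages_def)
    then show "\<beta> \<in> map (iso_arcs h) ` first_passages G T u v"
      unfolding \<alpha>(1) by (rule imageI)
  next
    fix \<beta> assume "\<beta> \<in> map (iso_arcs h) ` first_passages G T u v"
    then obtain \<alpha> where \<alpha>: "\<beta> = map (iso_arcs h) \<alpha>" "\<alpha> \<noteq> []" "G.awalk u \<alpha> v"
      "head G ` set (butlast \<alpha>) \<inter> T = {}"
      by (auto simp: first_passages_def)
    moreover have "set \<alpha> \<subseteq> arcs G" using \<alpha>(3) by (simp add: G.awalk_def)
    moreover have "pre_digraph.awalk (app_iso h G) (iso_verts h u) \<beta> (iso_verts h v)"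
      unfolding app_iso_walk[OF assms(1-3)] using \<alpha> by (intro exI conjI) auto
    ultimately show "\<beta> \<in> first_passages (app_iso h G) (iso_verts h ` T) (iso_verts h u) (iso_verts h v)"
      using head[of \<alpha>] by (simp add: first_passages_def)
  qed
  moreover have "inj_on (map (iso_arcs h)) (first_passages G T u v)"
    using G.digraph_isomorphism_inj_on_arcs[OF h] first_passages_lists
    by (rule inj_on_subset[OF inj_on_map_lists])
  ultimately show ?thesis by (simp add: passage_gf_def walk_gf_image)
qed

lemma in_splitting_passages:
  assumes spl: "in_splitting E F m \<phi>" and "fin_digraph E" and S: "finite S" "S \<subseteq> verts E"
    and ix: "\<And>s. s \<in> S \<Longrightarrow> ix s \<in> {1..m s}"
  defines "c \<equiv> \<lambda>s. \<phi> (s, ix s)"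
  obtains B :: "'a \<Rightarrow> 'a \<Rightarrow> int fps" where
    "\<And>s t n. 0 \<le> B s t $ n" and "\<And>s t n. B s t $ n \<le> passage_gf E S s t $ n"
    "\<And>s t. s \<in> S \<Longrightarrow> t \<in> S \<Longrightarrow> passage_gf F (c ` S) (c s) (c t) + B s t =
       passage_gf E S s t + (\<Sum>u\<in>S. B s u * passage_gf F (c ` S) (c u) (c t))"
proof -
  interpret fin_digraph E by fact
  obtain X h where X: "splitting_data E m X"
    and h: "pre_digraph.digraph_isomorphism (in_split E m X) h"
    and F: "F = app_iso h (in_split E m X)" and \<phi>: "\<phi> = iso_verts h"
    using spl unfolding in_splitting_def by blast
  let ?I = "in_split E m X" and ?H = "split_head E m X"
  define c0 where "c0 s = (s, ix s)" for s
  have wfI: "wf_digraph ?I" by (rule wf_in_split[OF wf_digraph_axioms X])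
  have c0: "c0 s \<in> verts ?I" if "s \<in> S" for s
    using that S ix by (auto simp: c0_def)
  have c: "c = (\<lambda>s. iso_verts h (c0 s))" by (simp add: c_def c0_def \<phi>)
  have gf: "passage_gf F (c ` S) (c s) (c t) = walk_gf (marked_passages E ?H c0 S s t)"
    if st: "s \<in> S" "t \<in> S" for s t
  proof -
    have "passage_gf F (c ` S) (c s) (c t) = passage_gf ?I (c0 ` S) (c0 s) (c0 t)"
      using app_iso_passage_gf[OF wfI h c0[OF st(1)] c0[OF st(2)] image_subsetI[OF c0]]
      by (simp add: F c image_image)
    also have "\<dots> = walk_gf (map fst ` first_passages ?I (c0 ` S) (c0 s) (c0 t))"
      unfolding passage_gf_def
    proof (rule walk_gf_image[symmetric])
      show "inj_on (map fst) (first_passages ?I (c0 ` S) (c0 s) (c0 t))"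
        by (intro inj_onI in_split_walk_inj[OF wf_digraph_axioms X]) (auto simp: first_passages_def)
    qed simp
    also have "map fst ` first_passages ?I (c0 ` S) (c0 s) (c0 t) = marked_passages E ?H c0 S s t"
      using in_split_first_passages[OF wf_digraph_axioms X ix[OF st(1)], of "c0 ` S" "c0 t"]
      by (auto simp: marked_passages_def c0_def)
    finally show ?thesis .
  qed
  show ?thesis
  proof (rule that[of "\<lambda>s t. walk_gf (wrong_passages E ?H c0 S s t)"])
    show "0 \<le> walk_gf (wrong_passages E ?H c0 S s t) $ n" for s t n
      by (simp add: walk_gf_nth)
    show "walk_gf (wrong_passages E ?H c0 S s t) $ n \<le> passage_gf E S s t $ n" for s t n
      unfolding passage_gf_def
      by (rule walk_gf_mono[OF finite_arcs first_passages_lists]) (auto simp: wrong_passages_def)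
    show "passage_gf F (c ` S) (c s) (c t) + walk_gf (wrong_passages E ?H c0 S s t) =
       passage_gf E S s t +
       (\<Sum>u\<in>S. walk_gf (wrong_passages E ?H c0 S s u) * passage_gf F (c ` S) (c u) (c t))"
      if "s \<in> S" "t \<in> S" for s t
      using marked_passages_gf[of E t S fst ?H c0 s] that S gf fin_digraph_axioms
      by (simp add: c0_def)
  qed
qed

lemma in_splitting_fin_digraph_iff:
  assumes "in_splitting E F m \<phi>"
  shows "fin_digraph E \<longleftrightarrow> fin_digraph F"
proof -
  obtain X h where wf: "wf_digraph E" and X: "splitting_data E m X"
    and h: "pre_digraph.digraph_isomorphism (in_split E m X) h"
    and F: "F = app_iso h (in_split E m X)"
    using assms unfolding in_splitting_def by blast
  interpret E: wf_digraph E by fact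
  interpret I: wf_digraph "in_split E m X" by (rule wf_in_split[OF wf X])
  interpret F: wf_digraph F unfolding F by (rule I.wf_digraphI_app_iso) fact
  have V: "verts (in_split E m X) = (SIGMA v:verts E. {1..m v})"
    and A: "arcs (in_split E m X) = (SIGMA e:arcs E. {1..m (tail E e)})"
    by (auto simp: in_split_def)
  have "finite (verts F) \<longleftrightarrow> finite (verts (in_split E m X))"
    "finite (arcs F) \<longleftrightarrow> finite (arcs (in_split E m X))"
    unfolding F using h
    by (auto simp: pre_digraph.digraph_isomorphism_def dest: finite_imageD)
  moreover have "finite (verts (in_split E m X)) \<longleftrightarrow> finite (verts E)"
    unfolding V
  proof
    assume "finite (SIGMA v:verts E. {1..m v})"
    moreover have "verts E \<subseteq> fst ` (SIGMA v:verts E. {1..m v})"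
      using copies_pos[OF X] by force
    ultimately show "finite (verts E)" by (rule finite_surj)
  qed simp
  moreover have "finite (arcs (in_split E m X)) \<longleftrightarrow> finite (arcs E)"
    unfolding A
  proof
    assume "finite (SIGMA e:arcs E. {1..m (tail E e)})"
    moreover have "arcs E \<subseteq> fst ` (SIGMA e:arcs E. {1..m (tail E e)})"
      using copies_pos[OF X] by force
    ultimately show "finite (arcs E)" by (rule finite_surj)
  qed simp
  ultimately show ?thesis
    by (auto simp: fin_digraph_def fin_digraph_axioms_def E.wf_digraph_axioms F.wf_digraph_axioms)
qed

lemma in_splitting_copy_in_verts:
  assumes "in_splitting E F m \<phi>" and "v \<in> verts E" and "i \<in> {1..m v}"
  shows "\<phi> (v, i) \<in> verts F"
  using assms unfolding in_splitting_def by auto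

lemma in_splitting_copy_inj:
  assumes "in_splitting E F m \<phi>" and "v \<in> verts E" "i \<in> {1..m v}" and "w \<in> verts E" "j \<in> {1..m w}"
    and "\<phi> (v, i) = \<phi> (w, j)"
  shows "v = w"
  using assms unfolding in_splitting_def pre_digraph.digraph_isomorphism_def inj_on_def by force

text \<open>
  All copies of a vertex have the same successors, so a nonempty walk can be started at any other
  copy of its first vertex.
\<close>

lemma in_splitting_change_start:
  assumes "in_splitting E F m \<phi>" and "v \<in> verts E" "i \<in> {1..m v}" "j \<in> {1..m v}"
    and "pre_digraph.awalk F (\<phi> (v, i)) \<alpha> w" and "\<alpha> \<noteq> []"
  shows "\<exists>\<beta>. \<beta> \<noteq> [] \<and> pre_digraph.awalk F (\<phi> (v, j)) \<beta> w"
proof -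
  obtain X h where wf: "wf_digraph E" and X: "splitting_data E m X"
    and h: "pre_digraph.digraph_isomorphism (in_split E m X) h"
    and F: "F = app_iso h (in_split E m X)" and \<phi>: "\<phi> = iso_verts h"
    using assms unfolding in_splitting_def by blast
  let ?I = "in_split E m X"
  interpret I: wf_digraph ?I by (rule wf_in_split[OF wf X])
  have in_verts: "(v, i) \<in> verts ?I" "(v, j) \<in> verts ?I" using assms by auto
  have "pre_digraph.awalk (app_iso h ?I) (iso_verts h (v, i)) \<alpha> w"
    using assms(5) by (simp add: F \<phi>)
  then obtain \<gamma> w' where \<gamma>: "\<alpha> = map (iso_arcs h) \<gamma>" "w = iso_verts h w'" "I.awalk (v, i) \<gamma> w'"
    unfolding app_iso_walk[OF I.wf_digraph_axioms h in_verts(1)] by (elim exE conjE)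
  have "pre_digraph.awalk E v (map fst \<gamma>) (fst w')"
    using in_split_walk_project[OF wf X \<gamma>(3)] by simp
  then obtain \<delta> where \<delta>:
    "I.awalk (v, j) \<delta> (last ((v, j) # map (split_head E m X) (map fst \<gamma>)))" "map fst \<delta> = map fst \<gamma>"
    using in_split_walk_lift[OF wf X _ assms(4)] by blast
  have ne: "\<gamma> \<noteq> []" "\<delta> \<noteq> []" using \<gamma> assms(6) \<delta>(2) by auto
  have "w' = head ?I (last \<gamma>)" using I.awalk_last[OF \<gamma>(3) ne(1)] .
  then have "last ((v, j) # map (split_head E m X) (map fst \<gamma>)) = w'"
    using ne by (simp add: last_map)
  then have "pre_digraph.awalk (app_iso h ?I) (iso_verts h (v, j)) (map (iso_arcs h) \<delta>) w"
    unfolding app_iso_walk[OF I.wf_digraph_axioms h in_verts(2)]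
    using \<delta>(1) \<gamma>(2) by (intro exI[of _ \<delta>] exI[of _ w']) simp
  then show ?thesis using ne by (auto simp: F \<phi>)
qed

section \<open>Residue class sums of the coefficients of a polynomial\<close>

text \<open>
  The image of \<open>f\<close> in the group ring of the cyclic group of order \<open>d\<close>, read as a function on the
  integers with period \<open>d\<close>.
\<close>

definition class_sum :: "nat \<Rightarrow> int poly \<Rightarrow> int \<Rightarrow> int" where
  "class_sum d f k = (\<Sum>i | i \<le> degree f \<and> [int i = k] (mod int d). coeff f i)"

lemma class_sum_bound:
  assumes "degree f \<le> N"
  shows "class_sum d f k = (\<Sum>i\<le>N. if [int i = k] (mod int d) then coeff f i else 0)"
proof -
  have "(\<Sum>i\<le>N. if [int i = k] (mod int d) then coeff f i else 0) =
      (\<Sum>i | i \<le> N \<and> [int i = k] (mod int d). coeff f i)"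
    by (simp add: sum.If_cases Int_def)
  also have "\<dots> = class_sum d f k"
    unfolding class_sum_def using assms
    by (intro sum.mono_neutral_right) (auto intro: coeff_eq_0)
  finally show ?thesis by simp
qed

lemma class_sum_cong: "[k = l] (mod int d) \<Longrightarrow> class_sum d f k = class_sum d f l"
  unfolding class_sum_def by (metis cong_sym cong_trans)

lemma class_sum_0 [simp]: "class_sum d 0 k = 0"
  by (simp add: class_sum_def)

lemma class_sum_add: "class_sum d (f + g) k = class_sum d f k + class_sum d g k"
proof -
  let ?N = "max (degree f) (degree g)"
  show ?thesis
    by (simp add: class_sum_bound[where N = ?N] degree_add_le_max sum.distrib[symmetric])
      (intro sum.cong, auto)
qed

lemma class_sum_minus: "class_sum d (- f) k = - class_sum d f k"
  by (simp add: class_sum_def sum_negf)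

lemma class_sum_diff: "class_sum d (f - g) k = class_sum d f k - class_sum d g k"
  using class_sum_add[of d f "- g" k] by (simp add: class_sum_minus)

lemma class_sum_sum: "class_sum d (\<Sum>i\<in>I. f i) k = (\<Sum>i\<in>I. class_sum d (f i) k)"
  by (induction I rule: infinite_finite_induct) (auto simp: class_sum_add)

lemma class_sum_smult: "class_sum d (smult c f) k = c * class_sum d f k"
  using degree_smult_le[of c f]
  by (simp add: class_sum_bound[where N = "degree f"] sum_distrib_left if_distrib cong: if_cong)

lemma class_sum_pCons_0: "class_sum d (pCons 0 f) k = class_sum d f (k - 1)"
proof -
  have *: "[1 + int i = k] (mod int d) \<longleftrightarrow> [int i = k - 1] (mod int d)" for i
    by (simp add: cong_iff_dvd_diff algebra_simps)
  have "class_sum d (pCons 0 f) k =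
      (\<Sum>i\<le>Suc (degree f). if [int i = k] (mod int d) then coeff (pCons 0 f) i else 0)"
    by (rule class_sum_bound) (simp add: degree_pCons_le)
  also have "\<dots> = (\<Sum>i\<le>degree f. if [int i = k - 1] (mod int d) then coeff f i else 0)"
    unfolding sum.atMost_Suc_shift by (simp add: * cong: if_cong)
  finally show ?thesis by (simp add: class_sum_bound[where N = "degree f"])
qed

lemma class_sum_monom_mult:
  "class_sum d (monom c j * f) k = c * class_sum d f (k - int j)"
proof (induction j arbitrary: k)
  case 0
  then show ?case by (simp add: monom_0 class_sum_smult)
next
  case (Suc j)
  have "monom c (Suc j) * f = pCons 0 (monom c j * f)"
    by (simp add: monom_Suc)
  then show ?case using Suc[of "k - 1"] by (simp add: class_sum_pCons_0 algebra_simps)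
qed

lemma class_sum_mult:
  "class_sum d (f * g) k = (\<Sum>j\<le>degree f. coeff f j * class_sum d g (k - int j))"
proof -
  have "f * g = (\<Sum>j\<le>degree f. monom (coeff f j) j * g)"
    by (simp add: poly_as_sum_of_monoms sum_distrib_right[symmetric])
  then show ?thesis by (simp add: class_sum_sum class_sum_monom_mult)
qed

lemma class_sum_one_minus_monom:
  "class_sum d ((1 - monom 1 n) * f) k = class_sum d f k - class_sum d f (k - int n)"
  by (simp add: left_diff_distrib class_sum_diff class_sum_monom_mult)

lemma class_sum_eq_0_of_dvd:
  assumes "d dvd n" and "1 - monom 1 n dvd f"
  shows "class_sum d f k = 0"
proof -
  obtain g where "f = (1 - monom 1 n) * g" using assms(2) by (elim dvdE)
  moreover have "[k - int n = k] (mod int d)"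
    using assms(1) by (simp add: cong_iff_dvd_diff)
  ultimately show ?thesis
    using class_sum_cong[of "k - int n" k d g] by (simp add: class_sum_one_minus_monom)
qed

lemma one_minus_monom_dvd:
  assumes "d dvd n"
  shows "(1 - monom 1 d :: int poly) dvd 1 - monom 1 n"
proof -
  obtain k where "n = d * k" using assms by (elim dvdE)
  then have "(monom 1 n :: int poly) = monom 1 d ^ k" by (simp add: monom_power)
  moreover have "(1 - monom 1 d :: int poly) dvd 1 - monom 1 d ^ k"
    by (simp add: one_diff_power_eq)
  ultimately show ?thesis by simp
qed

lemma class_sum_pos:
  assumes "\<And>n. 0 \<le> coeff f n" and "0 < coeff f n"
  shows "0 < class_sum d f (int n)"
  unfolding class_sum_def
proof (rule sum_pos2)
  show "n \<in> {i. i \<le> degree f \<and> [int i = int n] (mod int d)}"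
    using assms(2) by (auto intro: le_degree)
qed (use assms in auto)

section \<open>The relation between the trail polynomials\<close>

text \<open>
  The parts of the matrix identities that matter for the counts: \<open>f\<close> is needed only modulo
  \<open>1 - t^x\<close>, \<open>g\<close> modulo \<open>1 - t^z\<close>, and \<open>h\<close> modulo both. The support conditions keep track of the
  fact that \<open>u\<close> and \<open>v\<close> arise from actual walks from \<open>p\<close> to \<open>q\<close> and from \<open>q\<close> to \<open>r\<close>.
\<close>

definition trail_relation ::
    "nat \<Rightarrow> nat \<Rightarrow> nat \<Rightarrow> int poly \<Rightarrow> int poly \<Rightarrow> int poly \<Rightarrow> int poly \<Rightarrow> int poly \<Rightarrow> int poly \<Rightarrow> bool"
where
  "trail_relation x y z f g h f' g' h' \<longleftrightarrow>
    (\<exists>u v.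
       1 - monom 1 x dvd f' - f - u * (1 - monom 1 y) \<and>
       1 - monom 1 z dvd g' - g - v * (1 - monom 1 y) \<and>
       1 - monom 1 (gcd x z) dvd h' - h + u * g + f' * v \<and>
       (\<forall>n. coeff u n \<noteq> 0 \<longrightarrow> class_sum (gcd x (gcd y z)) f (int n) \<noteq> 0) \<and>
       (\<forall>n. coeff v n \<noteq> 0 \<longrightarrow> class_sum (gcd x (gcd y z)) g (int n) \<noteq> 0))"

lemma trail_relation_refl: "trail_relation x y z f g h f g h"
  unfolding trail_relation_def by (intro exI[of _ 0]) simp

lemma trail_relation_class_sum:
  assumes "trail_relation x y z f g h f' g' h'"
  shows "class_sum (gcd x (gcd y z)) f' k = class_sum (gcd x (gcd y z)) f k"
    and "class_sum (gcd x (gcd y z)) g' k = class_sum (gcd x (gcd y z)) g k"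
proof -
  let ?d = "gcd x (gcd y z)"
  have aux: "class_sum ?d a' k = class_sum ?d a k"
    if "1 - monom 1 n dvd a' - a - u * (1 - monom 1 y)" "?d dvd n" for a a' u n
  proof -
    have "class_sum ?d (a' - a - u * (1 - monom 1 y)) k = 0"
      using class_sum_eq_0_of_dvd that by blast
    moreover have "class_sum ?d (u * (1 - monom 1 y)) k = 0"
      by (rule class_sum_eq_0_of_dvd[of _ y]) (auto intro: gcd_dvd1 gcd_dvd2 dvd_trans)
    ultimately show ?thesis by (simp add: class_sum_diff)
  qed
  show "class_sum ?d f' k = class_sum ?d f k" "class_sum ?d g' k = class_sum ?d g k"
    using assms aux[of x] aux[of z, OF _ dvd_trans[OF gcd_dvd2 gcd_dvd2]]
    unfolding trail_relation_def by auto
qed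

text \<open>
  Negating \<open>u\<close> and \<open>v\<close> works: modulo \<open>1 - t^gcd(x, z)\<close> both \<open>u g' - u g\<close> and \<open>f' v - f v\<close> are
  \<open>u v (1 - t^y)\<close>, so \<open>u g' + f v\<close> and \<open>u g + f' v\<close> agree.
\<close>

lemma trail_relation_sym:
  assumes "trail_relation x y z f g h f' g' h'"
  shows "trail_relation x y z f' g' h' f g h"
proof -
  obtain u v where f: "1 - monom 1 x dvd f' - f - u * (1 - monom 1 y)"
    and g: "1 - monom 1 z dvd g' - g - v * (1 - monom 1 y)"
    and h: "1 - monom 1 (gcd x z) dvd h' - h + u * g + f' * v"
    and supp: "\<And>n. coeff u n \<noteq> 0 \<Longrightarrow> class_sum (gcd x (gcd y z)) f (int n) \<noteq> 0"
      "\<And>n. coeff v n \<noteq> 0 \<Longrightarrow> class_sum (gcd x (gcd y z)) g (int n) \<noteq> 0"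
    using assms unfolding trail_relation_def by blast
  have f0: "1 - monom 1 (gcd x z) dvd f' - f - u * (1 - monom 1 y)"
    using one_minus_monom_dvd[of "gcd x z" x] f dvd_trans by auto
  have g0: "1 - monom 1 (gcd x z) dvd g' - g - v * (1 - monom 1 y)"
    using one_minus_monom_dvd[of "gcd x z" z] g dvd_trans by auto
  have eq: "h - h' + (- u) * g' + f * (- v) =
      v * (f' - f - u * (1 - monom 1 y)) - (h' - h + u * g + f' * v)
      - u * (g' - g - v * (1 - monom 1 y))"
    by (simp add: algebra_simps)
  have "1 - monom 1 (gcd x z) dvd h - h' + (- u) * g' + f * (- v)"
    unfolding eq by (rule dvd_diff[OF dvd_diff[OF dvd_mult[OF f0] h] dvd_mult[OF g0]])
  moreover have "1 - monom 1 x dvd f - f' - (- u) * (1 - monom 1 y)"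
  proof -
    have "f - f' - (- u) * (1 - monom 1 y) = - (f' - f - u * (1 - monom 1 y))"
      by (simp add: algebra_simps)
    then show ?thesis using f by (metis dvd_minus_iff)
  qed
  moreover have "1 - monom 1 z dvd g - g' - (- v) * (1 - monom 1 y)"
  proof -
    have "g - g' - (- v) * (1 - monom 1 y) = - (g' - g - v * (1 - monom 1 y))"
      by (simp add: algebra_simps)
    then show ?thesis using g by (metis dvd_minus_iff)
  qed
  ultimately show ?thesis
    unfolding trail_relation_def trail_relation_class_sum[OF assms]
    using supp by (intro exI[of _ "- u"] exI[of _ "- v"]) simp
qed

text \<open>
  The polynomials \<open>u\<close> and \<open>v\<close> simply add up. The mixed terms cancel because the third congruence
  pairs \<open>u\<close> with the old \<open>g\<close> but \<open>v\<close> with the new \<open>f\<close>.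
\<close>

lemma trail_relation_trans:
  assumes r: "trail_relation x y z f g h f' g' h'" and "trail_relation x y z f' g' h' f'' g'' h''"
  shows "trail_relation x y z f g h f'' g'' h''"
proof -
  obtain u v where f: "1 - monom 1 x dvd f' - f - u * (1 - monom 1 y)"
    and g: "1 - monom 1 z dvd g' - g - v * (1 - monom 1 y)"
    and h: "1 - monom 1 (gcd x z) dvd h' - h + u * g + f' * v"
    and supp: "\<And>n. coeff u n \<noteq> 0 \<Longrightarrow> class_sum (gcd x (gcd y z)) f (int n) \<noteq> 0"
      "\<And>n. coeff v n \<noteq> 0 \<Longrightarrow> class_sum (gcd x (gcd y z)) g (int n) \<noteq> 0"
    using r unfolding trail_relation_def by blast
  obtain u' v' where f': "1 - monom 1 x dvd f'' - f' - u' * (1 - monom 1 y)"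
    and g': "1 - monom 1 z dvd g'' - g' - v' * (1 - monom 1 y)"
    and h': "1 - monom 1 (gcd x z) dvd h'' - h' + u' * g' + f'' * v'"
    and supp': "\<And>n. coeff u' n \<noteq> 0 \<Longrightarrow> class_sum (gcd x (gcd y z)) f' (int n) \<noteq> 0"
      "\<And>n. coeff v' n \<noteq> 0 \<Longrightarrow> class_sum (gcd x (gcd y z)) g' (int n) \<noteq> 0"
    using assms(2) unfolding trail_relation_def by blast
  have f0: "1 - monom 1 (gcd x z) dvd f'' - f' - u' * (1 - monom 1 y)"
    using one_minus_monom_dvd[of "gcd x z" x] f' dvd_trans by auto
  have g0: "1 - monom 1 (gcd x z) dvd g' - g - v * (1 - monom 1 y)"
    using one_minus_monom_dvd[of "gcd x z" z] g dvd_trans by auto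
  have eq: "h'' - h + (u + u') * g + f'' * (v + v') =
      (h' - h + u * g + f' * v) + (h'' - h' + u' * g' + f'' * v')
      - u' * (g' - g - v * (1 - monom 1 y)) + v * (f'' - f' - u' * (1 - monom 1 y))"
    by (simp add: algebra_simps)
  have "1 - monom 1 (gcd x z) dvd h'' - h + (u + u') * g + f'' * (v + v')"
    unfolding eq by (rule dvd_add[OF dvd_diff[OF dvd_add[OF h h'] dvd_mult[OF g0]] dvd_mult[OF f0]])
  moreover have "1 - monom 1 x dvd f'' - f - (u + u') * (1 - monom 1 y)"
    using dvd_add[OF f f'] by (simp add: algebra_simps)
  moreover have "1 - monom 1 z dvd g'' - g - (v + v') * (1 - monom 1 y)"
    using dvd_add[OF g g'] by (simp add: algebra_simps)
  moreover have "class_sum (gcd x (gcd y z)) f (int n) \<noteq> 0" if "coeff (u + u') n \<noteq> 0" for n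
  proof -
    have "coeff u n \<noteq> 0 \<or> coeff u' n \<noteq> 0" using that by auto
    then show ?thesis using supp(1) supp'(1) trail_relation_class_sum(1)[OF r] by metis
  qed
  moreover have "class_sum (gcd x (gcd y z)) g (int n) \<noteq> 0" if "coeff (v + v') n \<noteq> 0" for n
  proof -
    have "coeff v n \<noteq> 0 \<or> coeff v' n \<noteq> 0" using that by auto
    then show ?thesis using supp(2) supp'(2) trail_relation_class_sum(2)[OF r] by metis
  qed
  ultimately show ?thesis
    unfolding trail_relation_def by blast
qed

text \<open>
  Transposing a graph exchanges the roles of the first and the last cycle.
\<close>

lemma trail_relation_swap:
  assumes "trail_relation z y x g f h g' f' h'"
  shows "trail_relation x y z f g h f' g' h'"
proof -
  obtain v u where f: "1 - monom 1 x dvd f' - f - u * (1 - monom 1 y)"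
    and g: "1 - monom 1 z dvd g' - g - v * (1 - monom 1 y)"
    and h: "1 - monom 1 (gcd x z) dvd h' - h + v * f + g' * u"
    and supp: "\<And>n. coeff u n \<noteq> 0 \<Longrightarrow> class_sum (gcd x (gcd y z)) f (int n) \<noteq> 0"
      "\<And>n. coeff v n \<noteq> 0 \<Longrightarrow> class_sum (gcd x (gcd y z)) g (int n) \<noteq> 0"
    using assms unfolding trail_relation_def
    by (auto simp: gcd.commute gcd.left_commute)
  have f0: "1 - monom 1 (gcd x z) dvd f' - f - u * (1 - monom 1 y)"
    using one_minus_monom_dvd[of "gcd x z" x] f dvd_trans by auto
  have g0: "1 - monom 1 (gcd x z) dvd g' - g - v * (1 - monom 1 y)"
    using one_minus_monom_dvd[of "gcd x z" z] g dvd_trans by auto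
  have eq: "h' - h + u * g + f' * v = (h' - h + v * f + g' * u)
      - u * (g' - g - v * (1 - monom 1 y)) + v * (f' - f - u * (1 - monom 1 y))"
    by (simp add: algebra_simps)
  have "1 - monom 1 (gcd x z) dvd h' - h + u * g + f' * v"
    unfolding eq by (rule dvd_add[OF dvd_diff[OF h dvd_mult[OF g0]] dvd_mult[OF f0]])
  then show ?thesis unfolding trail_relation_def using f g supp by blast
qed

text \<open>
  The hypotheses describe an in-splitting. A walk that enters a cycle at a wrong copy of its marked
  vertex reaches the marked copy after one turn, which explains the factors \<open>t^y\<close> and \<open>t^z\<close>; and a
  walk that is at a wrong copy of \<open>q\<close> may also go on to \<open>r\<close>, which explains \<open>b g'\<close>.
\<close>

lemma trail_relation_in_split:
  assumes b: "\<And>n. 0 \<le> coeff b n" "\<And>n. coeff b n \<le> coeff f n"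
    and f: "f' = f - b + b * monom 1 y"
    and g: "g' = g - c + c * monom 1 z"
    and h: "h' = h - e + b * g' + e * monom 1 z"
  shows "trail_relation x y z f g h f' g' h'"
proof -
  have "h' - h + (- b) * g = - (e + b * c) * (1 - monom 1 z)"
    unfolding h g by (simp add: algebra_simps)
  moreover have "(1 - monom 1 (gcd x z) :: int poly) dvd 1 - monom 1 z"
    by (rule one_minus_monom_dvd) simp
  ultimately have "1 - monom 1 (gcd x z) dvd h' - h + (- b) * g"
    by (metis dvd_mult)
  moreover have "1 - monom 1 z dvd g' - g"
    unfolding g by (intro dvdI[of _ _ "- c"]) (simp add: algebra_simps)
  moreover have "class_sum (gcd x (gcd y z)) f (int n) \<noteq> 0" if "coeff b n \<noteq> 0" for n
  proof -
    have "0 \<le> coeff f k" for k using b[of k] by linarith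
    moreover have "0 < coeff f n" using that b[of n] by linarith
    ultimately show ?thesis using class_sum_pos[of f n "gcd x (gcd y z)"] by simp
  qed
  ultimately show ?thesis unfolding trail_relation_def f
    by (intro exI[of _ "- b"] exI[of _ 0]) (simp add: algebra_simps)
qed

section \<open>Graphs whose passages look like those of a meteor graph\<close>

text \<open>
  This property, unlike being in normal form, is inherited by all graphs in a sequence of moves.
  Requiring polynomials above the diagonal takes the place of requiring that every cycle contains
  one of the marked vertices.
\<close>

definition meteor_skeleton ::
    "('a, 'b) pre_digraph \<Rightarrow> 'a \<Rightarrow> 'a \<Rightarrow> 'a \<Rightarrow> nat \<Rightarrow> nat \<Rightarrow> nat \<Rightarrow>
     int poly \<Rightarrow> int poly \<Rightarrow> int poly \<Rightarrow> bool" where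
  "meteor_skeleton G p q r x y z f g h \<longleftrightarrow>
    fin_digraph G \<and> distinct [p, q, r] \<and> {p, q, r} \<subseteq> verts G \<and>
    (let A = passage_gf G {p, q, r} in
       A p p = fps_X ^ x \<and> A q q = fps_X ^ y \<and> A r r = fps_X ^ z \<and>
       A q p = 0 \<and> A r p = 0 \<and> A r q = 0 \<and>
       A p q = fps_of_poly f \<and> A q r = fps_of_poly g \<and> A p r = fps_of_poly h)"

text \<open>
  Walks between vertices of \<open>S\<close> are concatenations of first passages.
\<close>

lemma closed_under_walks:
  assumes "wf_digraph G" and "T \<subseteq> S"
    and closed: "\<And>s t. s \<in> T \<Longrightarrow> t \<in> S - T \<Longrightarrow> first_passages G S s t = {}"
    and "pre_digraph.awalk G s \<alpha> t" and "s \<in> T" and "t \<in> S"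
  shows "t \<in> T"
  using assms(4,5)
proof (induction "length \<alpha>" arbitrary: s \<alpha> rule: less_induct)
  case less
  interpret wf_digraph G by fact
  show ?case
  proof (cases "\<alpha> = []")
    case True
    then show ?thesis using less.prems by (simp add: awalk_Nil_iff)
  next
    case False
    obtain \<beta> \<gamma> u where *: "\<alpha> = \<beta> @ \<gamma>" "u \<in> S" "\<beta> \<in> first_passages G S s u" "awalk u \<gamma> t"
      using walk_first_visit[OF wf_digraph_axioms less.prems(1) False \<open>t \<in> S\<close>] .
    have "u \<in> T" using closed[of s u] * less.prems(2) by blast
    moreover have "length \<gamma> < length \<alpha>" using * by (auto simp: first_passages_def)
    ultimately show ?thesis using less.hyps * by blast
  qed
qed

lemma no_return:
  assumes "wf_digraph G" and "T \<subseteq> S" and "s \<in> S - T"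
    and closed: "\<And>s t. s \<in> T \<Longrightarrow> t \<in> S - T \<Longrightarrow> first_passages G S s t = {}"
    and leave: "\<And>t. t \<in> S - T \<Longrightarrow> first_passages G S s t = {}"
    and "pre_digraph.awalk G s \<alpha> s"
  shows "\<alpha> = []"
proof (rule ccontr)
  interpret wf_digraph G by fact
  assume "\<alpha> \<noteq> []"
  have "s \<in> S" using assms(3) by simp
  obtain \<beta> \<gamma> u where *: "\<alpha> = \<beta> @ \<gamma>" "u \<in> S" "\<beta> \<in> first_passages G S s u" "awalk u \<gamma> s"
    using walk_first_visit[OF wf_digraph_axioms assms(6) \<open>\<alpha> \<noteq> []\<close> \<open>s \<in> S\<close>] .
  then have "u \<in> T" using leave by blast
  then show False
    using closed_under_walks[OF wf_digraph_axioms assms(2) closed *(4)] assms(3) by blast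
qed

lemma cycle_verts_closed_walk:
  assumes "wf_digraph G" and "v \<in> cycle_verts G"
  shows "\<exists>\<alpha>. \<alpha> \<noteq> [] \<and> pre_digraph.awalk G v \<alpha> v"
proof -
  interpret wf_digraph G by fact
  obtain C u e where C: "awalk u C u" "e \<in> set C" "v = tail G e"
    using assms(2) by (auto simp: cycle_verts_def verts_of_cycle_def cycle_def)
  obtain xs ys where [simp]: "C = xs @ e # ys" using C(2) by (metis split_list)
  obtain w where w: "awalk u xs w" "awalk w (e # ys) u"
    using C(1) by (auto simp del: awalk_append_iff simp: awalk_append_ex)
  then have "w = v" using C(3) by (simp add: awalk_Cons_iff)
  then have "awalk v (e # ys @ xs) v" using awalk_appendI[OF w(2,1)] by simp
  then show ?thesis by blast
qed

lemma fps_fixed_by_shift: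
  fixes f :: "int fps"
  assumes "0 < n" and "f = fps_X ^ n * f"
  shows "f = 0"
proof -
  have "(1 - fps_X ^ n) * f = 0" using assms(2) by (simp add: algebra_simps)
  moreover have "(1 - fps_X ^ n :: int fps) $ 0 = 1" using assms(1) by simp
  then have "(1 - fps_X ^ n :: int fps) \<noteq> 0" by fastforce
  ultimately show ?thesis by simp
qed

lemma fps_eventually_zero_poly:
  fixes b :: "int fps"
  assumes "\<And>n. N < n \<Longrightarrow> b $ n = 0"
  obtains g where "b = fps_of_poly g"
proof
  show "b = fps_of_poly (\<Sum>i\<le>N. monom (b $ i) i)"
    by (rule fps_ext) (use assms in \<open>auto simp: coeff_sum not_le\<close>)
qed

lemma fps_below_poly:
  fixes b :: "int fps"
  assumes "\<And>n. 0 \<le> b $ n" and "\<And>n. b $ n \<le> coeff f n"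
  obtains g where "b = fps_of_poly g"
proof -
  have "b $ n = 0" if "degree f < n" for n
    using assms[of n] coeff_eq_0[OF that] by simp
  then show ?thesis using fps_eventually_zero_poly that by blast
qed

text \<open>
  The entries above the diagonal of \<open>A' + B = A + B A'\<close>, once \<open>B\<close> is known to be strictly upper
  triangular. Both directions of an in-splitting end here.
\<close>

lemma in_splitting_trail_relation:
  fixes A A' B :: "'s \<Rightarrow> 's \<Rightarrow> int fps"
  assumes rec_pq: "A' p q + B p q = fps_of_poly f + B p q * fps_X ^ y"
    and rec_qr: "A' q r + B q r = fps_of_poly g + B q r * fps_X ^ z"
    and rec_pr: "A' p r + B p r = fps_of_poly h + B p q * A' q r + B p r * fps_X ^ z"
    and A: "A p q = fps_of_poly f" "A q r = fps_of_poly g" "A p r = fps_of_poly h"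
    and B: "\<And>s t n. 0 \<le> B s t $ n" "\<And>s t n. B s t $ n \<le> A s t $ n"
  obtains f' g' h' where "A' p q = fps_of_poly f'" "A' q r = fps_of_poly g'"
    "A' p r = fps_of_poly h'" "trail_relation x y z f g h f' g' h'"
proof -
  obtain b where b: "B p q = fps_of_poly b"
    using fps_below_poly[of "B p q" f] B[of p q] A by auto
  obtain c where c: "B q r = fps_of_poly c"
    using fps_below_poly[of "B q r" g] B[of q r] A by auto
  obtain e where e: "B p r = fps_of_poly e"
    using fps_below_poly[of "B p r" h] B[of p r] A by auto
  let ?f = "f - b + b * monom 1 y" and ?g = "g - c + c * monom 1 z"
  let ?h = "h - e + b * ?g + e * monom 1 z"
  show ?thesis
  proof (rule that)
    show "A' p q = fps_of_poly ?f"
      using rec_pq by (simp add: b fps_of_poly_simps fps_of_poly_monom' algebra_simps)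
    show g': "A' q r = fps_of_poly ?g"
      using rec_qr by (simp add: c fps_of_poly_simps fps_of_poly_monom' algebra_simps)
    show "A' p r = fps_of_poly ?h"
      using rec_pr unfolding g' b e
      by (simp add: fps_of_poly_simps fps_of_poly_monom' algebra_simps)
    have "0 \<le> coeff b n \<and> coeff b n \<le> coeff f n" for n
      using B[of p q n] unfolding b A by simp
    then show "trail_relation x y z f g h ?f ?g ?h"
      by (intro trail_relation_in_split[OF _ _ HOL.refl HOL.refl HOL.refl]) auto
  qed
qed

text \<open>
  If the walk around a marked cycle ended at a wrong copy, then the recursion would give
  \<open>A'(s, s) = t^n A'(s, s)\<close> for the marked copy of \<open>s\<close>, hence \<open>A'(s, s) = 0\<close>: no walk could return to
  the marked copy, although it lies on a cycle. Going through the rows from bottom to top, this makes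
  \<open>B\<close> strictly upper triangular.
\<close>

lemma in_splitting_skeleton:
  assumes spl: "in_splitting E F m \<phi>" and E: "meteor_skeleton E p q r x y z f g h"
    and ijk: "i \<in> {1..m p}" "j \<in> {1..m q}" "k \<in> {1..m r}"
    and cyc: "\<And>v. v \<in> {\<phi> (p, i), \<phi> (q, j), \<phi> (r, k)} \<Longrightarrow> \<exists>\<alpha>. \<alpha> \<noteq> [] \<and> pre_digraph.awalk F v \<alpha> v"
  obtains f' g' h' where "meteor_skeleton F (\<phi> (p, i)) (\<phi> (q, j)) (\<phi> (r, k)) x y z f' g' h'"
    "trail_relation x y z f g h f' g' h'"
proof -
  have fin: "fin_digraph E" "fin_digraph F" and dist: "distinct [p, q, r]"
    and V: "{p, q, r} \<subseteq> verts E"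
    using E in_splitting_fin_digraph_iff[OF spl] by (auto simp: meteor_skeleton_def)
  interpret F: fin_digraph F by fact
  define A where "A = passage_gf E {p, q, r}"
  have A: "A p p = fps_X ^ x" "A q q = fps_X ^ y" "A r r = fps_X ^ z"
    "A q p = 0" "A r p = 0" "A r q = 0"
    "A p q = fps_of_poly f" "A q r = fps_of_poly g" "A p r = fps_of_poly h"
    using E by (simp_all add: meteor_skeleton_def A_def Let_def)
  define ix where "ix s = (if s = p then i else if s = q then j else k)" for s
  have ix: "ix s \<in> {1..m s}" if "s \<in> {p, q, r}" for s using that ijk by (auto simp: ix_def)
  define c where "c s = \<phi> (s, ix s)" for s
  have c: "c p = \<phi> (p, i)" "c q = \<phi> (q, j)" "c r = \<phi> (r, k)"
    using dist by (auto simp: c_def ix_def)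
  define S where "S = c ` {p, q, r}"
  have S: "S = {c p, c q, c r}" by (simp add: S_def)
  define A' where "A' s t = passage_gf F S (c s) (c t)" for s t
  obtain B where B: "\<And>s t n. 0 \<le> B s t $ n" "\<And>s t n. B s t $ n \<le> A s t $ n"
    and "\<And>s t. s \<in> {p, q, r} \<Longrightarrow> t \<in> {p, q, r} \<Longrightarrow> A' s t + B s t = A s t + (\<Sum>u\<in>{p, q, r}. B s u * A' u t)"
    using in_splitting_passages[OF spl fin(1) _ V ix] unfolding A_def A'_def S_def c_def by blast
  then have recur: "A' s t + B s t = A s t + (B s p * A' p t + B s q * A' q t + B s r * A' r t)"
    if "s \<in> {p, q, r}" "t \<in> {p, q, r}" for s t
    using that dist by (simp add: add.assoc)
  have B0: "B s t = 0" if "A s t = 0" for s t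
    using B[of s t] that by (intro fps_ext) (simp add: order_antisym)
  have Bdiag: "B s s = 0 \<or> B s s = fps_X ^ n" if "A s s = fps_X ^ n" for s n
  proof (cases "B s s $ n = 0")
    case True
    have "B s s $ i = 0" for i using B[of s s i] that True by (cases "i = n") auto
    then show ?thesis by (intro disjI1 fps_ext) simp
  next
    case False
    have "B s s $ n = 1" using B[of s s n] that False by simp
    then have "B s s $ i = fps_X ^ n $ i" for i using B[of s s i] that by (cases "i = n") auto
    then show ?thesis by (intro disjI2 fps_ext) simp
  qed
  have pos: "0 < n" if "A s t = fps_X ^ n" for s t n
    using that passage_gf_0[of E "{p, q, r}" s t] unfolding A_def by (cases n) auto
  have cinj: "c s = c t \<longleftrightarrow> s = t" if "s \<in> {p, q, r}" "t \<in> {p, q, r}" for s t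
    using in_splitting_copy_inj[OF spl, of s "ix s" t "ix t"] that V ix[of s] ix[of t]
    unfolding c_def by blast
  have cdist: "c p \<noteq> c q" "c p \<noteq> c r" "c q \<noteq> c r"
    using cinj[of p q] cinj[of p r] cinj[of q r] dist by simp_all
  have no: "first_passages F S (c s) (c t) = {}" if "A' s t = 0" for s t
    using that unfolding A'_def passage_gf_eq_0_iff[OF F.finite_arcs] .
  have stuck: False
    if T: "T \<subseteq> S" "c s \<in> S - T"
      and empty: "\<And>u t. u \<in> insert (c s) T \<Longrightarrow> t \<in> S - T \<Longrightarrow> first_passages F S u t = {}" for s T
  proof -
    obtain \<alpha> where "\<alpha> \<noteq> []" "F.awalk (c s) \<alpha> (c s)"
      using cyc[of "c s"] T(2) unfolding S c by blast
    then show False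
      using no_return[OF F.wf_digraph_axioms T empty[OF insertI2] empty[OF insertI1]] by blast
  qed
  \<comment> \<open>A marked cycle must end at its marked copy, for otherwise that copy would be on no cycle.\<close>
  have lower_r: "B r p = 0" "B r q = 0" by (auto intro: B0 A)
  have "B r r = 0"
  proof (rule ccontr)
    assume "B r r \<noteq> 0"
    then have "B r r = fps_X ^ z" using Bdiag A by blast
    then have "A' r t = fps_X ^ z * A' r t" if "t \<in> {p, q, r}" for t
      using recur[of r t] that lower_r A by auto
    then have "A' r p = 0" "A' r q = 0" "A' r r = 0"
      using fps_fixed_by_shift[OF pos[OF A(3)]] by blast+
    then have empty: "first_passages F S u t = {}" if "u \<in> {c r}" "t \<in> S - {}" for u t
      using that no unfolding S by blast
    show False
      by (rule stuck[of "{}" r, OF _ _ empty]) (use S cdist in auto)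
  qed
  then have row_r: "A' r p = 0" "A' r q = 0" "A' r r = fps_X ^ z"
    using recur[of r p] recur[of r q] recur[of r r] lower_r A by auto
  have lower_q: "B q p = 0" by (auto intro: B0 A)
  have "B q q = 0"
  proof (rule ccontr)
    assume "B q q \<noteq> 0"
    then have "B q q = fps_X ^ y" using Bdiag A by blast
    then have "A' q p = fps_X ^ y * A' q p" "A' q q = fps_X ^ y * A' q q"
      using recur[of q p] recur[of q q] lower_q A row_r by simp_all
    then have "A' q p = 0" "A' q q = 0"
      using fps_fixed_by_shift[OF pos[OF A(2)]] by blast+
    then have empty: "first_passages F S u t = {}" if "u \<in> {c q, c r}" "t \<in> S - {c r}" for u t
      using that no[of q p] no[of q q] no[OF row_r(1)] no[OF row_r(2)] unfolding S by blast
    show False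
      by (rule stuck[of "{c r}" q, OF _ _ empty]) (use S cdist in auto)
  qed
  then have row_q: "A' q p = 0" "A' q q = fps_X ^ y"
    using recur[of q p] recur[of q q] lower_q A row_r by auto
  have "B p p = 0"
  proof (rule ccontr)
    assume "B p p \<noteq> 0"
    then have "B p p = fps_X ^ x" using Bdiag A by blast
    then have "A' p p = fps_X ^ x * A' p p"
      using recur[of p p] A row_r row_q by simp
    then have "A' p p = 0"
      using fps_fixed_by_shift[OF pos[OF A(1)]] by blast
    then have empty: "first_passages F S u t = {}" if "u \<in> {c p, c q, c r}" "t \<in> S - {c q, c r}" for u t
      using that no[of p p] no[OF row_r(1)] no[OF row_q(1)] unfolding S by blast
    show False
      by (rule stuck[of "{c q, c r}" p, OF _ _ empty]) (use S cdist in auto)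
  qed
  then have row_p: "A' p p = fps_X ^ x"
    using recur[of p p] A row_r row_q by auto
  have "A' p q + B p q = fps_of_poly f + B p q * fps_X ^ y"
    "A' q r + B q r = fps_of_poly g + B q r * fps_X ^ z"
    "A' p r + B p r = fps_of_poly h + B p q * A' q r + B p r * fps_X ^ z"
    using recur[of p q] recur[of q r] recur[of p r] \<open>B p p = 0\<close> \<open>B q q = 0\<close> lower_q row_r row_q A
    by (auto simp: add.assoc)
  then obtain f' g' h' where *: "A' p q = fps_of_poly f'" "A' q r = fps_of_poly g'"
    "A' p r = fps_of_poly h'" "trail_relation x y z f g h f' g' h'"
    using in_splitting_trail_relation[of A' p q B f y r g z h A x] A B by blast
  show ?thesis
  proof (rule that)
    have "{c p, c q, c r} \<subseteq> verts F" "distinct [c p, c q, c r]"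
      using in_splitting_copy_in_verts[OF spl] V ix cinj dist by (auto simp: c_def)
    then show "meteor_skeleton F (\<phi> (p, i)) (\<phi> (q, j)) (\<phi> (r, k)) x y z f' g' h'"
      using fin(2) row_p row_q row_r * unfolding c[symmetric] meteor_skeleton_def A'_def S
      by (simp add: Let_def)
  qed fact
qed

text \<open>
  Here \<open>A'\<close> is known and \<open>A\<close> is not, and positivity replaces the argument about cycles: an equation
  \<open>B = A + B t^n\<close> with \<open>0 \<le> B \<le> A\<close> forces \<open>A = B = 0\<close>, and \<open>t^n + B = A + B t^n\<close> forces \<open>B = 0\<close>,
  first passages having positive length.
\<close>

lemma in_amalgamation_skeleton:
  assumes spl: "in_splitting E F m \<phi>"
    and F: "meteor_skeleton F (\<phi> (p, i)) (\<phi> (q, j)) (\<phi> (r, k)) x y z f' g' h'"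
    and V: "{p, q, r} \<subseteq> verts E"
    and ijk: "i \<in> {1..m p}" "j \<in> {1..m q}" "k \<in> {1..m r}"
  obtains f g h where "meteor_skeleton E p q r x y z f g h"
    "trail_relation x y z f g h f' g' h'"
proof -
  have fin: "fin_digraph E" "fin_digraph F"
    and distF: "distinct [\<phi> (p, i), \<phi> (q, j), \<phi> (r, k)]"
    using F in_splitting_fin_digraph_iff[OF spl] by (auto simp: meteor_skeleton_def)
  interpret F: fin_digraph F by fact
  let ?S = "{\<phi> (p, i), \<phi> (q, j), \<phi> (r, k)}"
  define A0 where "A0 = passage_gf F ?S"
  have A0: "A0 (\<phi> (p, i)) (\<phi> (p, i)) = fps_X ^ x" "A0 (\<phi> (q, j)) (\<phi> (q, j)) = fps_X ^ y"
    "A0 (\<phi> (r, k)) (\<phi> (r, k)) = fps_X ^ z"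
    "A0 (\<phi> (q, j)) (\<phi> (p, i)) = 0" "A0 (\<phi> (r, k)) (\<phi> (p, i)) = 0" "A0 (\<phi> (r, k)) (\<phi> (q, j)) = 0"
    "A0 (\<phi> (p, i)) (\<phi> (q, j)) = fps_of_poly f'" "A0 (\<phi> (q, j)) (\<phi> (r, k)) = fps_of_poly g'"
    "A0 (\<phi> (p, i)) (\<phi> (r, k)) = fps_of_poly h'"
    using F by (simp_all add: meteor_skeleton_def A0_def Let_def)
  have no: "first_passages F ?S s t = {}" if "A0 s t = 0" for s t
    using that unfolding A0_def passage_gf_eq_0_iff[OF F.finite_arcs] .
  \<comment> \<open>If two marked vertices of \<open>F\<close> were copies of the same vertex of \<open>E\<close>, the walk around the
    higher of their cycles, started at the marked vertex of the lower one instead, would lead from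
    the lower cycle up to the higher one.\<close>
  have loop: "\<exists>\<alpha>. \<alpha> \<noteq> [] \<and> F.awalk s \<alpha> s" if "s \<in> ?S" for s
  proof -
    have "A0 s s \<noteq> 0" using that A0 by auto
    then obtain \<alpha> where "\<alpha> \<in> first_passages F ?S s s"
      unfolding A0_def passage_gf_eq_0_iff[OF F.finite_arcs] by blast
    then show ?thesis by (auto simp: first_passages_def)
  qed
  have merge: "\<exists>\<alpha>. F.awalk (\<phi> (v, b)) \<alpha> (\<phi> (v, a))"
    if "v \<in> verts E" "a \<in> {1..m v}" "b \<in> {1..m v}" "\<phi> (v, a) \<in> ?S" for v a b
    using in_splitting_change_start[OF spl that(1-3)] loop[OF that(4)] by blast
  have apart: "v \<noteq> w"
    if w: "v \<in> verts E" "a \<in> {1..m v}" "b \<in> {1..m w}" "\<phi> (v, a) \<in> ?S"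
      and T: "T \<subseteq> ?S" "\<phi> (w, b) \<in> T" "\<phi> (v, a) \<notin> T"
      "\<And>s t. s \<in> T \<Longrightarrow> t \<in> ?S - T \<Longrightarrow> first_passages F ?S s t = {}" for v w a b T
  proof
    assume "v = w"
    then obtain \<alpha> where "F.awalk (\<phi> (w, b)) \<alpha> (\<phi> (v, a))"
      using merge[OF w(1,2) _ w(4)] w(3) by blast
    then show False
      using closed_under_walks[OF F.wf_digraph_axioms T(1,4) _ T(2) w(4)] T(3) by blast
  qed
  have "p \<noteq> q"
    by (rule apart[of p i j q "{\<phi> (q, j), \<phi> (r, k)}"])
      (use V ijk distF no[OF A0(4)] no[OF A0(5)] in auto)
  moreover have "p \<noteq> r"
    by (rule apart[of p i k r "{\<phi> (r, k)}"])
      (use V ijk distF no[OF A0(5)] no[OF A0(6)] in auto)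
  moreover have "q \<noteq> r"
    by (rule apart[of q j k r "{\<phi> (r, k)}"])
      (use V ijk distF no[OF A0(5)] no[OF A0(6)] in auto)
  ultimately have dist: "distinct [p, q, r]" by simp
  define A where "A = passage_gf E {p, q, r}"
  define ix where "ix s = (if s = p then i else if s = q then j else k)" for s
  have ix: "ix s \<in> {1..m s}" if "s \<in> {p, q, r}" for s using that ijk by (auto simp: ix_def)
  define c where "c s = \<phi> (s, ix s)" for s
  have c: "c p = \<phi> (p, i)" "c q = \<phi> (q, j)" "c r = \<phi> (r, k)"
    using dist by (auto simp: c_def ix_def)
  define A' where "A' s t = A0 (c s) (c t)" for s t
  have A': "A' p p = fps_X ^ x" "A' q q = fps_X ^ y" "A' r r = fps_X ^ z"
    "A' q p = 0" "A' r p = 0" "A' r q = 0"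
    "A' p q = fps_of_poly f'" "A' q r = fps_of_poly g'" "A' p r = fps_of_poly h'"
    using A0 by (simp_all add: A'_def c)
  have cS: "?S = c ` {p, q, r}" using c by auto
  obtain B where B: "\<And>s t n. 0 \<le> B s t $ n" "\<And>s t n. B s t $ n \<le> A s t $ n"
    and "\<And>s t. s \<in> {p, q, r} \<Longrightarrow> t \<in> {p, q, r} \<Longrightarrow> A' s t + B s t = A s t + (\<Sum>u\<in>{p, q, r}. B s u * A' u t)"
    using in_splitting_passages[OF spl fin(1) _ V ix] unfolding A_def A'_def A0_def cS c_def by blast
  then have recur: "A' s t + B s t = A s t + (B s p * A' p t + B s q * A' q t + B s r * A' r t)"
    if "s \<in> {p, q, r}" "t \<in> {p, q, r}" for s t
    using that dist by (simp add: add.assoc)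
  have B_0: "B s t $ 0 = 0" for s t
    using B[of s t 0] passage_gf_0[of E "{p, q, r}" s t] unfolding A_def by simp
  have zero: "A s t = 0 \<and> B s t = 0" if "B s t = A s t + B s t * fps_X ^ n" for s t n
  proof -
    have nth: "B s t $ l = A s t $ l + (B s t * fps_X ^ n) $ l" for l
      by (metis that fps_add_nth)
    have nn: "0 \<le> (B s t * fps_X ^ n) $ l" for l using B by (simp add: fps_X_power_mult_right_nth)
    have "(B s t * fps_X ^ n) $ l = 0" for l using nth[of l] nn[of l] B(2)[of s t l] by linarith
    from this[of "l + n" for l] have "B s t = 0"
      by (intro fps_ext) (simp add: fps_X_power_mult_right_nth)
    then show ?thesis using that by simp
  qed
  have diag: "A s s = fps_X ^ n \<and> B s s = 0" if "fps_X ^ n + B s s = A s s + B s s * fps_X ^ n" for s n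
  proof -
    have eq: "(fps_X ^ n + B s s) $ (l + n) = (A s s + B s s * fps_X ^ n) $ (l + n)" for l
      using that by simp
    have "B s s $ (l + n) = A s s $ (l + n) + B s s $ l" if "l \<noteq> 0" for l
      using eq[of l] that by (simp add: fps_X_power_mult_right_nth)
    then have "B s s $ l = 0" if "l \<noteq> 0" for l
      using B(1)[of s s l] B(2)[of s s "l + n"] that by (metis add_le_same_cancel1 order_antisym)
    then have "B s s = 0" using B_0 by (intro fps_ext) (metis fps_zero_nth)
    then show ?thesis using that by simp
  qed
  have rp: "A r p = 0" "B r p = 0" using recur[of r p] A' zero[of r p x] by auto
  have rq: "A r q = 0" "B r q = 0" using recur[of r q] A' rp zero[of r q y] by auto
  have rr: "A r r = fps_X ^ z" "B r r = 0" using recur[of r r] A' rp rq diag[of z r] by auto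
  have qp: "A q p = 0" "B q p = 0" using recur[of q p] A' zero[of q p x] by auto
  have qq: "A q q = fps_X ^ y" "B q q = 0" using recur[of q q] A' qp diag[of y q] by auto
  have pp: "A p p = fps_X ^ x" "B p p = 0" using recur[of p p] A' diag[of x p] by auto
  have rec': "A' p q + B p q = A p q + B p q * fps_X ^ y"
    "A' q r + B q r = A q r + B q r * fps_X ^ z"
    "A' p r + B p r = A p r + B p q * A' q r + B p r * fps_X ^ z"
    using recur[of p q] recur[of q r] recur[of p r] pp qq qp A' by (auto simp: add.assoc)
  have poly: "\<exists>a. A s t = fps_of_poly a"
    if eq: "fps_of_poly a' + B s t = A s t + D + B s t * fps_X ^ n" and D: "\<And>l. 0 \<le> D $ l" for s t a' D n
  proof -
    have nth: "coeff a' l + B s t $ l = A s t $ l + D $ l + (B s t * fps_X ^ n) $ l" for l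
      using arg_cong[OF eq, of "\<lambda>f. f $ l"] by simp
    have nn: "0 \<le> (B s t * fps_X ^ n) $ l" for l using B by (simp add: fps_X_power_mult_right_nth)
    have "B s t $ l \<le> coeff a' (l + n)" for l
      using nth[of "l + n"] D[of "l + n"] B(2)[of s t "l + n"]
      by (simp add: fps_X_power_mult_right_nth)
    then have "B s t $ l = 0" if "degree a' < l" for l
      using B(1)[of s t l] that coeff_eq_0[of a' "l + n"] by (metis order_antisym trans_less_add1)
    then obtain b where b: "B s t = fps_of_poly b" using fps_eventually_zero_poly by blast
    have "A s t $ l \<le> coeff (a' + b) l" for l
      using nth[of l] nn[of l] D[of l] by (simp add: b)
    moreover have "0 \<le> A s t $ l" for l using B[of s t l] by linarith
    ultimately show ?thesis using fps_below_poly[of "A s t" "a' + b"] by blast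
  qed
  obtain f where f: "A p q = fps_of_poly f" using poly[of f' p q 0 y] rec'(1) A' by auto
  obtain g where g: "A q r = fps_of_poly g" using poly[of g' q r 0 z] rec'(2) A' by auto
  have "0 \<le> (B p q * A' q r) $ l" for l
    using B(1) passage_gf_nonneg unfolding A'_def A0_def
    by (auto simp: fps_mult_nth intro!: sum_nonneg mult_nonneg_nonneg)
  then obtain h where h: "A p r = fps_of_poly h"
    using poly[of h' p r "B p q * A' q r" z] rec'(3) A' by auto
  obtain f1 g1 h1 where "A' p q = fps_of_poly f1" "A' q r = fps_of_poly g1"
    "A' p r = fps_of_poly h1" "trail_relation x y z f g h f1 g1 h1"
    using in_splitting_trail_relation[of A' p q B f y r g z h A x] rec' f g h B by metis
  then have "trail_relation x y z f g h f' g' h'"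
    using A' by (simp add: fps_of_poly_eq_iff)
  moreover have "meteor_skeleton E p q r x y z f g h"
    using fin(1) dist V rp(1) rq(1) rr(1) qp(1) qq(1) pp(1) f g h
    unfolding meteor_skeleton_def A_def by (simp add: Let_def)
  ultimately show ?thesis using that by blast
qed

section \<open>Transposition\<close>

lemma transpose_simps [simp]:
  "verts (transpose_digraph G) = verts G" "arcs (transpose_digraph G) = arcs G"
  "tail (transpose_digraph G) = head G" "head (transpose_digraph G) = tail G"
  by (simp_all add: transpose_digraph_def)

lemma transpose_transpose [simp]: "transpose_digraph (transpose_digraph G) = G"
  by (simp add: transpose_digraph_def)

lemma wf_transpose: "wf_digraph G \<Longrightarrow> wf_digraph (transpose_digraph G)"
  by (simp add: wf_digraph_def)

lemma fin_transpose: "fin_digraph G \<Longrightarrow> fin_digraph (transpose_digraph G)"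
  using wf_transpose by (auto simp: fin_digraph_def fin_digraph_axioms_def)

lemma transpose_walk:
  assumes "wf_digraph G" and "pre_digraph.awalk G u \<alpha> v"
  shows "pre_digraph.awalk (transpose_digraph G) v (rev \<alpha>) u"
proof -
  interpret G: wf_digraph G by fact
  interpret T: wf_digraph "transpose_digraph G" by (rule wf_transpose) fact
  show ?thesis using assms(2)
  proof (induction \<alpha> arbitrary: u)
    case Nil
    then show ?case by (auto simp: G.awalk_Nil_iff T.awalk_Nil_iff)
  next
    case (Cons e \<alpha>)
    then have e: "e \<in> arcs G" "tail G e = u" "G.awalk (head G e) \<alpha> v"
      by (simp_all add: G.awalk_Cons_iff)
    have "T.awalk (head G e) [e] u"
      using e(1,2) by (auto simp: T.awalk_Cons_iff T.awalk_Nil_iff)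
    then show ?case using T.awalk_appendI[OF Cons.IH[OF e(3)]] by simp
  qed
qed

lemma (in wf_digraph) walk_interior:
  "awalk u \<alpha> v \<Longrightarrow> map (tail G) (tl \<alpha>) = map (head G) (butlast \<alpha>)"
proof (induction \<alpha> arbitrary: u)
  case (Cons e \<alpha>)
  then show ?case by (cases \<alpha>) (auto simp: awalk_Cons_iff)
qed simp

lemma transpose_first_passages:
  assumes "wf_digraph G"
  shows "rev ` first_passages G S u v \<subseteq> first_passages (transpose_digraph G) S v u"
proof
  interpret wf_digraph G by fact
  fix \<beta> assume "\<beta> \<in> rev ` first_passages G S u v"
  then obtain \<alpha> where \<alpha>: "\<beta> = rev \<alpha>" "\<alpha> \<noteq> []" "awalk u \<alpha> v"
    "head G ` set (butlast \<alpha>) \<inter> S = {}" by (auto simp: first_passages_def)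
  have "butlast (rev \<alpha>) = rev (tl \<alpha>)" by (cases \<alpha>) auto
  then have "tail G ` set (butlast (rev \<alpha>)) = head G ` set (butlast \<alpha>)"
    using walk_interior[OF \<alpha>(3)] by (metis set_map set_rev)
  then show "\<beta> \<in> first_passages (transpose_digraph G) S v u"
    using \<alpha> transpose_walk[OF wf_digraph_axioms \<alpha>(3)] by (simp add: first_passages_def)
qed

lemma transpose_passage_gf:
  assumes "wf_digraph G"
  shows "passage_gf (transpose_digraph G) S v u = passage_gf G S u v"
proof -
  have "first_passages (transpose_digraph G) S v u \<subseteq> rev ` first_passages G S u v"
  proof
    fix \<beta> assume "\<beta> \<in> first_passages (transpose_digraph G) S v u"
    then have "rev \<beta> \<in> first_passages G S u v"
      using transpose_first_passages[OF wf_transpose[OF assms], of S v u] by auto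
    then show "\<beta> \<in> rev ` first_passages G S u v" by (metis image_eqI rev_rev_ident)
  qed
  then have "first_passages (transpose_digraph G) S v u = rev ` first_passages G S u v"
    using transpose_first_passages[OF assms, of S u v] by blast
  then show ?thesis by (simp add: passage_gf_def walk_gf_image)
qed

lemma transpose_skeleton:
  assumes "meteor_skeleton G p q r x y z f g h"
  shows "meteor_skeleton (transpose_digraph G) r q p z y x g f h"
proof -
  have fin: "fin_digraph G" using assms by (simp add: meteor_skeleton_def)
  then have "wf_digraph G" by (simp add: fin_digraph_def)
  moreover have "{r, q, p} = {p, q, r}" by auto
  ultimately show ?thesis
    using assms fin_transpose[OF fin] unfolding meteor_skeleton_def Let_def
    by (auto simp: transpose_passage_gf)
qed

section \<open>Invariance under the moves\<close>

text \<open>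
  An amalgamation is a splitting read backwards, and the relation is symmetric. For the moves that
  split or merge along outgoing arcs the graphs are transposed, which reverses the chain of cycles.
\<close>

lemma move_skeleton:
  assumes "move G H \<sigma>" and G: "meteor_skeleton G p q r x y z f g h"
    and \<sigma>: "(p, p') \<in> \<sigma>" "(q, q') \<in> \<sigma>" "(r, r') \<in> \<sigma>"
  shows "\<exists>f' g' h'. meteor_skeleton H p' q' r' x y z f' g' h' \<and>
    trail_relation x y z f g h f' g' h'"
proof -
  have fin: "fin_digraph G" using G by (simp add: meteor_skeleton_def)
  have GT: "meteor_skeleton (transpose_digraph G) r q p z y x g f h"
    by (rule transpose_skeleton[OF G])
  show ?thesis using assms(1)
  proof cases
    case (in_split m \<phi>)
    obtain i j k where ijk: "i \<in> {1..m p}" "j \<in> {1..m q}" "k \<in> {1..m r}"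
      and [simp]: "p' = \<phi> (p, i)" "q' = \<phi> (q, j)" "r' = \<phi> (r, k)"
      and cyc: "p' \<in> cycle_verts H" "q' \<in> cycle_verts H" "r' \<in> cycle_verts H"
      using \<sigma> unfolding in_split copy_rel_def by blast
    have "wf_digraph H"
      using in_splitting_fin_digraph_iff[OF in_split(2)] fin by (simp add: fin_digraph_def)
    then have closed: "\<exists>\<alpha>. \<alpha> \<noteq> [] \<and> pre_digraph.awalk H v \<alpha> v"
      if "v \<in> {\<phi> (p, i), \<phi> (q, j), \<phi> (r, k)}" for v
      using that cyc cycle_verts_closed_walk by auto
    show ?thesis
      by (rule in_splitting_skeleton[OF in_split(2) G ijk closed]) auto
  next
    case (out_split m \<phi>)
    obtain i j k where ijk: "k \<in> {1..m r}" "j \<in> {1..m q}" "i \<in> {1..m p}"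
      and [simp]: "p' = \<phi> (p, i)" "q' = \<phi> (q, j)" "r' = \<phi> (r, k)"
      and cyc: "p' \<in> cycle_verts H" "q' \<in> cycle_verts H" "r' \<in> cycle_verts H"
      using \<sigma> unfolding out_split copy_rel_def by blast
    note spl = out_split(2)[unfolded out_splitting_def]
    have wfT: "wf_digraph (transpose_digraph H)"
      using in_splitting_fin_digraph_iff[OF spl] fin_transpose[OF fin] by (simp add: fin_digraph_def)
    then have wf: "wf_digraph H" using wf_transpose by fastforce
    have closed: "\<exists>\<alpha>. \<alpha> \<noteq> [] \<and> pre_digraph.awalk (transpose_digraph H) v \<alpha> v"
      if "v \<in> {\<phi> (r, k), \<phi> (q, j), \<phi> (p, i)}" for v
    proof -
      have "v \<in> cycle_verts H" using that cyc by auto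
      then obtain \<alpha> where "\<alpha> \<noteq> []" "pre_digraph.awalk H v \<alpha> v"
        using cycle_verts_closed_walk[OF wf] by blast
      then show ?thesis using transpose_walk[OF wf] by (intro exI[of _ "rev \<alpha>"]) auto
    qed
    obtain f' g' h' where *:
      "meteor_skeleton (transpose_digraph H) r' q' p' z y x g' f' h'"
      "trail_relation z y x g f h g' f' h'"
      by (rule in_splitting_skeleton[OF spl GT ijk closed]) auto
    show ?thesis using transpose_skeleton[OF *(1)] trail_relation_swap[OF *(2)] by auto
  next
    case (in_amalg m \<phi> v)
    obtain i j k where ijk: "i \<in> {1..m p'}" "j \<in> {1..m q'}" "k \<in> {1..m r'}"
      and pqr: "p = \<phi> (p', i)" "q = \<phi> (q', j)" "r = \<phi> (r', k)" and V: "{p', q', r'} \<subseteq> verts H"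
      using \<sigma> unfolding in_amalg copy_rel_def by blast
    then show ?thesis
      using in_amalgamation_skeleton[OF in_amalg(2) G[unfolded pqr] V ijk] trail_relation_sym
      by metis
  next
    case (out_amalg m \<phi> v)
    obtain i j k where ijk: "k \<in> {1..m r'}" "j \<in> {1..m q'}" "i \<in> {1..m p'}"
      and pqr: "p = \<phi> (p', i)" "q = \<phi> (q', j)" "r = \<phi> (r', k)"
      and V: "{r', q', p'} \<subseteq> verts (transpose_digraph H)"
      using \<sigma> unfolding out_amalg copy_rel_def by auto
    obtain f' g' h' where *:
      "meteor_skeleton (transpose_digraph H) r' q' p' z y x g' f' h'"
      "trail_relation z y x g' f' h' g f h"
      using in_amalgamation_skeleton[OF out_amalg(2)[unfolded out_splitting_def] GT[unfolded pqr] V ijk]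
      by metis
    show ?thesis
      using transpose_skeleton[OF *(1)] trail_relation_swap[OF trail_relation_sym[OF *(2)]] by auto
  qed
qed

lemma moves_skeleton:
  assumes "moves G H \<rho>" and "meteor_skeleton G p q r x y z f g h"
    and "(p, p') \<in> \<rho>" "(q, q') \<in> \<rho>" "(r, r') \<in> \<rho>"
  shows "\<exists>f' g' h'. meteor_skeleton H p' q' r' x y z f' g' h' \<and>
    trail_relation x y z f g h f' g' h'"
  using assms
proof (induction arbitrary: p' q' r')
  case (refl G)
  then have "p' = p" "q' = q" "r' = r" by auto
  then show ?case using trail_relation_refl refl.prems(1) by blast
next
  case (step G H \<rho> K \<sigma>)
  obtain p1 q1 r1 where 1: "(p, p1) \<in> \<rho>" "(q, q1) \<in> \<rho>" "(r, r1) \<in> \<rho>"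
    and 2: "(p1, p') \<in> \<sigma>" "(q1, q') \<in> \<sigma>" "(r1, r') \<in> \<sigma>"
    using step.prems(2-4) by blast
  obtain f1 g1 h1 where 3: "meteor_skeleton H p1 q1 r1 x y z f1 g1 h1"
    "trail_relation x y z f g h f1 g1 h1"
    using step.IH[OF step.prems(1) 1] by blast
  then show ?case
    using move_skeleton[OF step.hyps(2) 3(1) 2] trail_relation_trans[OF 3(2)] by blast
qed

section \<open>Passages in a meteor graph in normal form\<close>

lemma same_cycle_refl: "same_cycle C C"
  unfolding same_cycle_def by (rule exI[of _ 0]) simp

lemma same_cycle_trans: "same_cycle A B \<Longrightarrow> same_cycle B C \<Longrightarrow> same_cycle A C"
  unfolding same_cycle_def by (metis rotate_rotate)

lemma same_cycle_sym:
  assumes "same_cycle A B"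
  shows "same_cycle B A"
proof (cases "A = []")
  case True
  then show ?thesis using assms by (auto simp: same_cycle_def)
next
  case False
  obtain n where n: "B = rotate n A" using assms by (auto simp: same_cycle_def)
  let ?l = "length A"
  have "rotate (?l - n mod ?l) B = rotate (?l - n mod ?l + n mod ?l) A"
    by (metis n rotate_conv_mod rotate_rotate)
  also have "?l - n mod ?l + n mod ?l = ?l" using False by simp
  finally have "A = rotate (?l - n mod ?l) B" by simp
  then show ?thesis unfolding same_cycle_def by blast
qed

lemma same_cycle_verts: "same_cycle A B \<Longrightarrow> verts_of_cycle G A = verts_of_cycle G B"
  by (auto simp: same_cycle_def verts_of_cycle_def)

lemma same_cycle_length: "same_cycle A B \<Longrightarrow> length A = length B"
  by (auto simp: same_cycle_def)

context wf_digraph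
begin

lemma cycle_iff: "cycle C \<longleftrightarrow> C \<noteq> [] \<and> (\<exists>u. awalk u C u) \<and> distinct (map (head G) C)"
proof -
  have "tl (awalk_verts u C) = map (head G) C" if "awalk u C u" "C \<noteq> []" for u
    using that awalk_verts_conv'[of u C u] by (auto simp: awalk_def)
  then show ?thesis unfolding cycle_def by (metis (no_types, lifting))
qed

lemma rotate_cycle_to:
  assumes "cycle C" and "v \<in> verts_of_cycle G C"
  obtains D where "same_cycle C D" "cycle D" "awalk v D v"
proof -
  obtain u where u: "awalk u C u" and C: "C \<noteq> []" "distinct (map (head G) C)"
    using assms(1) by (auto simp: cycle_iff)
  obtain e where e: "e \<in> set C" "v = tail G e"
    using assms(2) by (auto simp: verts_of_cycle_def)
  obtain xs ys where xy: "C = xs @ e # ys" using e(1) by (metis split_list)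
  obtain w where w: "awalk u xs w" "awalk w (e # ys) u"
    using u unfolding xy awalk_append_ex by blast
  have "w = v" using w(2) e(2) by (simp add: awalk_Cons_iff)
  let ?D = "e # ys @ xs"
  have D: "?D = rotate (length xs) C" by (simp add: xy rotate_append)
  have walk: "awalk v ?D v" using awalk_appendI[OF w(2,1)] \<open>w = v\<close> by simp
  moreover have "distinct (map (head G) ?D)" using C(2) by (auto simp: xy)
  ultimately have "cycle ?D" unfolding cycle_iff by blast
  then show ?thesis using that D walk unfolding same_cycle_def by blast
qed

lemma walk_interior_set:
  assumes "awalk u \<alpha> v"
  shows "head G ` set (butlast \<alpha>) = tail G ` set (tl \<alpha>)"
  using walk_interior[OF assms] by (metis set_map)

lemma arc_reachable: "e \<in> arcs G \<Longrightarrow> tail G e \<rightarrow>\<^sup>* head G e"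
  using in_arcs_imp_in_arcs_ends reachable_adjI by blast

lemma closed_walk_heads:
  assumes "awalk u C u"
  shows "head G ` set C = tail G ` set C"
proof (cases "C = []")
  case False
  have "set C = insert (hd C) (set (tl C))" "set C = insert (last C) (set (butlast C))"
    using False by (metis list.exhaust_sel list.simps(15))
      (metis False append_butlast_last_id list.simps(15) rotate1.simps(2) set_rotate1)
  moreover have "head G (last C) = u" using awalk_last[OF assms False] by simp
  moreover have "tail G (hd C) = u" using assms False by (cases C) (auto simp: awalk_Cons_iff)
  moreover have "head G ` set (butlast C) = tail G ` set (tl C)"
    using walk_interior_set[OF assms] by simp
  ultimately show ?thesis by (metis image_insert)
qed simp

lemma cycle_heads: "cycle C \<Longrightarrow> head G ` set C = verts_of_cycle G C"
  using closed_walk_heads unfolding cycle_iff verts_of_cycle_def by blast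

lemma cycle_through_arc:
  assumes "e \<in> arcs G" and "head G e \<rightarrow>\<^sup>* tail G e"
  obtains \<alpha> where "cycle (e # \<alpha>)" "awalk (tail G e) (e # \<alpha>) (tail G e)"
proof -
  obtain \<alpha> where \<alpha>: "apath (head G e) \<alpha> (tail G e)"
    using assms(2) reachable_apath by blast
  then have walk: "awalk (tail G e) (e # \<alpha>) (tail G e)"
    using assms(1) by (auto simp: awalk_Cons_iff apath_def)
  have "awalk_verts (head G e) \<alpha> = map (head G) (e # \<alpha>)"
    using \<alpha> awalk_verts_conv'[of "head G e" \<alpha> "tail G e"]
    by (cases \<alpha>) (auto simp: apath_def awalk_Cons_iff awalk_def)
  then have "cycle (e # \<alpha>)"
    using walk \<alpha> unfolding cycle_iff apath_def by auto
  then show ?thesis using that walk by blast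
qed

lemma closed_walk_in_cycle_verts:
  assumes "awalk v \<alpha> v" and "\<alpha> \<noteq> []"
  shows "v \<in> cycle_verts G"
proof -
  obtain e \<beta> where \<alpha>: "\<alpha> = e # \<beta>" using assms(2) by (cases \<alpha>) auto
  then have e: "e \<in> arcs G" "tail G e = v" "awalk (head G e) \<beta> v"
    using assms(1) by (auto simp: awalk_Cons_iff)
  then have "head G e \<rightarrow>\<^sup>* tail G e" using reachable_awalk by blast
  then obtain \<gamma> where "cycle (e # \<gamma>)" using cycle_through_arc[OF e(1)] by blast
  then show ?thesis using e(2) unfolding cycle_verts_def verts_of_cycle_def by force
qed

lemma cycle_verts_reachable:
  assumes "cycle C" and "u \<in> verts_of_cycle G C" and "v \<in> verts_of_cycle G C"
  shows "u \<rightarrow>\<^sup>* v"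
proof -
  obtain D where D: "same_cycle C D" "awalk u D u" using rotate_cycle_to[OF assms(1,2)] by blast
  have "v \<in> tail G ` set D" using assms(3) same_cycle_verts[OF D(1), of G] by (simp add: verts_of_cycle_def)
  then obtain xs e ys where e: "D = xs @ e # ys" "v = tail G e" by (auto dest: split_list)
  obtain w where w: "awalk u xs w" "awalk w (e # ys) u" using D(2) unfolding e(1) awalk_append_ex by blast
  have "w = v" using w(2) e(2) by (simp add: awalk_Cons_iff)
  then show ?thesis using w(1) reachable_awalk by blast
qed

end

locale disjoint_cycles_graph = fin_digraph G for G (structure) +
  assumes disj: "disjoint_cycles G"
begin

lemma cycles_meet:
  assumes "cycle C" "cycle D" and "v \<in> verts_of_cycle G C" "v \<in> verts_of_cycle G D"
  shows "same_cycle C D"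
proof -
  obtain C' where C': "same_cycle C C'" "cycle C'" "awalk v C' v" using rotate_cycle_to assms(1,3) .
  obtain D' where D': "same_cycle D D'" "cycle D'" "awalk v D' v" using rotate_cycle_to assms(2,4) .
  have "C' = D'" using disj C' D' unfolding disjoint_cycles_def by blast
  then show ?thesis using C'(1) D'(1) same_cycle_sym same_cycle_trans by blast
qed

text \<open>
  Every arc of a closed walk lies on a cycle together with both of its ends. As the cycles are
  disjoint, this is always the cycle on which the walk started.
\<close>

lemma return_to_cycle:
  assumes "cycle C" and "awalk u \<alpha> v" and "u \<in> verts_of_cycle G C" and "v \<rightarrow>\<^sup>* u"
  shows "v \<in> verts_of_cycle G C"
  using assms(2-4)
proof (induction \<alpha> arbitrary: u)
  case Nil
  then show ?case by (simp add: awalk_Nil_iff)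
next
  case (Cons e \<alpha>)
  then have e: "e \<in> arcs G" "tail G e = u" "awalk (head G e) \<alpha> v" by (auto simp: awalk_Cons_iff)
  have hv: "head G e \<rightarrow>\<^sup>* v" using e(3) reachable_awalk by blast
  then have "head G e \<rightarrow>\<^sup>* tail G e" using Cons.prems(3) e(2) reachable_trans by blast
  then obtain \<beta> where D: "cycle (e # \<beta>)" using cycle_through_arc[OF e(1)] by blast
  have "u \<in> verts_of_cycle G (e # \<beta>)" using e(2) by (auto simp: verts_of_cycle_def)
  then have "verts_of_cycle G C = verts_of_cycle G (e # \<beta>)"
    by (intro same_cycle_verts cycles_meet[OF assms(1) D Cons.prems(2)])
  then have "head G e \<in> verts_of_cycle G C" using cycle_heads[OF D] by auto
  moreover have "v \<rightarrow>\<^sup>* head G e"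
    using Cons.prems(3) reachable_trans arc_reachable[OF e(1)] e(2) by blast
  ultimately show ?case using Cons.IH[OF e(3)] by blast
qed

text \<open>
  Both arcs start a cycle at the same vertex, and disjointness leaves room for only one such cycle.
\<close>

lemma returning_arc_unique:
  assumes "e \<in> arcs G" "head G e \<rightarrow>\<^sup>* tail G e" and "e' \<in> arcs G" "head G e' \<rightarrow>\<^sup>* tail G e'"
    and "tail G e = tail G e'"
  shows "e = e'"
proof -
  obtain \<alpha> where \<alpha>: "cycle (e # \<alpha>)" "awalk (tail G e) (e # \<alpha>) (tail G e)"
    using cycle_through_arc[OF assms(1,2)] .
  obtain \<beta> where \<beta>: "cycle (e' # \<beta>)" "awalk (tail G e') (e' # \<beta>) (tail G e')"
    using cycle_through_arc[OF assms(3,4)] .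
  have "e # \<alpha> = e' # \<beta>" using disj \<alpha> \<beta> assms(1,5) unfolding disjoint_cycles_def
    by (metis tail_in_verts)
  then show ?thesis by simp
qed

text \<open>
  From a vertex on a cycle there is only one way to proceed without losing the possibility to return.
\<close>

lemma closed_walks_comparable:
  assumes "awalk u \<alpha> v" "v \<rightarrow>\<^sup>* u" and "awalk u \<beta> w" "w \<rightarrow>\<^sup>* u"
  shows "\<exists>\<gamma>. \<alpha> = \<beta> @ \<gamma> \<or> \<beta> = \<alpha> @ \<gamma>"
  using assms
proof (induction \<alpha> arbitrary: u \<beta>)
  case (Cons e \<alpha>)
  show ?case
  proof (cases \<beta>)
    case (Cons e' \<beta>')
    have e: "e \<in> arcs G" "tail G e = u" "awalk (head G e) \<alpha> v"
      and e': "e' \<in> arcs G" "tail G e' = u" "awalk (head G e') \<beta>' w"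
      using Cons.prems Cons by (auto simp: awalk_Cons_iff)
    have "head G e \<rightarrow>\<^sup>* u" "head G e' \<rightarrow>\<^sup>* u"
      using e(3) e'(3) Cons.prems(2,4) reachable_trans reachable_awalk by blast+
    then have "e = e'" using returning_arc_unique[of e e'] e e' by simp
    moreover have "v \<rightarrow>\<^sup>* head G e" "w \<rightarrow>\<^sup>* head G e"
      using Cons.prems(2,4) reachable_trans arc_reachable[OF e(1)] e(2) by blast+
    ultimately show ?thesis using Cons.IH[of "head G e" \<beta>'] e e' Cons by auto
  qed auto
qed blast

lemma first_passages_cycle:
  assumes C: "cycle C" and S: "S \<inter> verts_of_cycle G C = {s}"
  obtains D where "first_passages G S s s = {D}" "length D = length C"
proof -
  have s: "s \<in> verts_of_cycle G C" "s \<in> S" using S by auto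
  obtain D where D: "same_cycle C D" "cycle D" "awalk s D s" using rotate_cycle_to[OF C s(1)] .
  have ne: "D \<noteq> []" and dist: "distinct (map (head G) D)" using D(2) by (auto simp: cycle_iff)
  have D_in: "D \<in> first_passages G S s s"
  proof -
    have "head G ` set (butlast D) \<subseteq> verts_of_cycle G C"
      using cycle_heads[OF D(2)] same_cycle_verts[OF D(1), of G]
      by (metis image_mono in_set_butlastD subsetI)
    moreover have "s \<notin> head G ` set (butlast D)"
    proof -
      have "map (head G) (butlast D @ [last D]) = map (head G) (butlast D) @ [s]"
        using awalk_last[OF D(3) ne] by simp
      then have "map (head G) D = map (head G) (butlast D) @ [s]"
        unfolding append_butlast_last_id[OF ne] .
      then show ?thesis using dist by auto
    qed
    ultimately have "head G ` set (butlast D) \<inter> S = {}"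
    proof (intro equals0I, elim IntE)
      fix v assume "v \<in> head G ` set (butlast D)" "v \<in> S"
      then have "v \<in> S \<inter> verts_of_cycle G C" "v \<noteq> s"
        using \<open>head G ` set (butlast D) \<subseteq> verts_of_cycle G C\<close>
          \<open>s \<notin> head G ` set (butlast D)\<close> by (blast, metis)
      then show False unfolding S by simp
    qed
    then show ?thesis using ne D(3) by (simp add: first_passages_def)
  qed
  have "\<alpha> = D" if \<alpha>: "\<alpha> \<in> first_passages G S s s" for \<alpha>
  proof -
    have walk: "awalk s \<alpha> s" using \<alpha> by (simp add: first_passages_def)
    have "s \<rightarrow>\<^sup>* s" using walk reachable_awalk by blast
    then obtain \<gamma> where "\<alpha> @ [] = D @ \<gamma> \<or> D @ [] = \<alpha> @ \<gamma>"
      using closed_walks_comparable[OF walk _ D(3)] by auto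
    then show ?thesis
      using first_passage_prefix_unique[OF wf_digraph_axioms s(2) s(2)] \<alpha> D_in by metis
  qed
  then have "first_passages G S s s = {D}" using D_in by blast
  then show ?thesis using that same_cycle_length[OF D(1)] by simp
qed

text \<open>
  A repeated interior vertex would lie on a closed walk, hence on a cycle.
\<close>

lemma cycle_trail_length:
  assumes "cycle_trail G A B \<alpha>"
  shows "length \<alpha> \<le> Suc (card (verts G))"
proof -
  obtain u v where walk: "awalk u \<alpha> v" and "\<alpha> \<noteq> []"
    and inner: "set (inner_verts \<alpha>) \<inter> cycle_verts G = {}"
    using assms by (auto simp: cycle_trail_def)
  have "distinct (map (head G) (butlast \<alpha>))"
  proof (rule ccontr)
    assume "\<not> distinct (map (head G) (butlast \<alpha>))"
    then obtain xs ys zs y where "map (head G) (butlast \<alpha>) = xs @ [y] @ ys @ [y] @ zs"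
      using not_distinct_decomp by blast
    then obtain as e bs e' cs where *: "butlast \<alpha> = as @ [e] @ bs @ [e'] @ cs"
      "head G e = y" "head G e' = y" 
      by (auto simp: map_eq_append_conv map_eq_Cons_conv append_eq_map_conv Cons_eq_map_conv)
    have "\<alpha> = butlast \<alpha> @ [last \<alpha>]" using \<open>\<alpha> \<noteq> []\<close> by simp
    then obtain l where \<alpha>: "\<alpha> = (as @ [e]) @ ((bs @ [e']) @ (cs @ [l]))"
      unfolding *(1) append_assoc by blast
    obtain w w' where w: "awalk u (as @ [e]) w" and w': "awalk w (bs @ [e']) w'"
      using walk[unfolded \<alpha> awalk_append_ex[of u "as @ [e]"]]
        awalk_append_ex[of _ "bs @ [e']" "cs @ [l]"] by blast
    have "w = y" "w' = y" using awalk_last[OF w] awalk_last[OF w'] * by simp_all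
    then have "y \<in> cycle_verts G" using closed_walk_in_cycle_verts[of y "bs @ [e']"] w' by simp
    moreover have "y \<in> head G ` set (butlast \<alpha>)" using * by auto
    ultimately show False using inner walk_interior_set[OF walk] by (auto simp: inner_verts_def map_tl[symmetric])
  qed
  moreover have "set (map (head G) (butlast \<alpha>)) \<subseteq> verts G"
    using walk by (auto simp: awalk_def dest!: in_set_butlastD)
  ultimately have "length (butlast \<alpha>) \<le> card (verts G)"
    using card_mono[OF finite_verts] distinct_card by (metis length_map)
  then show ?thesis by simp
qed

end

lemma cycle_trail_same_cycle:
  assumes "wf_digraph G" and "cycle_trail G A B \<alpha>" and "same_cycle A A'" "same_cycle B B'"
    and "pre_digraph.cycle G A'" "pre_digraph.cycle G B'"
  shows "cycle_trail G A' B' \<alpha>"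
  using assms(2,5,6) same_cycle_verts[OF assms(3), of G] same_cycle_verts[OF assms(4), of G]
    same_cycle_trans[OF same_cycle_trans[OF assms(3)] same_cycle_sym[OF assms(4)]]
  unfolding cycle_trail_def by auto

locale normal_meteor =
  fixes G :: "('a, 'b) pre_digraph" (structure) and P Q R p q r
  assumes meteor: "meteor_graph3 G P Q R" and normal: "normal_form G P Q R p q r"

sublocale normal_meteor \<subseteq> disjoint_cycles_graph
  using meteor
  by (auto simp: meteor_graph3_def essential_def disjoint_cycles_graph_def
      disjoint_cycles_graph_axioms_def)

context normal_meteor
begin

abbreviation "S \<equiv> {p, q, r}"

lemma cycle_cases: "cycle C \<longleftrightarrow> same_cycle P C \<or> same_cycle Q C \<or> same_cycle R C"
  using meteor by (simp add: meteor_graph3_def)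

lemma cycles: "cycle P" "cycle Q" "cycle R"
  unfolding cycle_cases using same_cycle_refl by blast+

lemma distinct_cycles: "\<not> same_cycle P Q" "\<not> same_cycle Q R" "\<not> same_cycle P R"
  using meteor by (simp_all add: meteor_graph3_def)

lemma marked: "p \<in> verts_of_cycle G P" "q \<in> verts_of_cycle G Q" "r \<in> verts_of_cycle G R"
  using normal by (simp_all add: normal_form_def)

lemma cycle_verts_eq:
  "cycle_verts G = verts_of_cycle G P \<union> verts_of_cycle G Q \<union> verts_of_cycle G R"
proof
  show "cycle_verts G \<subseteq> verts_of_cycle G P \<union> verts_of_cycle G Q \<union> verts_of_cycle G R"
    unfolding cycle_verts_def cycle_cases using same_cycle_verts[of _ _ G] by blast
  show "verts_of_cycle G P \<union> verts_of_cycle G Q \<union> verts_of_cycle G R \<subseteq> cycle_verts G"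
    unfolding cycle_verts_def using cycles by blast
qed

lemma cycles_disjoint:
  "verts_of_cycle G P \<inter> verts_of_cycle G Q = {}" "verts_of_cycle G Q \<inter> verts_of_cycle G R = {}"
  "verts_of_cycle G P \<inter> verts_of_cycle G R = {}"
  using cycles_meet cycles distinct_cycles by blast+

lemma cycle_vert_in_verts:
  assumes "cycle C" and "v \<in> verts_of_cycle G C"
  shows "v \<in> verts G"
  using assms by (auto simp: cycle_def awalk_def verts_of_cycle_def)

lemma descend:
  assumes C: "cycle C" "cycle D" "cycle_gt G C D"
    and uv: "u \<in> verts_of_cycle G C" "v \<in> verts_of_cycle G D"
  shows "u \<rightarrow>\<^sup>* v" "\<not> v \<rightarrow>\<^sup>* u"
proof -
  obtain u' v' where *: "u' \<in> verts_of_cycle G C" "v' \<in> verts_of_cycle G D" "u' \<rightarrow>\<^sup>* v'"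
    using C(3) by (auto simp: cycle_gt_def cycle_ge_def)
  have "u \<rightarrow>\<^sup>* u'" "v' \<rightarrow>\<^sup>* v" using cycle_verts_reachable C(1,2) uv * by blast+
  then show uv': "u \<rightarrow>\<^sup>* v" using *(3) reachable_trans by blast
  show "\<not> v \<rightarrow>\<^sup>* u"
  proof
    assume "v \<rightarrow>\<^sup>* u"
    moreover obtain \<alpha> where "awalk u \<alpha> v" using uv' reachable_awalk by blast
    ultimately have "v \<in> verts_of_cycle G C" using return_to_cycle[OF C(1) _ uv(1)] by blast
    then have "same_cycle C D" using cycles_meet[OF C(1,2)] uv(2) by blast
    then show False using C(3) by (simp add: cycle_gt_def)
  qed
qed

lemma no_ascent:
  "u \<in> verts_of_cycle G P \<Longrightarrow> v \<in> verts_of_cycle G Q \<Longrightarrow> \<not> v \<rightarrow>\<^sup>* u"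
  "u \<in> verts_of_cycle G Q \<Longrightarrow> v \<in> verts_of_cycle G R \<Longrightarrow> \<not> v \<rightarrow>\<^sup>* u"
  "u \<in> verts_of_cycle G P \<Longrightarrow> v \<in> verts_of_cycle G R \<Longrightarrow> \<not> v \<rightarrow>\<^sup>* u"
proof -
  have gt: "cycle_gt G P Q" "cycle_gt G Q R" using meteor by (simp_all add: meteor_graph3_def)
  note PQ = descend[OF cycles(1,2) gt(1)] and QR = descend[OF cycles(2,3) gt(2)]
  show "u \<in> verts_of_cycle G P \<Longrightarrow> v \<in> verts_of_cycle G Q \<Longrightarrow> \<not> v \<rightarrow>\<^sup>* u" by (rule PQ(2))
  show "u \<in> verts_of_cycle G Q \<Longrightarrow> v \<in> verts_of_cycle G R \<Longrightarrow> \<not> v \<rightarrow>\<^sup>* u" by (rule QR(2))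
  show "\<not> v \<rightarrow>\<^sup>* u" if "u \<in> verts_of_cycle G P" "v \<in> verts_of_cycle G R"
  proof
    assume "v \<rightarrow>\<^sup>* u"
    then have "v \<rightarrow>\<^sup>* q" using PQ(1)[OF that(1) marked(2)] reachable_trans by blast
    then show False using QR(2)[OF marked(2) that(2)] by blast
  qed
qed

lemma trails_from_marked:
  "cycle_trail G P Q \<alpha> \<Longrightarrow> awalk p \<alpha> q" "cycle_trail G Q R \<alpha> \<Longrightarrow> awalk q \<alpha> r"
  "cycle_trail G P R \<alpha> \<Longrightarrow> awalk p \<alpha> r"
  using normal by (simp_all add: normal_form_def)

text \<open>
  The normal form speaks about three pairs of cycles; the other pairs have no trails, as no walk
  leads back up the chain.
\<close>

lemma cycle_trail_ends:
  assumes "cycle_trail G A B \<alpha>" and "awalk u \<alpha> v"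
  shows "u \<in> S" and "v \<in> S"
proof -
  have AB: "cycle A" "cycle B" "\<not> same_cycle A B" and "\<alpha> \<noteq> []"
    using assms(1) by (auto simp: cycle_trail_def)
  obtain u' v' where u'v': "u' \<in> verts_of_cycle G A" "v' \<in> verts_of_cycle G B" "awalk u' \<alpha> v'"
    using assms(1) by (auto simp: cycle_trail_def)
  have ends: "u \<in> S \<and> v \<in> S" if "awalk s \<alpha> t" "s \<in> S" "t \<in> S" for s t
    using awalk_ends[OF that(1) assms(2)] \<open>\<alpha> \<noteq> []\<close> that(2,3) by blast
  have reach: "u' \<rightarrow>\<^sup>* v'" using u'v'(3) reachable_awalk by blast
  obtain A' B' where A': "A' \<in> {P, Q, R}" "same_cycle A' A" and B': "B' \<in> {P, Q, R}" "same_cycle B' B"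
    using AB cycle_cases by blast
  have "cycle_trail G A' B' \<alpha>"
    using cycle_trail_same_cycle[OF wf_digraph_axioms assms(1) same_cycle_sym[OF A'(2)]
        same_cycle_sym[OF B'(2)]] A'(1) B'(1) cycles by blast
  moreover have "u' \<in> verts_of_cycle G A'" "v' \<in> verts_of_cycle G B'"
    using u'v' same_cycle_verts[OF A'(2), of G] same_cycle_verts[OF B'(2), of G] by auto
  moreover have "A' \<noteq> B'" using AB(3) A'(2) B'(2) same_cycle_sym same_cycle_trans by blast
  ultimately have "u \<in> S \<and> v \<in> S"
    using A'(1) B'(1) reach no_ascent ends trails_from_marked by blast
  then show "u \<in> S" "v \<in> S" by blast+
qed

lemma trail_between_cycle_verts:
  assumes "\<alpha> \<in> first_passages G (cycle_verts G) u v"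
    and "cycle C" "cycle D" "\<not> same_cycle C D" "u \<in> verts_of_cycle G C" "v \<in> verts_of_cycle G D"
  shows "cycle_trail G C D \<alpha>"
proof -
  have walk: "awalk u \<alpha> v" and ne: "\<alpha> \<noteq> []"
    and "head G ` set (butlast \<alpha>) \<inter> cycle_verts G = {}"
    using assms(1) by (auto simp: first_passages_def)
  then have "set (inner_verts \<alpha>) \<inter> cycle_verts G = {}"
    using walk_interior_set[OF walk] by (simp add: inner_verts_def map_tl[symmetric])
  then show ?thesis using assms walk ne unfolding cycle_trail_def by blast
qed

text \<open>
  A walk can leave a cycle only along a trail, and all trails start at marked vertices.
\<close>

lemma stuck_on_cycle:
  assumes "awalk u \<alpha> v" and "cycle C" and "u \<in> verts_of_cycle G C - S"
    and "v \<in> cycle_verts G - verts_of_cycle G C" and "head G ` set (butlast \<alpha>) \<inter> S = {}"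
  shows False
  using assms(1,3,5)
proof (induction "length \<alpha>" arbitrary: u \<alpha> rule: less_induct)
  case less
  have "\<alpha> \<noteq> []" using less.prems(1,2) assms(4) by (auto simp: awalk_Nil_iff)
  obtain \<beta> \<gamma> w where \<beta>: "\<alpha> = \<beta> @ \<gamma>" "w \<in> cycle_verts G"
    "\<beta> \<in> first_passages G (cycle_verts G) u w" "awalk w \<gamma> v"
    using walk_first_visit[OF wf_digraph_axioms less.prems(1) \<open>\<alpha> \<noteq> []\<close>, of "cycle_verts G"] assms(4)
    by blast
  have walk: "awalk u \<beta> w" and ne: "\<beta> \<noteq> []" using \<beta>(3) by (auto simp: first_passages_def)
  show ?case
  proof (cases "w \<in> verts_of_cycle G C")
    case True
    then have "\<gamma> \<noteq> []" using \<beta>(4) assms(4) by (auto simp: awalk_Nil_iff)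
    then have butlast: "butlast \<alpha> = \<beta> @ butlast \<gamma>" using \<beta>(1) by (simp add: butlast_append)
    have "w = head G (last \<beta>)" using awalk_last[OF walk ne] .
    then have "w \<notin> S" using less.prems(3) ne unfolding butlast by auto
    moreover have "length \<gamma> < length \<alpha>" using \<beta>(1) ne by simp
    ultimately show ?thesis
      using less.hyps[OF _ \<beta>(4)] True less.prems(3) unfolding butlast by auto
  next
    case False
    obtain D where D: "cycle D" "w \<in> verts_of_cycle G D"
      using \<beta>(2) unfolding cycle_verts_def by blast
    have "\<not> same_cycle C D" using False D same_cycle_verts[of C D G] by blast
    then have "cycle_trail G C D \<beta>"
      using trail_between_cycle_verts[OF \<beta>(3) assms(2) D(1)] less.prems(2) D(2) by blast
    then show ?thesis using cycle_trail_ends walk less.prems(2) by blast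
  qed
qed

text \<open>
  A first passage that met a cycle in its interior would either have entered that cycle by a trail,
  that is, at a marked vertex, or still be on the cycle where it started, at an unmarked vertex that
  it could leave only by returning to the marked one.
\<close>

lemma first_passages_trails:
  assumes C: "cycle C" "u \<in> verts_of_cycle G C" "u \<in> S" and D: "cycle D" "v \<in> verts_of_cycle G D" "v \<in> S"
    and CD: "\<not> same_cycle C D" and ends: "\<And>\<alpha>. cycle_trail G C D \<alpha> \<Longrightarrow> awalk u \<alpha> v"
  shows "first_passages G S u v = {\<alpha>. cycle_trail G C D \<alpha>}"
proof (intro equalityI subsetI CollectI)
  fix \<alpha> assume \<alpha>: "\<alpha> \<in> {\<alpha>. cycle_trail G C D \<alpha>}"
  then have walk: "awalk u \<alpha> v" using ends by blast
  have "S \<subseteq> cycle_verts G" using marked by (auto simp: cycle_verts_eq)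
  then have "head G ` set (butlast \<alpha>) \<inter> S = {}"
    using \<alpha> walk_interior_set[OF walk] by (auto simp: cycle_trail_def inner_verts_def map_tl[symmetric])
  then show "\<alpha> \<in> first_passages G S u v"
    using \<alpha> walk by (auto simp: first_passages_def cycle_trail_def)
next
  fix \<alpha> assume "\<alpha> \<in> first_passages G S u v"
  then have walk: "awalk u \<alpha> v" and ne: "\<alpha> \<noteq> []" and avoid: "head G ` set (butlast \<alpha>) \<inter> S = {}"
    by (auto simp: first_passages_def)
  have v: "v \<in> cycle_verts G" using D unfolding cycle_verts_def by blast
  have vC: "v \<notin> verts_of_cycle G C" using cycles_meet[OF C(1) D(1)] D(2) CD by blast
  obtain \<beta> \<gamma> w where \<beta>: "\<alpha> = \<beta> @ \<gamma>" "w \<in> cycle_verts G"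
    "\<beta> \<in> first_passages G (cycle_verts G) u w" "awalk w \<gamma> v"
    using walk_first_visit[OF wf_digraph_axioms walk ne v] .
  have \<beta>walk: "awalk u \<beta> w" and \<beta>ne: "\<beta> \<noteq> []" using \<beta>(3) by (auto simp: first_passages_def)
  show "cycle_trail G C D \<alpha>"
  proof (cases "\<gamma> = []")
    case True
    then have "w = v" using \<beta>(4) by (simp add: awalk_Nil_iff)
    then show ?thesis
      using trail_between_cycle_verts[OF _ C(1) D(1) CD C(2) D(2)] \<beta> True by simp
  next
    case False
    then have butlast: "butlast \<alpha> = \<beta> @ butlast \<gamma>" using \<beta>(1) by (simp add: butlast_append)
    have "w = head G (last \<beta>)" using awalk_last[OF \<beta>walk \<beta>ne] .
    then have wS: "w \<notin> S" using avoid \<beta>ne unfolding butlast by auto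
    obtain B where B: "cycle B" "w \<in> verts_of_cycle G B" using \<beta>(2) unfolding cycle_verts_def by blast
    have "same_cycle C B"
    proof (rule ccontr)
      assume "\<not> same_cycle C B"
      then have "cycle_trail G C B \<beta>"
        using trail_between_cycle_verts[OF \<beta>(3) C(1) B(1) _ C(2) B(2)] by blast
      then show False using cycle_trail_ends(2) \<beta>walk wS by blast
    qed
    then have "w \<in> verts_of_cycle G C - S" using B(2) wS same_cycle_verts[of C B G] by blast
    moreover have "head G ` set (butlast \<gamma>) \<inter> S = {}" using avoid unfolding butlast by auto
    ultimately have False using stuck_on_cycle[OF \<beta>(4) C(1)] v vC by blast
    then show ?thesis ..
  qed
qed

definition trail_poly :: "'b list \<Rightarrow> 'b list \<Rightarrow> int poly" where
  "trail_poly A B =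
    (\<Sum>n\<le>Suc (card (verts G)). monom (int (card {\<alpha>. cycle_trail G A B \<alpha> \<and> length \<alpha> = n})) n)"

lemma coeff_trail_poly:
  "coeff (trail_poly A B) n = int (card {\<alpha>. cycle_trail G A B \<alpha> \<and> length \<alpha> = n})"
proof (cases "n \<le> Suc (card (verts G))")
  case True
  then show ?thesis by (simp add: trail_poly_def coeff_sum)
next
  case False
  then have none: "{\<alpha>. cycle_trail G A B \<alpha> \<and> length \<alpha> = n} = {}" using cycle_trail_length by auto
  show ?thesis unfolding none using False by (simp add: trail_poly_def coeff_sum)
qed

lemma trail_gf:
  assumes "first_passages G S u v = {\<alpha>. cycle_trail G A B \<alpha>}"
  shows "passage_gf G S u v = fps_of_poly (trail_poly A B)"
  by (rule fps_ext) (simp add: passage_gf_def assms walk_gf_nth coeff_trail_poly)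

lemma cycle_gf:
  assumes "cycle C" and "S \<inter> verts_of_cycle G C = {s}"
  shows "passage_gf G S s s = fps_X ^ length C"
proof -
  obtain D where D: "first_passages G S s s = {D}" "length D = length C"
    using first_passages_cycle[OF assms] .
  have "{\<alpha> \<in> {D}. length \<alpha> = n} = (if length C = n then {D} else {})" for n using D(2) by auto
  then show ?thesis
    by (intro fps_ext) (simp add: passage_gf_def D(1) walk_gf_nth)
qed

lemma skeleton:
  "meteor_skeleton G p q r (length P) (length Q) (length R)
     (trail_poly P Q) (trail_poly Q R) (trail_poly P R)"
proof -
  have SP: "S \<inter> verts_of_cycle G P = {p}" and SQ: "S \<inter> verts_of_cycle G Q = {q}"
    and SR: "S \<inter> verts_of_cycle G R = {r}"
    using marked cycles_disjoint by blast+
  have "distinct [p, q, r]" using marked cycles_disjoint by auto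
  moreover have "S \<subseteq> verts G" using marked cycle_vert_in_verts cycles by blast
  moreover have none: "passage_gf G S u v = 0" if "\<not> u \<rightarrow>\<^sup>* v" for u v
    using that reachable_awalk unfolding passage_gf_eq_0_iff[OF finite_arcs] first_passages_def
    by blast
  ultimately show ?thesis
    unfolding meteor_skeleton_def Let_def
    using fin_digraph_axioms cycle_gf[OF cycles(1) SP] cycle_gf[OF cycles(2) SQ]
      cycle_gf[OF cycles(3) SR] none[OF no_ascent(1)[OF marked(1,2)]]
      none[OF no_ascent(2)[OF marked(2,3)]] none[OF no_ascent(3)[OF marked(1,3)]]
      trail_gf[OF first_passages_trails[OF cycles(1) marked(1) _ cycles(2) marked(2) _
        distinct_cycles(1) trails_from_marked(1)]]
      trail_gf[OF first_passages_trails[OF cycles(2) marked(2) _ cycles(3) marked(3) _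
        distinct_cycles(2) trails_from_marked(2)]]
      trail_gf[OF first_passages_trails[OF cycles(1) marked(1) _ cycles(3) marked(3) _
        distinct_cycles(3) trails_from_marked(3)]]
    by simp
qed

end

section \<open>From the trail relation to the equivalence of meteor graphs\<close>

text \<open>
  The representative in \<open>{1..d}\<close>, the range over which the counts are indexed.
\<close>

definition class_rep :: "nat \<Rightarrow> int \<Rightarrow> nat" where
  "class_rep d k = nat ((k - 1) mod int d) + 1"

lemma class_rep_range: "0 < d \<Longrightarrow> class_rep d k \<in> {1..d}"
  by (simp add: class_rep_def Suc_le_eq nat_less_iff)

lemma class_rep_cong: "0 < d \<Longrightarrow> [int (class_rep d k) = k] (mod int d)"
  by (simp add: class_rep_def cong_def mod_simps)

lemma class_rep_eq_iff:
  assumes "a \<in> {1..d}"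
  shows "class_rep d k = a \<longleftrightarrow> [k = int a] (mod int d)"
proof
  assume "class_rep d k = a"
  then show "[k = int a] (mod int d)" using class_rep_cong[of d k] assms cong_sym by auto
next
  assume "[k = int a] (mod int d)"
  then have "(k - 1) mod int d = (int a - 1) mod int d"
    by (metis cong_def mod_diff_left_eq)
  also have "\<dots> = int a - 1" using assms by (intro mod_pos_pos_trivial) auto
  finally show "class_rep d k = a" using assms by (simp add: class_rep_def nat_diff_distrib)
qed

lemma class_sum_refine:
  assumes "d dvd g" and "0 < g"
  shows "class_sum d f a = (\<Sum>k | k \<in> {1..g} \<and> [int k = a] (mod int d). class_sum g f (int k))"
proof -
  let ?I = "{i. i \<le> degree f \<and> [int i = a] (mod int d)}"
  let ?K = "{k. k \<in> {1..g} \<and> [int k = a] (mod int d)}"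
  let ?r = "\<lambda>i. class_rep g (int i)"
  have dg: "[int (?r i) = int i] (mod int d)" for i
    using cong_dvd_modulus[OF class_rep_cong[OF assms(2)], of "int d"] assms(1) by simp
  have "?r ` ?I \<subseteq> ?K"
    using class_rep_range[OF assms(2)] cong_trans[OF dg] by (auto simp del: atLeastAtMost_iff)
  then have "class_sum d f a = (\<Sum>k\<in>?K. \<Sum>i | i \<in> ?I \<and> ?r i = k. coeff f i)"
    unfolding class_sum_def by (intro sum.group[symmetric]) auto
  also have "\<dots> = (\<Sum>k\<in>?K. class_sum g f (int k))"
  proof (rule sum.cong[OF HOL.refl])
    fix k assume k: "k \<in> ?K"
    have "i \<in> ?I \<and> ?r i = k \<longleftrightarrow> i \<le> degree f \<and> [int i = int k] (mod int g)" for i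
    proof -
      have "[int i = a] (mod int d)" if "[int i = int k] (mod int g)"
        using cong_dvd_modulus[OF that, of "int d"] assms(1) k cong_trans by auto
      then show ?thesis using class_rep_eq_iff[of k g "int i"] k by auto
    qed
    then show "(\<Sum>i | i \<in> ?I \<and> ?r i = k. coeff f i) = class_sum g f (int k)"
      by (simp add: class_sum_def)
  qed
  finally show ?thesis .
qed

lemma class_sum_eq_coarser:
  assumes "d dvd g" and "0 < g" and "\<And>k. class_sum g f k = class_sum g f' k"
  shows "class_sum d f a = class_sum d f' a"
  unfolding class_sum_refine[OF assms(1,2)] using assms(3) by simp

text \<open>
  A polynomial whose exponents are all congruent modulo \<open>n\<close> to numbers below the divisor \<open>g\<close> of
  \<open>n\<close> is determined up to multiples of \<open>1 - t^n\<close> by its residue class sums modulo \<open>g\<close>.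
\<close>

lemma class_sum_concentrated:
  assumes g: "0 < g" "g dvd n" and "0 < n"
    and conc: "\<And>i. coeff f i \<noteq> 0 \<Longrightarrow> [i = i mod g] (mod n)"
  shows "class_sum n f k = (if k mod int n < int g then class_sum g f k else 0)"
proof -
  have mod: "int i mod int n = int (i mod g)" if "coeff f i \<noteq> 0" for i
  proof -
    have "i mod n = i mod g mod n" using conc[OF that] by (simp add: cong_def)
    also have "\<dots> = i mod g"
      using g assms(3) by (meson dvd_imp_le less_le_trans mod_less mod_less_divisor)
    finally show ?thesis by (metis of_nat_mod)
  qed
  have iff: "[int i = k] (mod int n) \<longleftrightarrow> k mod int n < int g \<and> [int i = k] (mod int g)"
    if "coeff f i \<noteq> 0" for i
  proof
    assume *: "[int i = k] (mod int n)"
    then have "k mod int n = int (i mod g)" using mod[OF that] by (simp add: cong_def)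
    then show "k mod int n < int g \<and> [int i = k] (mod int g)"
      using g(1) cong_dvd_modulus[OF *, of "int g"] g(2) by simp
  next
    assume *: "k mod int n < int g \<and> [int i = k] (mod int g)"
    have "int (i mod g) = k mod int g" using * by (simp add: cong_def of_nat_mod)
    also have "\<dots> = k mod int n mod int g" using g(2) by (simp add: mod_mod_cancel)
    also have "\<dots> = k mod int n" using * assms(3) by (intro mod_pos_pos_trivial) auto
    finally show "[int i = k] (mod int n)" using mod[OF that] by (simp add: cong_def)
  qed
  show ?thesis
  proof (cases "k mod int n < int g")
    case True
    have "class_sum n f k = (\<Sum>i\<le>degree f. if [int i = k] (mod int n) then coeff f i else 0)"
      by (simp add: class_sum_bound)
    also have "\<dots> = (\<Sum>i\<le>degree f. if [int i = k] (mod int g) then coeff f i else 0)"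
      using iff True by (intro sum.cong) (auto split: if_splits)
    finally show ?thesis using True by (simp add: class_sum_bound[where N = "degree f"])
  next
    case False
    have "class_sum n f k = (\<Sum>i\<le>degree f. if [int i = k] (mod int n) then coeff f i else 0)"
      by (simp add: class_sum_bound)
    also have "\<dots> = 0" using iff False by (intro sum.neutral) auto
    finally show ?thesis using False by simp
  qed
qed

lemma periodic_multiple:
  fixes U :: "int \<Rightarrow> 'c"
  assumes "\<And>k. U (k - a) = U k"
  shows "U (k + n * a) = U k"
proof (induction n rule: int_induct[where k = 0])
  case (step1 i)
  then show ?case using assms[of "k + (i + 1) * a"] by (simp add: algebra_simps)
next
  case (step2 i)
  then show ?case using assms[of "k + i * a"] by (simp add: algebra_simps)
qed simp

lemma periodic_gcd:
  fixes U :: "int \<Rightarrow> 'c"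
  assumes "\<And>k. U (k - a) = U k" and "\<And>k. U (k - b) = U k" and "[k = l] (mod gcd a b)"
  shows "U k = U l"
proof -
  obtain s t where st: "s * a + t * b = gcd a b" using bezout_int by blast
  obtain m where "k = l + gcd a b * m" using assms(3) by (metis cong_iff_lin cong_sym)
  then have "k = l + m * s * a + m * t * b" unfolding st[symmetric] by (simp add: algebra_simps)
  then show ?thesis using periodic_multiple[of U, OF assms(1)] periodic_multiple[of U, OF assms(2)] by simp
qed

lemma sum_periodic:
  fixes U :: "int \<Rightarrow> int"
  assumes "\<And>k. U (k - int L) = U k"
  shows "(\<Sum>k=1..m * L. U (int k)) = int m * (\<Sum>k=1..L. U (int k))"
proof (induction m)
  case (Suc m)
  have "(\<Sum>k=1..Suc m * L. U (int k)) = (\<Sum>k=1..m * L + L. U (int k))" by (simp add: add.commute)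
  also have "\<dots> = (\<Sum>k=1..m * L. U (int k)) + (\<Sum>k=m * L + 1..m * L + L. U (int k))"
    by (rule sum.ub_add_nat) simp
  also have "(\<Sum>k=m * L + 1..m * L + L. U (int k)) = (\<Sum>k=1..L. U (int (k + m * L)))"
    using sum.shift_bounds_cl_nat_ivl[of "\<lambda>k. U (int k)" 1 "m * L" L] by (simp add: add.commute)
  also have "\<dots> = (\<Sum>k=1..L. U (int k))"
    using periodic_multiple[of U "int L", OF assms] by simp
  finally show ?case using Suc by (simp add: algebra_simps)
qed simp

text \<open>
  The class sum modulo \<open>gcd x z\<close> is a sum over \<open>k\<close> in \<open>{1..x}\<close> of terms that are periodic in \<open>k\<close>
  with period \<open>L = lcm (gcd x y) (gcd x z)\<close>, so it is a multiple of \<open>x / L\<close>. Multiplied by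
  \<open>y gcd x z / \<delta>\<close> this number becomes \<open>lcm x y\<close>.
\<close>

lemma periodic_class_sum_divisible:
  assumes "0 < x" and per: "\<And>k. class_sum x u (k - int y) = class_sum x u k"
  shows "int (lcm x y) dvd int (y * (gcd x z div gcd x (gcd y z))) * class_sum (gcd x z) u a"
proof -
  let ?g = "gcd x y" and ?G = "gcd x z" and ?d = "gcd x (gcd y z)"
  let ?L = "lcm ?g ?G"
  have "?L dvd x" by simp
  then obtain m where m: "x = m * ?L" by (metis dvd_def mult.commute)
  have per_x: "class_sum x u (k - int x) = class_sum x u k" for k
    by (rule class_sum_cong) (simp add: cong_iff_dvd_diff)
  have per_g: "class_sum x u k = class_sum x u l" if "[k = l] (mod int ?g)" for k l
    using periodic_gcd[of "class_sum x u" "int x" "int y" k l] per_x per that by simp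
  define V where "V k = (if [k = a] (mod int ?G) then class_sum x u k else 0)" for k
  have "V (k - int ?L) = V k" for k
  proof -
    have "[k - int ?L = k] (mod int ?G)" "[k - int ?L = k] (mod int ?g)"
      by (simp_all add: cong_iff_dvd_diff)
    then show ?thesis
      unfolding V_def using per_g[of "k - int ?L" k] by (metis cong_sym cong_trans)
  qed
  then have V: "(\<Sum>k=1..x. V (int k)) = int m * (\<Sum>k=1..?L. V (int k))"
    using sum_periodic[of V ?L m] m by simp
  have "class_sum ?G u a = (\<Sum>k | k \<in> {1..x} \<and> [int k = a] (mod int ?G). class_sum x u (int k))"
    by (rule class_sum_refine) (use assms(1) in auto)
  also have "\<dots> = (\<Sum>k=1..x. V (int k))"
    unfolding V_def by (rule sum.inter_filter) simp
  finally have u: "class_sum ?G u a = int m * (\<Sum>k=1..?L. V (int k))" using V by simp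
  have "gcd ?g ?G = ?d" by (metis gcd.assoc gcd.left_commute gcd.left_idem)
  then have "?L * ?d = ?g * ?G" by (metis mult.commute prod_gcd_lcm_nat)
  moreover obtain e where e: "?G = ?d * e"
    by (metis dvdE gcd.left_commute gcd_dvd2)
  moreover have d0: "0 < ?d" "0 < ?g" using assms(1) by auto
  ultimately have "?L = ?g * e" by auto
  then have "x = ?g * (m * e)" using m by (metis mult.assoc mult.commute)
  then have "lcm x y * ?g = y * e * m * ?g" by (metis mult.assoc mult.commute prod_gcd_lcm_nat)
  then have "lcm x y = y * e * m" using d0(2) by (metis less_irrefl mult_right_cancel)
  moreover have "?G div ?d = e" using e d0 by (metis nonzero_mult_div_cancel_left less_numeral_extra(3))
  ultimately have "int (y * (?G div ?d)) * class_sum ?G u a = int (lcm x y) * (\<Sum>k=1..?L. V (int k))"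
    unfolding u by simp
  then show ?thesis by simp
qed

text \<open>
  A factor with period \<open>d\<close> sees of the other factor only its class sums modulo \<open>d\<close>.
\<close>

lemma class_sum_mult_periodic:
  assumes "0 < d" and per: "\<And>k l. [k = l] (mod int d) \<Longrightarrow> class_sum n u k = class_sum n u l"
  shows "class_sum n (f * u) k = (\<Sum>b=1..d. class_sum d f (int b) * class_sum n u (k - int b))"
proof -
  let ?r = "\<lambda>i. class_rep d (int i)"
  have r: "?r ` {..degree f} \<subseteq> {1..d}" using class_rep_range[OF assms(1)] by blast
  have "class_sum n (f * u) k = (\<Sum>i\<le>degree f. coeff f i * class_sum n u (k - int i))"
    by (rule class_sum_mult)
  also have "\<dots> = (\<Sum>b=1..d. \<Sum>i | i \<in> {..degree f} \<and> ?r i = b. coeff f i * class_sum n u (k - int i))"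
    by (rule sum.group[symmetric]) (use r in auto)
  also have "\<dots> = (\<Sum>b=1..d. class_sum d f (int b) * class_sum n u (k - int b))"
  proof (rule sum.cong[OF HOL.refl])
    fix b assume b: "b \<in> {1..d}"
    have "(\<Sum>i | i \<in> {..degree f} \<and> ?r i = b. coeff f i * class_sum n u (k - int i)) =
        (\<Sum>i | i \<le> degree f \<and> [int i = int b] (mod int d). coeff f i * class_sum n u (k - int b))"
    proof (rule sum.cong)
      show "{i. i \<in> {..degree f} \<and> ?r i = b} = {i. i \<le> degree f \<and> [int i = int b] (mod int d)}"
        using class_rep_eq_iff[OF b] by auto
      fix i assume "i \<in> {i. i \<le> degree f \<and> [int i = int b] (mod int d)}"
      then have "[k - int i = k - int b] (mod int d)" by (auto intro: cong_diff)
      then show "coeff f i * class_sum n u (k - int i) = coeff f i * class_sum n u (k - int b)"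
        using per by metis
    qed
    then show "(\<Sum>i | i \<in> {..degree f} \<and> ?r i = b. coeff f i * class_sum n u (k - int i)) =
        class_sum d f (int b) * class_sum n u (k - int b)"
      by (simp add: class_sum_def sum_distrib_right)
  qed
  finally show ?thesis .
qed

lemma sum_pairs_periodic:
  fixes U c :: "int \<Rightarrow> int"
  assumes "0 < d" and per: "\<And>k l. [k = l] (mod int d) \<Longrightarrow> U k = U l"
  shows "(\<Sum>(a, b) \<in> {(a, b). a \<in> {1..d} \<and> b \<in> {1..d} \<and> [a + b = h] (mod d)}. c (int a) * U (int b)) =
      (\<Sum>a=1..d. c (int a) * U (int h - int a))" (is "?l1 = ?r")
    and "(\<Sum>(a, b) \<in> {(a, b). a \<in> {1..d} \<and> b \<in> {1..d} \<and> [a + b = h] (mod d)}. U (int a) * c (int b)) =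
      (\<Sum>a=1..d. c (int a) * U (int h - int a))" (is "?l2 = ?r")
proof -
  let ?r = "\<lambda>a. class_rep d (int h - int a)"
  have rep: "[a + b = h] (mod d) \<longleftrightarrow> b = ?r a" if "b \<in> {1..d}" for a b
  proof -
    have "[a + b = h] (mod d) \<longleftrightarrow> [int h - int a = int b] (mod int d)"
      by (simp add: cong_int_iff[symmetric] cong_iff_dvd_diff)
        (metis diff_diff_eq dvd_minus_iff minus_diff_eq)
    then show ?thesis using class_rep_eq_iff[OF that] by metis
  qed
  have U: "U (int (?r a)) = U (int h - int a)" for a
    by (rule per[OF class_rep_cong[OF assms(1)]])
  have set1: "{(a, b). a \<in> {1..d} \<and> b \<in> {1..d} \<and> [a + b = h] (mod d)} = (\<lambda>a. (a, ?r a)) ` {1..d}"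
    using rep class_rep_range[OF assms(1)] by (auto simp del: atLeastAtMost_iff)
  show "?l1 = (\<Sum>a=1..d. c (int a) * U (int h - int a))"
    unfolding set1 by (subst sum.reindex) (auto simp: inj_on_def U)
  have set2: "{(a, b). a \<in> {1..d} \<and> b \<in> {1..d} \<and> [a + b = h] (mod d)} = (\<lambda>a. (?r a, a)) ` {1..d}"
    using rep class_rep_range[OF assms(1)] by (auto simp: add.commute simp del: atLeastAtMost_iff)
  show "?l2 = (\<Sum>a=1..d. c (int a) * U (int h - int a))"
    unfolding set2 by (subst sum.reindex) (auto simp: inj_on_def U mult.commute)
qed

text \<open>
  The hypotheses on the class sums of \<open>f'\<close> and \<open>g'\<close> make those of \<open>u\<close> modulo \<open>x\<close> and of \<open>v\<close> modulo
  \<open>z\<close> periodic with period \<open>y\<close>. Hence modulo \<open>gcd x z\<close> both have period \<open>d\<close>, and the products \<open>u g\<close> and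
  \<open>f' v\<close> depend only on class sums modulo \<open>d\<close>.
\<close>

lemma trail_relation_counts:
  assumes rel: "trail_relation x y z f g h f' g' h'" and pos: "0 < x" "0 < y" "0 < z"
    and f: "\<And>k. class_sum x f' k = class_sum x f k" and g: "\<And>k. class_sum z g' k = class_sum z g k"
  defines "d \<equiv> gcd x (gcd y z)"
  shows "\<exists>gs ls :: nat \<Rightarrow> int.
    (\<forall>a\<in>{1..d}. int (lcm x y) dvd ls a \<and> int (lcm y z) dvd gs a) \<and>
    (\<forall>a\<in>{1..d}. class_sum d f (int a) = 0 \<longrightarrow> ls a = 0) \<and>
    (\<forall>b\<in>{1..d}. class_sum d g (int b) = 0 \<longrightarrow> gs b = 0) \<and>
    (\<forall>k. rat_of_int (class_sum (gcd x z) h' (int k) - class_sum (gcd x z) h (int k)) =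
       rat_of_nat d / rat_of_nat (y * gcd x z) * rat_of_int
       ((\<Sum>(a, b) \<in> {(a, b). a \<in> {1..d} \<and> b \<in> {1..d} \<and> [a + b = k] (mod d)}.
          class_sum d f (int a) * gs b) +
        (\<Sum>(a, b) \<in> {(a, b). a \<in> {1..d} \<and> b \<in> {1..d} \<and> [a + b = k] (mod d)}.
          ls a * class_sum d g (int b))))"
proof -
  let ?G = "gcd x z"
  obtain u v where fu: "1 - monom 1 x dvd f' - f - u * (1 - monom 1 y)"
    and gv: "1 - monom 1 z dvd g' - g - v * (1 - monom 1 y)"
    and huv: "1 - monom 1 ?G dvd h' - h + u * g + f' * v"
    and supp: "\<And>n. coeff u n \<noteq> 0 \<Longrightarrow> class_sum d f (int n) \<noteq> 0"
      "\<And>n. coeff v n \<noteq> 0 \<Longrightarrow> class_sum d g (int n) \<noteq> 0"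
    using rel unfolding trail_relation_def d_def by blast
  have d: "0 < d" "d dvd ?G" "gcd ?G y = d"
    using pos unfolding d_def by (auto simp: gcd.commute gcd.left_commute gcd.assoc intro: gcd_dvd1 gcd_dvd2 dvd_trans)
  have per: "class_sum e w (k - int y) = class_sum e w k"
    if "1 - monom 1 n dvd F' - F - w * (1 - monom 1 y)" "e dvd n"
      "\<And>k. class_sum e F' k = class_sum e F k" for e n F F' w k
    using class_sum_eq_0_of_dvd[OF that(2,1), of k] that(3)[of k]
      class_sum_one_minus_monom[of e y w k] by (simp add: class_sum_diff mult.commute)
  have fG: "class_sum ?G f' k = class_sum ?G f k" for k
    by (rule class_sum_eq_coarser[OF _ pos(1) f]) simp
  have gG: "class_sum ?G g' k = class_sum ?G g k" for k
    by (rule class_sum_eq_coarser[OF _ pos(3) g]) simp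
  have per_d: "class_sum ?G w k = class_sum ?G w l"
    if "\<And>k. class_sum ?G w (k - int y) = class_sum ?G w k" "[k = l] (mod int d)" for w k l
  proof (rule periodic_gcd[of "class_sum ?G w" "int ?G" "int y"])
    show "class_sum ?G w (k - int ?G) = class_sum ?G w k" for k
      by (rule class_sum_cong) (simp add: cong_iff_dvd_diff)
    show "[k = l] (mod gcd (int ?G) (int y))" using that(2) d(3) by simp
  qed (rule that(1))
  have u_d: "class_sum ?G u k = class_sum ?G u l" if "[k = l] (mod int d)" for k l
    by (rule per_d[OF per[OF fu _ fG] that]) simp
  have v_d: "class_sum ?G v k = class_sum ?G v l" if "[k = l] (mod int d)" for k l
    by (rule per_d[OF per[OF gv _ gG] that]) simp
  define N where "N = int (y * (?G div d))"
  define ls gs where "ls a = - N * class_sum ?G u (int a)" and "gs a = - N * class_sum ?G v (int a)" for a :: nat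
  have "int (lcm x y) dvd ls a" for a
    using periodic_class_sum_divisible[OF pos(1) per[OF fu _ f], of z "int a"]
    unfolding ls_def N_def d_def by simp
  moreover have "int (lcm y z) dvd gs a" for a
    using periodic_class_sum_divisible[OF pos(3) per[OF gv _ g], of x "int a"]
    unfolding gs_def N_def d_def by (simp add: lcm.commute gcd.commute gcd.left_commute)
  moreover have vanish: "class_sum ?G w (int a) = 0"
    if "\<And>n. coeff w n \<noteq> 0 \<Longrightarrow> class_sum d F (int n) \<noteq> 0" "class_sum d F (int a) = 0" for w F a
  proof -
    have "coeff w n = 0" if n: "[int n = int a] (mod int ?G)" for n
    proof -
      have "[int n = int a] (mod int d)" using cong_dvd_modulus[OF n, of "int d"] d(2) by simp
      then show ?thesis using that class_sum_cong \<open>class_sum d F (int a) = 0\<close>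
        \<open>\<And>n. coeff w n \<noteq> 0 \<Longrightarrow> class_sum d F (int n) \<noteq> 0\<close> by metis
    qed
    then show ?thesis by (simp add: class_sum_def)
  qed
  then have "class_sum d f (int a) = 0 \<Longrightarrow> ls a = 0" "class_sum d g (int a) = 0 \<Longrightarrow> gs a = 0" for a
    using supp unfolding ls_def gs_def by auto
  moreover have "rat_of_int (class_sum ?G h' (int k) - class_sum ?G h (int k)) =
       rat_of_nat d / rat_of_nat (y * ?G) * rat_of_int
       ((\<Sum>(a, b) \<in> {(a, b). a \<in> {1..d} \<and> b \<in> {1..d} \<and> [a + b = k] (mod d)}.
          class_sum d f (int a) * gs b) +
        (\<Sum>(a, b) \<in> {(a, b). a \<in> {1..d} \<and> b \<in> {1..d} \<and> [a + b = k] (mod d)}.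
          ls a * class_sum d g (int b)))" (is "_ = ?q * rat_of_int (?s1 + ?s2)") for k
  proof -
    define A where "A = (\<Sum>a=1..d. class_sum d f (int a) * class_sum ?G v (int k - int a))"
    define B where "B = (\<Sum>a=1..d. class_sum d g (int a) * class_sum ?G u (int k - int a))"
    have "class_sum ?G (h' - h + u * g + f' * v) (int k) = 0"
      by (rule class_sum_eq_0_of_dvd[OF _ huv]) simp
    moreover have "class_sum ?G (g * u) (int k) = B"
      unfolding B_def by (rule class_sum_mult_periodic[OF d(1) u_d])
    moreover have "class_sum ?G (f' * v) (int k) = A"
      unfolding A_def
      using class_sum_mult_periodic[OF d(1) v_d, of f' "int k"] trail_relation_class_sum(1)[OF rel]
      by (simp add: d_def)
    ultimately have diff: "class_sum ?G h' (int k) - class_sum ?G h (int k) = - (A + B)"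
      by (simp add: class_sum_add class_sum_diff mult.commute)
    have "?s1 = (\<Sum>a=1..d. class_sum d f (int a) * (- N * class_sum ?G v (int k - int a)))"
      using sum_pairs_periodic(1)[OF d(1), of "\<lambda>k. - N * class_sum ?G v k" "class_sum d f" k] v_d
      unfolding gs_def by metis
    then have s1: "?s1 = - N * A" unfolding A_def sum_distrib_left by (simp add: algebra_simps)
    have "?s2 = (\<Sum>a=1..d. class_sum d g (int a) * (- N * class_sum ?G u (int k - int a)))"
      using sum_pairs_periodic(2)[OF d(1), of "\<lambda>k. - N * class_sum ?G u k" "class_sum d g" k] u_d
      unfolding ls_def by metis
    then have s2: "?s2 = - N * B" unfolding B_def sum_distrib_left by (simp add: algebra_simps)
    obtain e where e: "?G = d * e" using d(2) by (elim dvdE)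
    then have "N = int (y * e)" "0 < e" using d(1) pos unfolding N_def by (auto intro: Nat.gr0I)
    then have qN: "?q * rat_of_int N = 1" using e d(1) pos by (simp add: field_simps)
    have "w * rat_of_int (- N * A + - N * B) = - (w * rat_of_int N * rat_of_int (A + B))" for w
      by (simp add: algebra_simps)
    then show ?thesis unfolding diff s1 s2 by (simp only: qN mult_1_left of_int_minus)
  qed
  ultimately show ?thesis by (intro exI[of _ gs] exI[of _ ls]) blast
qed

lemma (in normal_meteor) class_sum_trail_poly:
  "class_sum d (trail_poly A B) (int k) =
    int (card {\<alpha>. cycle_trail G A B \<alpha> \<and> [length \<alpha> = k] (mod d)})"
proof -
  define N where "N = Suc (card (verts G))"
  let ?T = "\<lambda>n. {\<alpha>. cycle_trail G A B \<alpha> \<and> length \<alpha> = n}"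
  have fin: "finite (?T n)" for n
    by (rule finite_subset[OF _ finite_lists_length_eq[OF finite_arcs, of n]])
      (auto simp: cycle_trail_def awalk_def)
  have "degree (trail_poly A B) \<le> N"
  proof (rule degree_le, intro allI impI)
    fix n assume "N < n"
    then have none: "?T n = {}" using cycle_trail_length unfolding N_def by fastforce
    show "coeff (trail_poly A B) n = 0" unfolding coeff_trail_poly none by simp
  qed
  then have "class_sum d (trail_poly A B) (int k) =
      (\<Sum>n\<le>N. if [int n = int k] (mod int d) then int (card (?T n)) else 0)"
    unfolding coeff_trail_poly[symmetric] by (rule class_sum_bound)
  also have "\<dots> = (\<Sum>n | n \<le> N \<and> [n = k] (mod d). int (card (?T n)))"
    by (simp add: sum.If_cases Int_def cong_int_iff)
  also have "\<dots> = int (card (\<Union>n\<in>{n. n \<le> N \<and> [n = k] (mod d)}. ?T n))"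
    by (subst card_UN_disjoint) (use fin in auto)
  also have "(\<Union>n\<in>{n. n \<le> N \<and> [n = k] (mod d)}. ?T n) =
      {\<alpha>. cycle_trail G A B \<alpha> \<and> [length \<alpha> = k] (mod d)}"
    using cycle_trail_length by (auto simp: N_def)
  finally show ?thesis .
qed

lemma (in normal_meteor) trail_count_class_sum:
  "int (trail_count G A B c) = class_sum (gcd (length A) (length B)) (trail_poly A B) (int c)"
  by (simp add: trail_count_def class_sum_trail_poly)

lemma (in normal_meteor) trail_sum_class_sum:
  assumes "d dvd gcd (length A) (length B)" and "0 < gcd (length A) (length B)"
  shows "int (trail_sum G A B d a) = class_sum d (trail_poly A B) (int a)"
  unfolding class_sum_refine[OF assms] trail_sum_def
  by (simp add: trail_count_class_sum cong_int_iff)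

lemma (in normal_meteor) trail_poly_concentrated:
  assumes "coeff (trail_poly A B) n \<noteq> 0" and "0 < gcd (length A) (length B)"
  shows "[n = n mod gcd (length A) (length B)] (mod length A)"
    and "[n = n mod gcd (length A) (length B)] (mod length B)"
proof -
  let ?g = "gcd (length A) (length B)"
  have "{\<alpha>. cycle_trail G A B \<alpha> \<and> length \<alpha> = n} \<noteq> {}"
    using assms(1) unfolding coeff_trail_poly by (metis card.empty of_nat_0)
  then obtain \<alpha> where \<alpha>: "cycle_trail G A B \<alpha>" "length \<alpha> = n" by blast
  have "[length \<alpha> = n mod ?g] (mod length A * length B)"
  proof -
    have "\<forall>A B \<alpha> t. cycle_trail G A B \<alpha> \<and> t < gcd (length A) (length B) \<and>
        [length \<alpha> = t] (mod gcd (length A) (length B)) \<longrightarrow> [length \<alpha> = t] (mod length A * length B)"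
      using normal unfolding normal_form_def by (elim conjE)
    moreover have "n mod ?g < ?g" using assms(2) by simp
    moreover have "[length \<alpha> = n mod ?g] (mod ?g)" using \<alpha>(2) by (simp add: cong_def)
    ultimately show ?thesis using \<alpha>(1) by blast
  qed
  then show "[n = n mod ?g] (mod length A)" "[n = n mod ?g] (mod length B)"
    using \<alpha>(2) cong_dvd_modulus_nat by auto
qed

theorem proposition4p10:
  fixes E F :: "('a, 'b) pre_digraph"
    and P Q R P' Q' R' :: "'b list"
    and p q r p' q' r' :: 'a
    and \<rho> :: "('a \<times> 'a) set"
  assumes "meteor_graph3 E P Q R" and "normal_form E P Q R p q r"
    and "meteor_graph3 F P' Q' R'" and "normal_form F P' Q' R' p' q' r'"
    and "moves E F \<rho>"
    and "(p, p') \<in> \<rho>" and "(q, q') \<in> \<rho>" and "(r, r') \<in> \<rho>"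
  shows "meteor_equiv E P Q R F P' Q' R'"
proof -
  interpret E: normal_meteor E P Q R p q r by unfold_locales fact+
  interpret F: normal_meteor F P' Q' R' p' q' r' by unfold_locales fact+
  let ?x = "length P" and ?y = "length Q" and ?z = "length R"
  let ?d = "gcd ?x (gcd ?y ?z)"
  let ?f = "E.trail_poly P Q" and ?g = "E.trail_poly Q R" and ?h = "E.trail_poly P R"
  let ?f' = "F.trail_poly P' Q'" and ?g' = "F.trail_poly Q' R'" and ?h' = "F.trail_poly P' R'"
  obtain f' g' h' where sk: "meteor_skeleton F p' q' r' ?x ?y ?z f' g' h'"
    and "trail_relation ?x ?y ?z ?f ?g ?h f' g' h'"
    using moves_skeleton[OF assms(5) E.skeleton assms(6-8)] by blast
  moreover have X: "(fps_X :: int fps) ^ m = fps_X ^ n \<longleftrightarrow> m = n" for m n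
    by (metis fps_X_power_nth zero_neq_one)
  have eq: "length P' = ?x" "length Q' = ?y" "length R' = ?z" "f' = ?f'" "g' = ?g'" "h' = ?h'"
    using sk F.skeleton unfolding meteor_skeleton_def Let_def
    by (auto simp: X fps_of_poly_eq_iff)
  ultimately have rel: "trail_relation ?x ?y ?z ?f ?g ?h ?f' ?g' ?h'" by simp
  have pos: "0 < ?x" "0 < ?y" "0 < ?z" using E.cycles by (auto simp: E.cycle_iff)
  then have pos_gcd: "0 < gcd ?x ?y" "0 < gcd ?y ?z" "0 < gcd ?x ?z" by auto
  have f_gcd: "class_sum (gcd ?x ?y) ?f' k = class_sum (gcd ?x ?y) ?f k" for k
  proof -
    obtain u where u: "1 - monom 1 ?x dvd ?f' - ?f - u * (1 - monom 1 ?y)"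
      using rel unfolding trail_relation_def by blast
    show ?thesis
      using class_sum_eq_0_of_dvd[OF _ u, of "gcd ?x ?y" k]
        class_sum_eq_0_of_dvd[of "gcd ?x ?y" ?y "u * (1 - monom 1 ?y)" k]
      by (simp add: class_sum_diff)
  qed
  have g_gcd: "class_sum (gcd ?y ?z) ?g' k = class_sum (gcd ?y ?z) ?g k" for k
  proof -
    obtain v where v: "1 - monom 1 ?z dvd ?g' - ?g - v * (1 - monom 1 ?y)"
      using rel unfolding trail_relation_def by blast
    show ?thesis
      using class_sum_eq_0_of_dvd[OF _ v, of "gcd ?y ?z" k]
        class_sum_eq_0_of_dvd[of "gcd ?y ?z" ?y "v * (1 - monom 1 ?y)" k]
      by (simp add: class_sum_diff)
  qed
  have f_x: "class_sum ?x ?f' k = class_sum ?x ?f k" for k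
    using class_sum_concentrated[OF pos_gcd(1) _ pos(1) E.trail_poly_concentrated(1)[OF _ pos_gcd(1)], where k = k]
      class_sum_concentrated[OF pos_gcd(1) _ pos(1), where f = ?f' and k = k] F.trail_poly_concentrated(1)[of P' Q']
      pos_gcd f_gcd by (simp add: eq)
  have g_z: "class_sum ?z ?g' k = class_sum ?z ?g k" for k
    using class_sum_concentrated[OF pos_gcd(2) _ pos(3) E.trail_poly_concentrated(2)[OF _ pos_gcd(2)], where k = k]
      class_sum_concentrated[OF pos_gcd(2) _ pos(3), where f = ?g' and k = k] F.trail_poly_concentrated(2)[of Q' R']
      pos_gcd g_gcd by (simp add: eq)
  have d_dvd: "?d dvd gcd ?x ?y" "?d dvd gcd ?y ?z"
    by (metis gcd.assoc gcd_dvd1) (rule gcd_dvd2)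
  have S1: "int (trail_sum E P Q ?d a) = class_sum ?d ?f (int a)" for a
    by (rule E.trail_sum_class_sum[OF d_dvd(1) pos_gcd(1)])
  have S2: "int (trail_sum E Q R ?d a) = class_sum ?d ?g (int a)" for a
    by (rule E.trail_sum_class_sum[OF d_dvd(2) pos_gcd(2)])
  have "int (trail_count E P Q c) = int (trail_count F P' Q' c)" for c
    unfolding E.trail_count_class_sum F.trail_count_class_sum eq by (simp add: f_gcd)
  then have N1: "\<forall>c\<in>{1..gcd ?x ?y}. trail_count E P Q c = trail_count F P' Q' c" by simp
  have "int (trail_count E Q R c) = int (trail_count F Q' R' c)" for c
    unfolding E.trail_count_class_sum F.trail_count_class_sum eq by (simp add: g_gcd)
  then have N2: "\<forall>c\<in>{1..gcd ?y ?z}. trail_count E Q R c = trail_count F Q' R' c" by simp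
  have N: "rat_of_nat (trail_count F P' R' c) - rat_of_nat (trail_count E P R c) =
      rat_of_int (class_sum (gcd ?x ?z) ?h' (int c) - class_sum (gcd ?x ?z) ?h (int c))" for c
    using E.trail_count_class_sum[of P R c] F.trail_count_class_sum[of P' R' c] eq
    by (metis of_int_diff of_int_of_nat_eq)
  obtain gs ls :: "nat \<Rightarrow> int" where
    dvd: "\<forall>a\<in>{1..?d}. int (lcm ?x ?y) dvd ls a \<and> int (lcm ?y ?z) dvd gs a"
    and ls0: "\<forall>a\<in>{1..?d}. class_sum ?d ?f (int a) = 0 \<longrightarrow> ls a = 0"
    and gs0: "\<forall>b\<in>{1..?d}. class_sum ?d ?g (int b) = 0 \<longrightarrow> gs b = 0"
    and diff: "\<forall>k. rat_of_int (class_sum (gcd ?x ?z) ?h' (int k) - class_sum (gcd ?x ?z) ?h (int k)) =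
       rat_of_nat ?d / rat_of_nat (?y * gcd ?x ?z) * rat_of_int
       ((\<Sum>(a, b) \<in> {(a, b). a \<in> {1..?d} \<and> b \<in> {1..?d} \<and> [a + b = k] (mod ?d)}.
          class_sum ?d ?f (int a) * gs b) +
        (\<Sum>(a, b) \<in> {(a, b). a \<in> {1..?d} \<and> b \<in> {1..?d} \<and> [a + b = k] (mod ?d)}.
          ls a * class_sum ?d ?g (int b)))"
    using trail_relation_counts[OF rel pos f_x g_z] by (elim exE conjE) (rule that)
  have ls0': "\<forall>a\<in>{1..?d}. trail_sum E P Q ?d a = 0 \<longrightarrow> ls a = 0"
    using ls0 unfolding S1[symmetric] by simp
  have gs0': "\<forall>b\<in>{1..?d}. trail_sum E Q R ?d b = 0 \<longrightarrow> gs b = 0"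
    using gs0 unfolding S2[symmetric] by simp
  note diff' = diff[folded N S1 S2]
  show ?thesis
    unfolding meteor_equiv_def Let_def
    by (intro conjI exI[of _ gs] exI[of _ ls] eq(1-3) N1 N2 dvd ls0' gs0')
      (rule ballI, rule diff'[rule_format])
qed

end
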